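(* Let $E$ be a Banach lattice, let $K$ be a compact Hausdorff space, and let $m:C(K)\to L(E)$ be a bounded unital algebra homomorphism, with Arens extension $m^{*}:C(K)''\to L(E')$. Consider the following statements: (1) Each closed $C(K)$-invariant subspace of $E$ (that is, each closed linear subspace $F$ of $E$ with $m(a)F\subseteq F$ for all $a\in C(K)$) is an order ideal of $E$. (2) $Z(E')=m^{*}(C(K)'')$. (3) $Z(E)$ equals the closure of $m(C(K))$ in $L(E)$ with respect to the weak operator topology. Then (1) and (2) are equivalent, and (2) implies (3). Moreover, if (1) (equivalently (2)) holds, then $m$ is positive (i.e. $m(a)$ is a positive operator on $E$ whenever $a\ge 0$ in $C(K)$) and contractive (i.e. $\|m(a)\|\le\|a\|_\infty$ for all $a\in C(K)$).
   Context: Scalars may be real or complex throughout; the result is asserted in either case. $L(E)$ denotes the algebra of bounded linear operators on $E$, $E'$ is the Banach dual of $E$ (a Banach lattice), and $C(K)$ is the Banach algebra of continuous scalar functions on $K$ with the sup norm. Ideal center: for a Banach lattice $E$, $Z(E)$ is the set of all $T\in L(E)$ for which there is $M>0$ with $|T(x)|\le Mx$ for every $x\in E_+$. Likewise $Z(E')$ is the ideal center of the Banach lattice $E'$. Arens extension: given $m$, write $ax=m(a)(x)$ for $a\in C(K)$, $x\in E$. For $x\in E$, $x'\in E'$ define $\mu_{xx'}\in C(K)'$ by $\mu_{xx'}(a)=x'(ax)$ for $a\in C(K)$. For $a\in C(K)''$ and $x'\in E'$ define $ax'\in E'$ by $(ax')(x)=a(\mu_{xx'})$ for $x\in E$. Then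 $m^{*}:C(K)''\to L(E')$ is defined by $m^{*}(a)(x')=ax'$. It is a bounded unital algebra homomorphism when $C(K)''$ is given its Arens product (under which $C(K)''$ is isomorphic to $C(S)$ for a hyperstonian compact space $S$), and for $a\in C(K)$, $m^*(a)$ is the adjoint of $m(a)$. *)

theory Defs
  imports "HOL-Analysis.Analysis" "HOL-Library.Lattice_Algebras"
begin

section \<open>Real Banach lattices\<close>

class banach_lattice = banach + ordered_real_vector + lattice_ab_group_add_abs +
  assumes norm_mono_abs: "\<bar>x\<bar> \<le> \<bar>y\<bar> \<Longrightarrow> norm x \<le> norm y"

lemma norm_abs_lattice [simp]: "norm \<bar>x\<bar> = norm (x :: 'a :: banach_lattice)"
  by (intro order.antisym norm_mono_abs) auto

lemma norm_mono_nonneg: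
  fixes x y :: "'a :: banach_lattice"
  assumes "0 \<le> x" "x \<le> y"
  shows "norm x \<le> norm y"
  using assms by (intro norm_mono_abs) (auto simp: abs_of_nonneg intro: order_trans)

lemma norm_le_of_abs_le:
  fixes x y :: "'a :: banach_lattice"
  assumes "\<bar>x\<bar> \<le> y"
  shows "norm x \<le> norm y"
  using norm_mono_nonneg[OF abs_ge_zero assms] by simp

lemma lattice_LIMSEQ_nonneg:
  fixes X :: "nat \<Rightarrow> 'a :: banach_lattice"
  assumes X: "X \<longlonglongrightarrow> x" and nonneg: "\<And>n. 0 \<le> X n"
  shows "0 \<le> x"
proof -
  have le: "norm (sup (- x) 0) \<le> norm (X n - x)" for n
  proof -
    have "- x \<le> X n - x" using nonneg[of n] by simp
    also have "\<dots> \<le> \<bar>X n - x\<bar>" by (rule abs_ge_self)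
    finally have "sup (- x) 0 \<le> \<bar>X n - x\<bar>" by simp
    then have "norm (sup (- x) 0) \<le> norm \<bar>X n - x\<bar>"
      by (intro norm_mono_nonneg) auto
    then show ?thesis by simp
  qed
  have "(\<lambda>n. norm (X n - x)) \<longlonglongrightarrow> 0"
    using X by (simp add: LIM_zero tendsto_norm_zero)
  then have "norm (sup (- x) 0) \<le> 0"
    by (rule LIMSEQ_le_const) (use le in auto)
  then have "sup (- x) 0 = 0" by simp
  then have "- x \<le> 0" by (metis sup_ge1)
  then show ?thesis by simp
qed

lemma lattice_LIMSEQ_le:
  fixes X Y :: "nat \<Rightarrow> 'a :: banach_lattice"
  assumes "X \<longlonglongrightarrow> x" "Y \<longlonglongrightarrow> y" "\<And>n. X n \<le> Y n"
  shows "x \<le> y"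
  using lattice_LIMSEQ_nonneg[OF tendsto_diff[OF assms(2,1)]] assms(3) by simp

lemma abs_scaleR_lattice:
  fixes x :: "'a :: banach_lattice"
  shows "\<bar>r *\<^sub>R x\<bar> = \<bar>r\<bar> *\<^sub>R \<bar>x\<bar>"
proof -
  have le: "\<bar>r *\<^sub>R x\<bar> \<le> \<bar>r\<bar> *\<^sub>R \<bar>x\<bar>" for r and x :: 'a
  proof (rule abs_leI)
    have *: "s *\<^sub>R x \<le> \<bar>s\<bar> *\<^sub>R \<bar>x\<bar>" for s
    proof (cases "0 \<le> s")
      case True
      then show ?thesis by (simp add: scaleR_left_mono abs_ge_self)
    next
      case False
      then have "(- s) *\<^sub>R (- x) \<le> (- s) *\<^sub>R \<bar>x\<bar>"
        by (intro scaleR_left_mono) (use abs_ge_minus_self[of x] in auto)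
      then show ?thesis using False by simp
    qed
    show "r *\<^sub>R x \<le> \<bar>r\<bar> *\<^sub>R \<bar>x\<bar>" by (rule *)
    show "- (r *\<^sub>R x) \<le> \<bar>r\<bar> *\<^sub>R \<bar>x\<bar>" using *[of "- r"] by simp
  qed
  show ?thesis
  proof (cases "r = 0")
    case False
    have "\<bar>x\<bar> = \<bar>inverse r *\<^sub>R (r *\<^sub>R x)\<bar>" using False by simp
    also have "\<dots> \<le> \<bar>inverse r\<bar> *\<^sub>R \<bar>r *\<^sub>R x\<bar>" by (rule le)
    finally have "\<bar>r\<bar> *\<^sub>R \<bar>x\<bar> \<le> \<bar>r\<bar> *\<^sub>R (\<bar>inverse r\<bar> *\<^sub>R \<bar>r *\<^sub>R x\<bar>)"
      by (intro scaleR_left_mono) auto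
    also have "\<dots> = \<bar>r *\<^sub>R x\<bar>"
      using False by (simp flip: abs_mult)
    finally show ?thesis using le by (intro order.antisym) auto
  qed simp
qed


section \<open>The dual of a real normed space, and of a real Banach lattice\<close>

text \<open>A copy of the type of bounded linear functionals, so that it can carry the dual order;
  the order cannot be put on \<^typ>\<open>'a \<Rightarrow>\<^sub>L real\<close> itself by a type class instance.\<close>

typedef (overloaded) 'a dual = "UNIV :: ('a::real_normed_vector \<Rightarrow>\<^sub>L real) set"
  morphisms blinfun_of_dual Dual by simp

setup_lifting type_definition_dual

lift_definition dual_apply :: "'a::real_normed_vector dual \<Rightarrow> 'a \<Rightarrow> real" is blinfun_apply .

declare [[coercion "dual_apply :: ('a::real_normed_vector) dual \<Rightarrow> 'a \<Rightarrow> real"]]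

lemma dual_eqI: "(\<And>x. dual_apply f x = dual_apply g x) \<Longrightarrow> f = g"
  by transfer (rule blinfun_eqI)

instantiation dual :: (real_normed_vector) real_normed_vector
begin

lift_definition zero_dual :: "'a dual" is 0 .
lift_definition plus_dual :: "'a dual \<Rightarrow> 'a dual \<Rightarrow> 'a dual" is "(+)" .
lift_definition minus_dual :: "'a dual \<Rightarrow> 'a dual \<Rightarrow> 'a dual" is "(-)" .
lift_definition uminus_dual :: "'a dual \<Rightarrow> 'a dual" is uminus .
lift_definition scaleR_dual :: "real \<Rightarrow> 'a dual \<Rightarrow> 'a dual" is "(*\<^sub>R)" .
lift_definition norm_dual :: "'a dual \<Rightarrow> real" is norm .

definition dist_dual :: "'a dual \<Rightarrow> 'a dual \<Rightarrow> real"
  where "dist_dual f g = norm (f - g)"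
definition uniformity_dual :: "('a dual \<times> 'a dual) filter"
  where "uniformity_dual = (INF e\<in>{0<..}. principal {(f, g). dist f g < e})"
definition open_dual :: "'a dual set \<Rightarrow> bool"
  where "open_dual S = (\<forall>f\<in>S. \<forall>\<^sub>F (f', g) in uniformity. f' = f \<longrightarrow> g \<in> S)"
definition sgn_dual :: "'a dual \<Rightarrow> 'a dual"
  where "sgn_dual f = scaleR (inverse (norm f)) f"

instance
proof
  fix f g :: "'a dual"
  show "norm (f + g) \<le> norm f + norm g" by transfer (rule norm_triangle_ineq)
qed (unfold dist_dual_def uniformity_dual_def open_dual_def sgn_dual_def,
     (rule refl | (transfer, simp add: algebra_simps))+)

end

lemma dual_apply_simps [simp]:
  "dual_apply 0 x = 0"
  "dual_apply (f + g) x = f x + g x"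
  "dual_apply (f - g) x = f x - g x"
  "dual_apply (- f) x = - f x"
  "dual_apply (r *\<^sub>R f) x = r * f x"
  by (transfer; simp add: blinfun.bilinear_simps)+

lemma norm_dual_apply: "\<bar>dual_apply f x\<bar> \<le> norm f * norm x"
  by transfer (metis norm_blinfun real_norm_def)

lemma norm_dual_bound: "0 \<le> b \<Longrightarrow> (\<And>x. \<bar>dual_apply f x\<bar> \<le> b * norm x) \<Longrightarrow> norm f \<le> b"
  by transfer (simp add: norm_blinfun_bound)

lemma bounded_linear_dual_apply: "bounded_linear (dual_apply f)"
  by transfer (rule blinfun.bounded_linear_right)

lemma dual_apply_Dual: "bounded_linear f \<Longrightarrow> dual_apply (Dual (Blinfun f)) = f"
  by (simp add: dual_apply.abs_eq bounded_linear_Blinfun_apply)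

instance dual :: (real_normed_vector) banach
proof
  fix X :: "nat \<Rightarrow> 'a dual"
  assume "Cauchy X"
  then have "Cauchy (\<lambda>n. blinfun_of_dual (X n))"
    unfolding Cauchy_iff by (simp add: norm_dual.rep_eq minus_dual.rep_eq)
  then obtain L where "(\<lambda>n. blinfun_of_dual (X n)) \<longlonglongrightarrow> L"
    using Cauchy_convergent convergent_def by blast
  then have "X \<longlonglongrightarrow> Dual L"
    unfolding LIMSEQ_iff by (simp add: norm_dual.rep_eq minus_dual.rep_eq Dual_inverse)
  then show "convergent X" by (rule convergentI)
qed

text \<open>Riesz--Kantorovich: for \<open>x \<ge> 0\<close> the modulus of \<open>f\<close> in the dual takes the value
  \<open>sup {f y | \<bar>y\<bar> \<le> x}\<close> at \<open>x\<close>; \<open>rk_lin\<close> is its linear extension.\<close>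

definition rk_set :: "'a::banach_lattice dual \<Rightarrow> 'a \<Rightarrow> real set"
  where "rk_set f x = {dual_apply f y |y. \<bar>y\<bar> \<le> x}"

lemma riesz_decomposition:
  fixes y :: "'a :: banach_lattice"
  assumes "\<bar>y\<bar> \<le> u + v" "0 \<le> u" "0 \<le> v"
  obtains y1 y2 where "y = y1 + y2" "\<bar>y1\<bar> \<le> u" "\<bar>y2\<bar> \<le> v"
proof
  define y1 where "y1 = sup (- u) (inf y u)"
  show "y = y1 + (y - y1)" by simp
  have nu: "- u \<le> u" using assms(2) by (meson neg_le_0_iff_le order_trans)
  have y: "y \<le> u + v" "- y \<le> u + v"
    using assms(1) abs_ge_self abs_ge_minus_self order_trans by blast+
  show "\<bar>y1\<bar> \<le> u"
  proof (rule abs_leI)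
    show "y1 \<le> u" using nu by (simp add: y1_def)
    show "- y1 \<le> u" by (simp add: y1_def minus_le_iff)
  qed
  show "\<bar>y - y1\<bar> \<le> v"
  proof (rule abs_leI)
    have "y - v \<le> y" "y - v \<le> u" using assms(3) y(1) by (simp_all add: diff_le_eq)
    then have "y - v \<le> y1" unfolding y1_def by (intro le_supI2) simp
    then show "y - y1 \<le> v" by (simp add: algebra_simps)
    have "inf y u \<le> y + v" using assms(3) by (intro le_infI1) simp
    moreover have "- u \<le> y + v" using y(2) by (metis add.commute diff_le_eq minus_diff_eq minus_le_iff neg_le_iff_le uminus_add_conv_diff)
    ultimately have "y1 \<le> y + v" by (simp add: y1_def)
    then show "- (y - y1) \<le> v" by (simp add: algebra_simps)
  qed
qed

lemma rk_set_bound: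
  assumes "t \<in> rk_set f x"
  shows "t \<le> norm f * norm x"
proof -
  obtain y where y: "t = dual_apply f y" "\<bar>y\<bar> \<le> x" using assms by (auto simp: rk_set_def)
  have "t \<le> norm f * norm y" using norm_dual_apply[of f y] y(1) by simp
  also have "\<dots> \<le> norm f * norm x"
    by (intro mult_left_mono norm_le_of_abs_le y) auto
  finally show ?thesis .
qed

lemma rk_set_bdd: "bdd_above (rk_set f x)"
  using rk_set_bound by (intro bdd_aboveI) blast

lemma rk_set_nonempty: "0 \<le> x \<Longrightarrow> rk_set f x \<noteq> {}"
  by (auto simp: rk_set_def intro!: exI[of _ 0])

definition rk :: "'a::banach_lattice dual \<Rightarrow> 'a \<Rightarrow> real"
  where "rk f x = Sup (rk_set f x)"

lemma rk_upper: "\<bar>y\<bar> \<le> x \<Longrightarrow> dual_apply f y \<le> rk f x"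
  unfolding rk_def by (intro cSup_upper rk_set_bdd) (auto simp: rk_set_def)

lemma rk_least: "0 \<le> x \<Longrightarrow> (\<And>y. \<bar>y\<bar> \<le> x \<Longrightarrow> dual_apply f y \<le> b) \<Longrightarrow> rk f x \<le> b"
  unfolding rk_def by (intro cSup_least rk_set_nonempty) (auto simp: rk_set_def)

lemma rk_nonneg: "0 \<le> x \<Longrightarrow> 0 \<le> rk f x"
  using rk_upper[of 0 x f] bounded_linear.linear[OF bounded_linear_dual_apply[of f]]
  by (simp add: linear_0)

lemma rk_bound: "0 \<le> x \<Longrightarrow> rk f x \<le> norm f * norm x"
  unfolding rk_def by (intro cSup_least rk_set_nonempty) (auto intro: rk_set_bound)

lemma dual_apply_add: "dual_apply f (x + y) = f x + f y"
  and dual_apply_diff: "dual_apply f (x - y) = f x - f y"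
  and dual_apply_minus: "dual_apply f (- x) = - f x"
  and dual_apply_scaleR: "dual_apply f (r *\<^sub>R x) = r * f x"
  by (transfer; simp add: blinfun.bilinear_simps)+

lemma rk_add:
  assumes "0 \<le> u" "0 \<le> v"
  shows "rk f (u + v) = rk f u + rk f v"
proof (rule order.antisym)
  show "rk f (u + v) \<le> rk f u + rk f v"
  proof (rule rk_least)
    show "0 \<le> u + v" using assms by simp
    fix y assume "\<bar>y\<bar> \<le> u + v"
    then obtain y1 y2 where "y = y1 + y2" "\<bar>y1\<bar> \<le> u" "\<bar>y2\<bar> \<le> v"
      using riesz_decomposition assms by blast
    then show "dual_apply f y \<le> rk f u + rk f v"
      using rk_upper[of y1 u f] rk_upper[of y2 v f] by (simp add: dual_apply_add)
  qed
  have "rk f u \<le> rk f (u + v) - rk f v"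
  proof (rule rk_least[OF assms(1)])
    fix y assume y: "\<bar>y\<bar> \<le> u"
    have "rk f v \<le> rk f (u + v) - dual_apply f y"
    proof (rule rk_least[OF assms(2)])
      fix z assume "\<bar>z\<bar> \<le> v"
      then have "\<bar>y + z\<bar> \<le> u + v"
        using y abs_triangle_ineq[of y z] add_mono order_trans by blast
      from rk_upper[OF this, of f]
      show "dual_apply f z \<le> rk f (u + v) - dual_apply f y" by (simp add: dual_apply_add)
    qed
    then show "dual_apply f y \<le> rk f (u + v) - rk f v" by simp
  qed
  then show "rk f u + rk f v \<le> rk f (u + v)" by simp
qed

lemma rk_scale_le:
  assumes "0 \<le> x" "0 < r"
  shows "rk f (r *\<^sub>R x) \<le> r * rk f x"
proof (rule rk_least)
  show "0 \<le> r *\<^sub>R x" using assms by (simp add: scaleR_nonneg_nonneg)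
  fix y assume "\<bar>y\<bar> \<le> r *\<^sub>R x"
  then have "inverse r *\<^sub>R \<bar>y\<bar> \<le> inverse r *\<^sub>R (r *\<^sub>R x)"
    using assms by (intro scaleR_left_mono) auto
  then have "\<bar>inverse r *\<^sub>R y\<bar> \<le> x" using assms by (simp add: abs_scaleR_lattice)
  from rk_upper[OF this, of f] show "dual_apply f y \<le> r * rk f x"
    using assms by (simp add: dual_apply_scaleR field_simps)
qed

lemma rk_scale:
  assumes "0 \<le> x" "0 < r"
  shows "rk f (r *\<^sub>R x) = r * rk f x"
proof (rule order.antisym[OF rk_scale_le[OF assms]])
  have "rk f (inverse r *\<^sub>R (r *\<^sub>R x)) \<le> inverse r * rk f (r *\<^sub>R x)"
    using assms by (intro rk_scale_le scaleR_nonneg_nonneg) auto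
  then show "r * rk f x \<le> rk f (r *\<^sub>R x)" using assms by (simp add: field_simps)
qed

definition rk_lin :: "'a::banach_lattice dual \<Rightarrow> 'a \<Rightarrow> real"
  where "rk_lin f x = rk f (sup x 0) - rk f (sup (- x) 0)"

lemma pos_neg_parts:
  fixes x :: "'a :: banach_lattice"
  shows "x = sup x 0 - sup (- x) 0" "\<bar>x\<bar> = sup x 0 + sup (- x) 0"
proof -
  have n: "nprt x = - sup (- x) 0" unfolding nprt_def inf_eq_neg_sup[of x 0] by simp
  show "x = sup x 0 - sup (- x) 0"
    using prts[of x] unfolding n pprt_def diff_conv_add_uminus .
  show "\<bar>x\<bar> = sup x 0 + sup (- x) 0"
    using abs_prts[of x] unfolding n pprt_def diff_minus_eq_add .
qed

lemma rk_lin_diff: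
  assumes "0 \<le> u" "0 \<le> v"
  shows "rk_lin f (u - v) = rk f u - rk f v"
proof -
  define p n where "p = sup (u - v) 0" and "n = sup (- (u - v)) 0"
  have pn: "0 \<le> p" "0 \<le> n" by (simp_all only: p_def n_def sup_ge2)
  have "u - v = p - n" unfolding p_def n_def by (rule pos_neg_parts(1))
  then have eq: "u + n = v + p" by (simp add: diff_eq_eq eq_diff_eq algebra_simps)
  have "rk f u + rk f n = rk f (u + n)" by (rule rk_add[symmetric]) (use assms pn in auto)
  also have "\<dots> = rk f v + rk f p" unfolding eq by (rule rk_add) (use assms pn in auto)
  finally show ?thesis unfolding rk_lin_def p_def[symmetric] n_def[symmetric] by linarith
qed

lemma rk_lin_nonneg_eq: "0 \<le> x \<Longrightarrow> rk_lin f x = rk f x"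
  using rk_lin_diff[of x 0 f] rk_add[of 0 0 f] by simp

lemma bounded_linear_rk_lin: "bounded_linear (rk_lin f)"
proof (rule bounded_linear_intro)
  fix x y :: 'a
  have "x + y = (sup x 0 + sup y 0) - (sup (- x) 0 + sup (- y) 0)"
  proof -
    define p n where "p = sup x 0" and "n = sup (- x) 0"
    define q k where "q = sup y 0" and "k = sup (- y) 0"
    have "x = p - n" "y = q - k"
      unfolding p_def n_def q_def k_def by (rule pos_neg_parts(1))+
    then have "x + y = (p + q) - (n + k)" by simp
    then show ?thesis by (simp only: p_def n_def q_def k_def)
  qed
  moreover have "rk_lin f ((sup x 0 + sup y 0) - (sup (- x) 0 + sup (- y) 0)) =
      rk f (sup x 0 + sup y 0) - rk f (sup (- x) 0 + sup (- y) 0)"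
    by (intro rk_lin_diff add_nonneg_nonneg) auto
  ultimately have "rk_lin f (x + y) =
      rk f (sup x 0 + sup y 0) - rk f (sup (- x) 0 + sup (- y) 0)" by (simp only:)
  then show "rk_lin f (x + y) = rk_lin f x + rk_lin f y"
    by (simp add: rk_add rk_lin_def)
next
  fix r :: real and x :: 'a
  consider "r = 0" | "r > 0" | "r < 0" by linarith
  then show "rk_lin f (r *\<^sub>R x) = r *\<^sub>R rk_lin f x"
  proof cases
    case 1
    then show ?thesis using rk_lin_diff[of 0 0 f] by simp
  next
    case 2
    have "r *\<^sub>R x = r *\<^sub>R sup x 0 - r *\<^sub>R sup (- x) 0"
      using arg_cong[OF pos_neg_parts(1)[of x], of "scaleR r"] unfolding scaleR_diff_right .
    moreover have "rk_lin f (r *\<^sub>R sup x 0 - r *\<^sub>R sup (- x) 0) =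
        rk f (r *\<^sub>R sup x 0) - rk f (r *\<^sub>R sup (- x) 0)"
      using 2 by (intro rk_lin_diff scaleR_nonneg_nonneg) auto
    ultimately have "rk_lin f (r *\<^sub>R x) =
        rk f (r *\<^sub>R sup x 0) - rk f (r *\<^sub>R sup (- x) 0)" by (simp only:)
    then show ?thesis using 2 by (simp add: rk_scale rk_lin_def algebra_simps)
  next
    case 3
    have "r *\<^sub>R x = (- r) *\<^sub>R sup (- x) 0 - (- r) *\<^sub>R sup x 0"
      using arg_cong[OF pos_neg_parts(1)[of x], of "scaleR r"]
      unfolding scaleR_diff_right scaleR_minus_left by simp
    moreover have "rk_lin f ((- r) *\<^sub>R sup (- x) 0 - (- r) *\<^sub>R sup x 0) =
        rk f ((- r) *\<^sub>R sup (- x) 0) - rk f ((- r) *\<^sub>R sup x 0)"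
      using 3 by (intro rk_lin_diff scaleR_nonneg_nonneg) auto
    ultimately have "rk_lin f (r *\<^sub>R x) =
        rk f ((- r) *\<^sub>R sup (- x) 0) - rk f ((- r) *\<^sub>R sup x 0)" by (simp only:)
    then show ?thesis
      using 3 rk_scale[of "sup x 0" "- r" f] rk_scale[of "sup (- x) 0" "- r" f]
      by (simp add: rk_lin_def algebra_simps del: scaleR_minus_left)
  qed
next
  fix x :: 'a
  have "rk f (sup x 0) \<le> norm f * norm x" "rk f (sup (- x) 0) \<le> norm f * norm x"
  proof -
    have "norm (sup x 0) \<le> norm x" "norm (sup (- x) 0) \<le> norm x"
      using norm_mono_nonneg[of "sup x 0" "\<bar>x\<bar>"] norm_mono_nonneg[of "sup (- x) 0" "\<bar>x\<bar>"]
      by (simp_all add: abs_ge_self abs_ge_minus_self)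
    then show "rk f (sup x 0) \<le> norm f * norm x" "rk f (sup (- x) 0) \<le> norm f * norm x"
      using rk_bound[of "sup x 0" f] rk_bound[of "sup (- x) 0" f]
      by (meson mult_left_mono norm_ge_zero order_trans sup_ge2)+
  qed
  then show "norm (rk_lin f x) \<le> norm x * norm f"
    using rk_nonneg[of "sup x 0" f] rk_nonneg[of "sup (- x) 0" f]
    by (simp add: rk_lin_def mult.commute abs_le_iff)
qed

instantiation dual :: (banach_lattice) banach_lattice
begin

definition less_eq_dual :: "'a dual \<Rightarrow> 'a dual \<Rightarrow> bool"
  where "f \<le> g \<longleftrightarrow> (\<forall>x\<ge>0. dual_apply f x \<le> dual_apply g x)"
definition less_dual :: "'a dual \<Rightarrow> 'a dual \<Rightarrow> bool"
  where "f < g \<longleftrightarrow> f \<le> g \<and> f \<noteq> (g :: 'a dual)"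
definition abs_dual :: "'a dual \<Rightarrow> 'a dual"
  where "\<bar>f\<bar> = Dual (Blinfun (rk_lin f))"
definition sup_dual :: "'a dual \<Rightarrow> 'a dual \<Rightarrow> 'a dual"
  where "sup_dual f g = (1/2 :: real) *\<^sub>R (f + g + \<bar>f - g\<bar>)"
definition inf_dual :: "'a dual \<Rightarrow> 'a dual \<Rightarrow> 'a dual"
  where "inf_dual f g = (1/2) *\<^sub>R (f + g - \<bar>f - g\<bar>)"

lemma abs_dual_apply: "0 \<le> x \<Longrightarrow> dual_apply \<bar>f\<bar> x = rk f x"
  by (simp add: abs_dual_def dual_apply_Dual bounded_linear_rk_lin rk_lin_nonneg_eq)

lemma abs_dual_upper: "0 \<le> x \<Longrightarrow> dual_apply f x \<le> dual_apply \<bar>f\<bar> x"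
  "0 \<le> x \<Longrightarrow> - dual_apply f x \<le> dual_apply \<bar>f\<bar> x"
  using rk_upper[of x x f] rk_upper[of "- x" x f]
  by (auto simp: abs_dual_apply dual_apply_minus abs_of_nonneg)

lemma abs_dual_least:
  fixes f g :: "'a dual"
  assumes "f \<le> g" "- f \<le> g" "0 \<le> x"
  shows "dual_apply \<bar>f\<bar> x \<le> dual_apply g x"
  unfolding abs_dual_apply[OF assms(3)]
proof (rule rk_least[OF assms(3)])
  fix y assume y: "\<bar>y\<bar> \<le> x"
  let ?p = "sup y 0" and ?n = "sup (- y) 0"
  have "dual_apply f y = dual_apply f ?p - dual_apply f ?n"
    using pos_neg_parts(1)[of y] by (metis dual_apply_diff)
  also have "\<dots> \<le> dual_apply g ?p + dual_apply g ?n"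
    using assms(1,2) unfolding less_eq_dual_def
    by (metis add_mono diff_conv_add_uminus dual_apply_simps(4) sup_ge2)
  also have "\<dots> = dual_apply g \<bar>y\<bar>"
    using pos_neg_parts(2)[of y] by (simp add: dual_apply_add)
  also have "\<dots> \<le> dual_apply g x"
  proof -
    have "- dual_apply g z \<le> dual_apply g z" if "0 \<le> z" for z
      using assms(1,2) that unfolding less_eq_dual_def by fastforce
    from this[of "x - \<bar>y\<bar>"] y show ?thesis by (simp add: dual_apply_diff)
  qed
  finally show "dual_apply f y \<le> dual_apply g x" .
qed

lemma dual_antisym:
  fixes f g :: "'a dual"
  assumes "f \<le> g" "g \<le> f"
  shows "f = g"
proof (rule dual_eqI)
  fix x :: 'a
  have "dual_apply f z = dual_apply g z" if "0 \<le> z" for z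
    using assms that by (auto simp: less_eq_dual_def intro: order.antisym)
  then show "dual_apply f x = dual_apply g x"
    using pos_neg_parts(1)[of x] by (metis dual_apply_diff sup_ge2)
qed

lemma abs_minus_dual: "\<bar>- f\<bar> = \<bar>f :: 'a dual\<bar>"
proof (rule dual_antisym)
  have *: "\<bar>- f\<bar> \<le> \<bar>f\<bar>" for f :: "'a dual"
    unfolding less_eq_dual_def
  proof (intro allI impI)
    fix x :: 'a assume "0 \<le> x"
    then show "dual_apply \<bar>- f\<bar> x \<le> dual_apply \<bar>f\<bar> x"
      by (intro abs_dual_least) (auto simp: less_eq_dual_def abs_dual_upper minus_le_iff
        intro: order_trans[OF _ abs_dual_upper(1)] order_trans[OF _ abs_dual_upper(2)])
  qed
  show "\<bar>- f\<bar> \<le> \<bar>f\<bar>" by (rule *)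
  show "\<bar>f\<bar> \<le> \<bar>- f\<bar>" using *[of "- f"] by simp
qed

instance
proof
  fix f g h :: "'a dual" and a b :: real
  show "f < g \<longleftrightarrow> f \<le> g \<and> \<not> g \<le> f"
    using dual_antisym[of f g] by (auto simp: less_dual_def)
  show "f \<le> f" by (simp add: less_eq_dual_def)
  show "f \<le> g \<Longrightarrow> g \<le> h \<Longrightarrow> f \<le> h" by (force simp: less_eq_dual_def)
  show "f \<le> g \<Longrightarrow> g \<le> f \<Longrightarrow> f = g" by (rule dual_antisym)
  show "f \<le> g \<Longrightarrow> h + f \<le> h + g" by (simp add: less_eq_dual_def)
  show "f \<le> g \<Longrightarrow> 0 \<le> a \<Longrightarrow> a *\<^sub>R f \<le> a *\<^sub>R g"
    by (simp add: less_eq_dual_def mult_left_mono)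
  show "a \<le> b \<Longrightarrow> 0 \<le> f \<Longrightarrow> a *\<^sub>R f \<le> b *\<^sub>R f"
    by (simp add: less_eq_dual_def mult_right_mono)
  show "f \<le> sup f g" "g \<le> sup f g" "inf f g \<le> f" "inf f g \<le> g"
    using abs_dual_upper[of _ "f - g"] by (force simp: less_eq_dual_def sup_dual_def inf_dual_def)+
  show "sup g h \<le> f" if "g \<le> f" "h \<le> f"
    unfolding less_eq_dual_def
  proof (intro allI impI)
    fix x :: 'a assume "0 \<le> x"
    then have "dual_apply \<bar>g - h\<bar> x \<le> dual_apply (2 *\<^sub>R f - g - h) x"
      using that by (intro abs_dual_least) (fastforce simp: less_eq_dual_def)+
    then show "dual_apply (sup g h) x \<le> dual_apply f x" by (simp add: sup_dual_def)
  qed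
  show "f \<le> inf g h" if "f \<le> g" "f \<le> h"
    unfolding less_eq_dual_def
  proof (intro allI impI)
    fix x :: 'a assume "0 \<le> x"
    then have "dual_apply \<bar>g - h\<bar> x \<le> dual_apply (g + h - 2 *\<^sub>R f) x"
      using that by (intro abs_dual_least) (fastforce simp: less_eq_dual_def)+
    then show "dual_apply f x \<le> dual_apply (inf g h) x" by (simp add: inf_dual_def)
  qed
  show "\<bar>f\<bar> = sup f (- f)"
  proof (rule dual_antisym)
    show "\<bar>f\<bar> \<le> sup f (- f)"
      unfolding less_eq_dual_def
    proof (intro allI impI)
      fix x :: 'a assume x: "0 \<le> x"
      have "f \<le> sup f (- f)" "- f \<le> sup f (- f)"
        using abs_dual_upper[of _ "f - - f"]
        by (force simp: less_eq_dual_def sup_dual_def)+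
      then show "dual_apply \<bar>f\<bar> x \<le> dual_apply (sup f (- f)) x"
        using x by (intro abs_dual_least)
    qed
    show "sup f (- f) \<le> \<bar>f\<bar>"
      unfolding less_eq_dual_def
    proof (intro allI impI)
      fix x :: 'a assume x: "0 \<le> x"
      have "dual_apply \<bar>f - - f\<bar> x \<le> dual_apply (2 *\<^sub>R \<bar>f\<bar>) x"
        using x abs_dual_upper[of _ f]
        by (intro abs_dual_least) (force simp: less_eq_dual_def)+
      then show "dual_apply (sup f (- f)) x \<le> dual_apply \<bar>f\<bar> x" by (simp add: sup_dual_def)
    qed
  qed
  show "norm f \<le> norm g" if "\<bar>f\<bar> \<le> \<bar>g\<bar>"
  proof (rule norm_dual_bound)
    fix x :: 'a
    have "dual_apply f x \<le> rk f \<bar>x\<bar>" "- dual_apply f x \<le> rk f \<bar>x\<bar>"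
      using rk_upper[of x "\<bar>x\<bar>" f] rk_upper[of "- x" "\<bar>x\<bar>" f]
      by (simp_all add: dual_apply_minus)
    moreover have "rk f \<bar>x\<bar> \<le> rk g \<bar>x\<bar>"
      using that by (auto simp: less_eq_dual_def simp flip: abs_dual_apply)
    moreover have "rk g \<bar>x\<bar> \<le> norm g * norm x"
      using rk_bound[of "\<bar>x\<bar>" g] by simp
    ultimately show "\<bar>dual_apply f x\<bar> \<le> norm g * norm x" by simp
  qed simp
qed

end


section \<open>Complex normed spaces and their duals\<close>

class scaleC =
  fixes scaleC :: "complex \<Rightarrow> 'a \<Rightarrow> 'a" (infixr \<open>*\<^sub>C\<close> 75)

class complex_normed_vector = real_normed_vector + scaleC +
  assumes scaleC_add_right: "c *\<^sub>C (x + y) = c *\<^sub>C x + c *\<^sub>C y"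
    and scaleC_add_left: "(c + d) *\<^sub>C x = c *\<^sub>C x + d *\<^sub>C x"
    and scaleC_scaleC: "c *\<^sub>C (d *\<^sub>C x) = (c * d) *\<^sub>C x"
    and scaleC_of_real: "complex_of_real r *\<^sub>C x = r *\<^sub>R x"
    and norm_scaleC: "norm (c *\<^sub>C x) = cmod c * norm x"

instantiation complex :: complex_normed_vector
begin

definition scaleC_complex :: "complex \<Rightarrow> complex \<Rightarrow> complex"
  where "scaleC_complex c x = c * x"

instance
  by standard (simp_all add: scaleC_complex_def algebra_simps norm_mult scaleR_conv_of_real)

end

lemma bounded_linear_scaleC: "bounded_linear (\<lambda>x :: 'a :: complex_normed_vector. c *\<^sub>C x)"
proof (rule bounded_linear_intro)
  fix x y :: 'a and r :: real
  show "c *\<^sub>C (x + y) = c *\<^sub>C x + c *\<^sub>C y" by (rule scaleC_add_right)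
  show "c *\<^sub>C (r *\<^sub>R x) = r *\<^sub>R (c *\<^sub>C x)"
    by (simp add: scaleC_scaleC mult.commute flip: scaleC_of_real)
  show "norm (c *\<^sub>C x) \<le> norm x * cmod c" by (simp add: norm_scaleC mult.commute)
qed

lemma scaleC_zero_right [simp]: "c *\<^sub>C 0 = (0 :: 'a :: complex_normed_vector)"
  using linear_0[OF bounded_linear.linear[OF bounded_linear_scaleC]] .

typedef (overloaded) ('a, 'b) cblinfun (\<open>(_ \<Rightarrow>\<^sub>C\<^sub>L /_)\<close> [22, 21] 21) =
  "{f :: 'a::complex_normed_vector \<Rightarrow>\<^sub>L 'b::complex_normed_vector.
    \<forall>c x. f (c *\<^sub>C x) = c *\<^sub>C f x}"
  morphisms blinfun_of_cblinfun Abs_cblinfun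
  by (rule exI[of _ 0]) simp

setup_lifting type_definition_cblinfun

lift_definition cblinfun_apply ::
  "('a::complex_normed_vector \<Rightarrow>\<^sub>C\<^sub>L 'b::complex_normed_vector) \<Rightarrow> 'a \<Rightarrow> 'b"
  is blinfun_apply .

declare [[coercion "cblinfun_apply ::
  ('a::complex_normed_vector \<Rightarrow>\<^sub>C\<^sub>L 'b::complex_normed_vector) \<Rightarrow> 'a \<Rightarrow> 'b"]]

lemma cblinfun_eqI: "(\<And>x. cblinfun_apply f x = cblinfun_apply g x) \<Longrightarrow> f = g"
  by transfer (rule blinfun_eqI)

instantiation cblinfun :: (complex_normed_vector, complex_normed_vector) real_normed_vector
begin

lift_definition zero_cblinfun :: "'a \<Rightarrow>\<^sub>C\<^sub>L 'b" is 0 by simp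
lift_definition plus_cblinfun :: "('a \<Rightarrow>\<^sub>C\<^sub>L 'b) \<Rightarrow> ('a \<Rightarrow>\<^sub>C\<^sub>L 'b) \<Rightarrow> 'a \<Rightarrow>\<^sub>C\<^sub>L 'b" is "(+)"
  by (simp add: blinfun.add_left scaleC_add_right)
lift_definition minus_cblinfun :: "('a \<Rightarrow>\<^sub>C\<^sub>L 'b) \<Rightarrow> ('a \<Rightarrow>\<^sub>C\<^sub>L 'b) \<Rightarrow> 'a \<Rightarrow>\<^sub>C\<^sub>L 'b" is "(-)"
  by (simp add: blinfun.diff_left linear_diff[OF bounded_linear.linear[OF bounded_linear_scaleC]])
lift_definition uminus_cblinfun :: "('a \<Rightarrow>\<^sub>C\<^sub>L 'b) \<Rightarrow> 'a \<Rightarrow>\<^sub>C\<^sub>L 'b" is uminus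
  by (simp add: blinfun.minus_left linear_neg[OF bounded_linear.linear[OF bounded_linear_scaleC]])
lift_definition scaleR_cblinfun :: "real \<Rightarrow> ('a \<Rightarrow>\<^sub>C\<^sub>L 'b) \<Rightarrow> 'a \<Rightarrow>\<^sub>C\<^sub>L 'b" is "(*\<^sub>R)"
  by (simp add: blinfun.scaleR_left linear_scale[OF bounded_linear.linear[OF bounded_linear_scaleC]])
lift_definition norm_cblinfun :: "('a \<Rightarrow>\<^sub>C\<^sub>L 'b) \<Rightarrow> real" is norm .

definition dist_cblinfun :: "('a \<Rightarrow>\<^sub>C\<^sub>L 'b) \<Rightarrow> ('a \<Rightarrow>\<^sub>C\<^sub>L 'b) \<Rightarrow> real"
  where "dist_cblinfun f g = norm (f - g)"
definition uniformity_cblinfun :: "(('a \<Rightarrow>\<^sub>C\<^sub>L 'b) \<times> ('a \<Rightarrow>\<^sub>C\<^sub>L 'b)) filter"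
  where "uniformity_cblinfun = (INF e\<in>{0<..}. principal {(f, g). dist f g < e})"
definition open_cblinfun :: "('a \<Rightarrow>\<^sub>C\<^sub>L 'b) set \<Rightarrow> bool"
  where "open_cblinfun S = (\<forall>f\<in>S. \<forall>\<^sub>F (f', g) in uniformity. f' = f \<longrightarrow> g \<in> S)"
definition sgn_cblinfun :: "('a \<Rightarrow>\<^sub>C\<^sub>L 'b) \<Rightarrow> 'a \<Rightarrow>\<^sub>C\<^sub>L 'b"
  where "sgn_cblinfun f = scaleR (inverse (norm f)) f"

instance
proof
  fix f g :: "'a \<Rightarrow>\<^sub>C\<^sub>L 'b"
  show "norm (f + g) \<le> norm f + norm g" by transfer (rule norm_triangle_ineq)
qed (unfold dist_cblinfun_def uniformity_cblinfun_def open_cblinfun_def sgn_cblinfun_def,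
     (rule refl | (transfer, simp add: algebra_simps))+)

end

lemma cblinfun_apply_simps [simp]:
  "cblinfun_apply 0 x = 0"
  "cblinfun_apply (f + g) x = f x + g x"
  "cblinfun_apply (f - g) x = f x - g x"
  "cblinfun_apply (- f) x = - f x"
  "cblinfun_apply (r *\<^sub>R f) x = r *\<^sub>R f x"
  by (transfer; simp add: blinfun.bilinear_simps)+

lemma cblinfun_apply_right:
  "cblinfun_apply f (x + y) = f x + f y"
  "cblinfun_apply f (r *\<^sub>R x) = r *\<^sub>R f x"
  "cblinfun_apply f (c *\<^sub>C x) = c *\<^sub>C f x"
  by (transfer; simp add: blinfun.bilinear_simps)+

lemma norm_cblinfun_apply: "norm (cblinfun_apply f x) \<le> norm f * norm x"
  by transfer (rule norm_blinfun)

lemma norm_cblinfun_bound: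
  "0 \<le> b \<Longrightarrow> (\<And>x. norm (cblinfun_apply f x) \<le> b * norm x) \<Longrightarrow> norm f \<le> b"
  by transfer (rule norm_blinfun_bound)

lemma bounded_linear_cblinfun_apply: "bounded_linear (cblinfun_apply f)"
  by transfer (rule blinfun.bounded_linear_right)

definition CBlinfun ::
    "('a::complex_normed_vector \<Rightarrow> 'b::complex_normed_vector) \<Rightarrow> 'a \<Rightarrow>\<^sub>C\<^sub>L 'b"
  where "CBlinfun f = Abs_cblinfun (Blinfun f)"

lemma cblinfun_apply_CBlinfun:
  assumes "bounded_linear f" "\<And>c x. f (c *\<^sub>C x) = c *\<^sub>C f x"
  shows "cblinfun_apply (CBlinfun f) = f"
  using assms
  by (simp add: CBlinfun_def cblinfun_apply.rep_eq Abs_cblinfun_inverse bounded_linear_Blinfun_apply)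

instantiation cblinfun :: (complex_normed_vector, complex_normed_vector) complex_normed_vector
begin

definition scaleC_cblinfun :: "complex \<Rightarrow> ('a \<Rightarrow>\<^sub>C\<^sub>L 'b) \<Rightarrow> 'a \<Rightarrow>\<^sub>C\<^sub>L 'b"
  where "c *\<^sub>C f = CBlinfun (\<lambda>x. c *\<^sub>C cblinfun_apply f x)"

lemma scaleC_cblinfun_apply [simp]: "cblinfun_apply (c *\<^sub>C f) x = c *\<^sub>C f x"
  unfolding scaleC_cblinfun_def
  by (subst cblinfun_apply_CBlinfun)
     (auto simp: cblinfun_apply_right scaleC_scaleC mult.commute
       intro!: bounded_linear_compose[OF bounded_linear_scaleC] bounded_linear_cblinfun_apply)

instance
proof
  fix c d :: complex and r :: real and f g :: "'a \<Rightarrow>\<^sub>C\<^sub>L 'b"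
  have le: "norm (c *\<^sub>C f) \<le> cmod c * norm f" for c and f :: "'a \<Rightarrow>\<^sub>C\<^sub>L 'b"
    by (rule norm_cblinfun_bound)
       (auto simp: norm_scaleC mult.assoc intro!: mult_left_mono norm_cblinfun_apply)
  show sc: "c *\<^sub>C (d *\<^sub>C f) = (c * d) *\<^sub>C f" for c d and f :: "'a \<Rightarrow>\<^sub>C\<^sub>L 'b"
    by (rule cblinfun_eqI) (simp add: scaleC_scaleC)
  show re: "complex_of_real r *\<^sub>C f = r *\<^sub>R f" for r and f :: "'a \<Rightarrow>\<^sub>C\<^sub>L 'b"
    by (rule cblinfun_eqI) (simp add: scaleC_of_real)
  show "norm (c *\<^sub>C f) = cmod c * norm f"
  proof (cases "c = 0")
    case True
    then show ?thesis using re[of 0 f] by simp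
  next
    case False
    have "f = inverse c *\<^sub>C (c *\<^sub>C f)"
      using False re[of 1 f] by (simp add: sc)
    then have "norm f \<le> cmod (inverse c) * norm (c *\<^sub>C f)"
      using le by metis
    then have "cmod c * norm f \<le> norm (c *\<^sub>C f)"
      using False by (simp add: norm_inverse norm_divide field_simps)
    then show ?thesis using le[of c f] by (rule order.antisym[rotated])
  qed
qed (rule cblinfun_eqI; simp add: scaleC_add_right scaleC_add_left)+

end

lift_definition id_cblinfun :: "'a::complex_normed_vector \<Rightarrow>\<^sub>C\<^sub>L 'a" is id_blinfun by simp

lift_definition cblinfun_compose ::
  "('b::complex_normed_vector \<Rightarrow>\<^sub>C\<^sub>L 'c::complex_normed_vector) \<Rightarrow>
   ('a::complex_normed_vector \<Rightarrow>\<^sub>C\<^sub>L 'b) \<Rightarrow> 'a \<Rightarrow>\<^sub>C\<^sub>L 'c" (infixl \<open>o\<^sub>C\<^sub>L\<close> 55)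
  is "(o\<^sub>L)"
  by simp


section \<open>The algebra of continuous functions\<close>

unbundle bcontfun.lifting

instantiation bcontfun :: (topological_space, real_normed_algebra_1) real_normed_algebra_1
begin

lift_definition one_bcontfun :: "'a \<Rightarrow>\<^sub>C 'b" is "\<lambda>_. 1"
  by (rule const_bcontfun)

lift_definition times_bcontfun :: "('a \<Rightarrow>\<^sub>C 'b) \<Rightarrow> ('a \<Rightarrow>\<^sub>C 'b) \<Rightarrow> 'a \<Rightarrow>\<^sub>C 'b" is "\<lambda>f g x. f x * g x"
proof -
  fix f g :: "'a \<Rightarrow> 'b"
  assume fg: "f \<in> bcontfun" "g \<in> bcontfun"
  then obtain b c where bc: "\<And>x. norm (f x) \<le> b" "\<And>x. norm (g x) \<le> c"
    unfolding bcontfun_def bounded_iff by auto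
  have "norm (f x * g x) \<le> b * c" for x
    using norm_mult_ineq[of "f x" "g x"] mult_mono[OF bc(1)[of x] bc(2)[of x]]
      order_trans[OF norm_ge_zero bc(1)] by force
  with fg show "(\<lambda>x. f x * g x) \<in> bcontfun"
    by (intro bcontfun_normI) (auto simp: bcontfun_def intro!: continuous_intros)
qed

lemmas [simp] = one_bcontfun.rep_eq times_bcontfun.rep_eq

instance
proof
  fix f g :: "'a \<Rightarrow>\<^sub>C 'b"
  show "norm (f * g) \<le> norm f * norm g"
  proof (rule norm_bound)
    fix x
    show "norm (apply_bcontfun (f * g) x) \<le> norm f * norm g"
      using norm_mult_ineq[of "f x" "g x"] mult_mono[OF norm_bounded[of f x] norm_bounded[of g x]]
      by force
  qed
  show "norm (1 :: 'a \<Rightarrow>\<^sub>C 'b) = 1"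
    using norm_bound[of "1 :: 'a \<Rightarrow>\<^sub>C 'b" 1] norm_bounded[of "1 :: 'a \<Rightarrow>\<^sub>C 'b" undefined]
    by simp
  show "(0 :: 'a \<Rightarrow>\<^sub>C 'b) \<noteq> 1"
    by (metis one_bcontfun.rep_eq zero_bcontfun.rep_eq zero_neq_one)
qed (rule bcontfun_eqI; simp add: algebra_simps)+

end

instantiation bcontfun :: (topological_space, complex_normed_vector) complex_normed_vector
begin

lift_definition scaleC_bcontfun :: "complex \<Rightarrow> ('a \<Rightarrow>\<^sub>C 'b) \<Rightarrow> 'a \<Rightarrow>\<^sub>C 'b" is "\<lambda>c f x. c *\<^sub>C f x"
proof -
  fix c and f :: "'a \<Rightarrow> 'b"
  assume f: "f \<in> bcontfun"
  then obtain b where b: "\<And>x. norm (f x) \<le> b" unfolding bcontfun_def bounded_iff by auto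
  show "(\<lambda>x. c *\<^sub>C f x) \<in> bcontfun"
  proof (rule bcontfun_normI)
    show "continuous_on UNIV (\<lambda>x. c *\<^sub>C f x)"
      using f bounded_linear.continuous_on[OF bounded_linear_scaleC] by (auto simp: bcontfun_def)
    show "norm (c *\<^sub>C f x) \<le> cmod c * b" for x by (simp add: norm_scaleC b mult_left_mono)
  qed
qed

lemmas [simp] = scaleC_bcontfun.rep_eq

instance
proof
  fix c d :: complex and r :: real and f g :: "'a \<Rightarrow>\<^sub>C 'b"
  have le: "norm (c *\<^sub>C f) \<le> cmod c * norm f" for c and f :: "'a \<Rightarrow>\<^sub>C 'b"
    by (rule norm_bound) (auto simp: norm_scaleC intro!: mult_left_mono norm_bounded)
  show sc: "c *\<^sub>C (d *\<^sub>C f) = (c * d) *\<^sub>C f" for c d and f :: "'a \<Rightarrow>\<^sub>C 'b"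
    by (rule bcontfun_eqI) (simp add: scaleC_scaleC)
  show re: "complex_of_real r *\<^sub>C f = r *\<^sub>R f" for r and f :: "'a \<Rightarrow>\<^sub>C 'b"
    by (rule bcontfun_eqI) (simp add: scaleC_of_real)
  show "norm (c *\<^sub>C f) = cmod c * norm f"
  proof (cases "c = 0")
    case True
    then show ?thesis using re[of 0 f] by simp
  next
    case False
    have "f = inverse c *\<^sub>C (c *\<^sub>C f)"
      using False re[of 1 f] by (simp add: sc)
    then have "norm f \<le> cmod (inverse c) * norm (c *\<^sub>C f)"
      using le by metis
    then have "cmod c * norm f \<le> norm (c *\<^sub>C f)"
      using False by (simp add: norm_inverse norm_divide field_simps)
    then show ?thesis using le[of c f] by (rule order.antisym[rotated])
  qed
qed (rule bcontfun_eqI; simp add: scaleC_add_right scaleC_add_left)+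

end


section \<open>Complexification of a real Banach lattice\<close>

datatype 'a complexified = Cx (rpart: 'a) (ipart: 'a)

instantiation complexified :: (real_vector) real_vector
begin

definition "0 = Cx 0 (0 :: 'a)"
definition "z + w = Cx (rpart z + rpart w) (ipart z + ipart w)"
definition "z - w = Cx (rpart z - rpart w) (ipart z - ipart w)"
definition "- z = Cx (- rpart z) (- ipart z)"
definition "r *\<^sub>R z = Cx (r *\<^sub>R rpart z) (r *\<^sub>R ipart z)"

instance
  by standard
     (simp_all add: zero_complexified_def plus_complexified_def minus_complexified_def
       uminus_complexified_def scaleR_complexified_def algebra_simps)

end

lemma complexified_parts [simp]:
  "rpart (0 :: 'a::real_vector complexified) = 0" "ipart (0 :: 'a complexified) = 0"
  "rpart (z + w) = rpart z + rpart w" "ipart (z + w) = ipart z + ipart w"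
  "rpart (z - w) = rpart z - rpart w" "ipart (z - w) = ipart z - ipart w"
  "rpart (- z) = - rpart z" "ipart (- z) = - ipart z"
  "rpart (r *\<^sub>R z) = r *\<^sub>R rpart z" "ipart (r *\<^sub>R z) = r *\<^sub>R ipart z"
  by (simp_all add: zero_complexified_def plus_complexified_def minus_complexified_def
       uminus_complexified_def scaleR_complexified_def)

instantiation complexified :: (real_vector) scaleC
begin

definition scaleC_complexified :: "complex \<Rightarrow> 'a complexified \<Rightarrow> 'a complexified"
  where "c *\<^sub>C z = Cx (Re c *\<^sub>R rpart z - Im c *\<^sub>R ipart z) (Re c *\<^sub>R ipart z + Im c *\<^sub>R rpart z)"

instance ..

end

lemma scaleC_parts [simp]:
  "rpart (c *\<^sub>C z) = Re c *\<^sub>R rpart z - Im c *\<^sub>R ipart (z :: 'a::real_vector complexified)"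
  "ipart (c *\<^sub>C z) = Re c *\<^sub>R ipart z + Im c *\<^sub>R rpart z"
  by (simp_all add: scaleC_complexified_def)

lemma scaleC_complexified_algebra:
  fixes z w :: "'a::real_vector complexified"
  shows "c *\<^sub>C (z + w) = c *\<^sub>C z + c *\<^sub>C w"
    and "(c + d) *\<^sub>C z = c *\<^sub>C z + d *\<^sub>C z"
    and "c *\<^sub>C (d *\<^sub>C z) = (c * d) *\<^sub>C z"
    and "complex_of_real r *\<^sub>C z = r *\<^sub>R z"
  by (rule complexified.expand; simp add: algebra_simps)+

text \<open>The modulus is the supremum of the real parts of \<open>c z\<close> over all scalars \<open>c\<close> of modulus
  one.  It always exists, see \<open>cabs_exists\<close>; the complex norm is the norm of
  the modulus.\<close>

definition is_cabs :: "'a::banach_lattice complexified \<Rightarrow> 'a \<Rightarrow> bool"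
  where "is_cabs z u \<longleftrightarrow> (\<forall>c. cmod c = 1 \<longrightarrow> rpart (c *\<^sub>C z) \<le> u) \<and>
    (\<forall>v. (\<forall>c. cmod c = 1 \<longrightarrow> rpart (c *\<^sub>C z) \<le> v) \<longrightarrow> u \<le> v)"

definition cabs :: "'a::banach_lattice complexified \<Rightarrow> 'a"
  where "cabs z = (THE u. is_cabs z u)"

lemma rpart_scaleC_le:
  fixes z :: "'a::banach_lattice complexified"
  shows "rpart (c *\<^sub>C z) \<le> cmod c *\<^sub>R (\<bar>rpart z\<bar> + \<bar>ipart z\<bar>)"
proof -
  have "Re c *\<^sub>R rpart z \<le> cmod c *\<^sub>R \<bar>rpart z\<bar>"
    using order_trans[OF abs_ge_self[of "Re c *\<^sub>R rpart z"]]
      scaleR_right_mono[OF abs_Re_le_cmod[of c] abs_ge_zero[of "rpart z"]]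
    unfolding abs_scaleR_lattice by blast
  moreover have "- (Im c *\<^sub>R ipart z) \<le> cmod c *\<^sub>R \<bar>ipart z\<bar>"
    using order_trans[OF abs_ge_minus_self[of "Im c *\<^sub>R ipart z"]]
      scaleR_right_mono[OF abs_Im_le_cmod[of c] abs_ge_zero[of "ipart z"]]
    unfolding abs_scaleR_lattice by blast
  ultimately have "Re c *\<^sub>R rpart z + - (Im c *\<^sub>R ipart z) \<le>
      cmod c *\<^sub>R \<bar>rpart z\<bar> + cmod c *\<^sub>R \<bar>ipart z\<bar>"
    by (rule add_mono)
  then show ?thesis by (simp add: scaleR_add_right)
qed

lemma cabs_exists: "\<exists>u. is_cabs (z :: 'a::banach_lattice complexified) u"
proof -
  define S where "S = sphere (0 :: complex) 1"
  define w where "w = \<bar>rpart z\<bar> + \<bar>ipart z\<bar>"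
  define e where "e n = 1 / real (Suc n)" for n
  have w: "0 \<le> w" unfolding w_def by (intro add_nonneg_nonneg abs_ge_zero)
  have e: "0 < e n" for n by (simp add: e_def)
  have "compact S" by (simp add: S_def)
  have "\<exists>D. D \<subseteq> S \<and> finite D \<and> S \<subseteq> (\<Union>d\<in>D. ball d (e n))" for n
    by (rule compactE_image[OF \<open>compact S\<close>, of S "\<lambda>d. ball d (e n)"]) (use e[of n] in auto)
  then have "\<exists>D. \<forall>n. D n \<subseteq> S \<and> finite (D n) \<and> S \<subseteq> (\<Union>d\<in>D n. ball d (e n))"
    by (intro choice allI)
  then obtain D where D: "\<And>n. finite (D n)" "\<And>n. D n \<subseteq> S" "\<And>n. S \<subseteq> (\<Union>d\<in>D n. ball d (e n))"
    by blast
  have "1 \<in> S" by (simp add: S_def)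
  then have ne: "D n \<noteq> {}" for n using D(3)[of n] by blast
  define v where "v n = Sup_fin ((\<lambda>c. rpart (c *\<^sub>C z)) ` D n)" for n
  have v_least: "v n \<le> u" if "\<And>c. cmod c = 1 \<Longrightarrow> rpart (c *\<^sub>C z) \<le> u" for n u
    unfolding v_def
  proof (rule Sup_fin.boundedI)
    fix a assume "a \<in> (\<lambda>c. rpart (c *\<^sub>C z)) ` D n"
    then show "a \<le> u" using that D(2)[of n] by (auto simp: S_def simp del: scaleC_parts)
  qed (use D(1) ne in auto)
  have v_upper: "rpart (c *\<^sub>C z) \<le> v n + e n *\<^sub>R w" if "cmod c = 1" for n c
  proof -
    from that have "c \<in> S" by (simp add: S_def)
    then obtain d where d: "d \<in> D n" "cmod (c - d) < e n"
      using D(3)[of n] by (auto simp: dist_norm norm_minus_commute)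
    have "c *\<^sub>C z = d *\<^sub>C z + (c - d) *\<^sub>C z"
      by (simp flip: scaleC_complexified_algebra(2))
    then have "rpart (c *\<^sub>C z) = rpart (d *\<^sub>C z) + rpart ((c - d) *\<^sub>C z)"
      by (simp only: complexified_parts)
    also have "\<dots> \<le> v n + e n *\<^sub>R w"
    proof (rule add_mono)
      show "rpart (d *\<^sub>C z) \<le> v n"
        unfolding v_def using d(1) D(1) by (intro Sup_fin.coboundedI) auto
      have "rpart ((c - d) *\<^sub>C z) \<le> cmod (c - d) *\<^sub>R w"
        unfolding w_def by (rule rpart_scaleC_le)
      also have "\<dots> \<le> e n *\<^sub>R w" using d(2) w by (intro scaleR_right_mono) auto
      finally show "rpart ((c - d) *\<^sub>C z) \<le> e n *\<^sub>R w" .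
    qed
    finally show ?thesis .
  qed
  have diff: "norm (v m - v n) \<le> (e m + e n) * norm w" for m n
  proof -
    have le: "v m \<le> v n + e n *\<^sub>R w" for m n by (rule v_least) (rule v_upper)
    have nn: "0 \<le> e k *\<^sub>R w" for k using w e[of k] by (intro scaleR_nonneg_nonneg) auto
    have "\<bar>v m - v n\<bar> \<le> (e m + e n) *\<^sub>R w"
    proof (rule abs_leI)
      have "v m - v n \<le> e n *\<^sub>R w" using le[of m n] by (simp add: algebra_simps)
      then show "v m - v n \<le> (e m + e n) *\<^sub>R w"
        using nn[of m] by (metis add_increasing scaleR_add_left)
      have "- (v m - v n) \<le> e m *\<^sub>R w" using le[of n m] by (simp add: algebra_simps)
      then show "- (v m - v n) \<le> (e m + e n) *\<^sub>R w"
        using nn[of n] by (metis add_increasing2 scaleR_add_left)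
    qed
    then have "norm (v m - v n) \<le> norm ((e m + e n) *\<^sub>R w)" by (rule norm_le_of_abs_le)
    then show ?thesis using e[of m] e[of n] by simp
  qed
  have e_lim: "e \<longlonglongrightarrow> 0" unfolding e_def using LIMSEQ_inverse_real_of_nat
    by (simp add: inverse_eq_divide)
  have "Cauchy v"
  proof (rule CauchyI)
    fix r :: real assume r: "0 < r"
    have "(\<lambda>n. e n * norm w) \<longlonglongrightarrow> 0" using tendsto_mult_left_zero[OF e_lim] by simp
    then have "eventually (\<lambda>n. e n * norm w < r / 2) sequentially"
      using r by (intro order_tendstoD) auto
    then obtain M where M: "\<And>n. n \<ge> M \<Longrightarrow> e n * norm w < r / 2"
      by (auto simp: eventually_sequentially)
    show "\<exists>M. \<forall>m\<ge>M. \<forall>n\<ge>M. norm (v m - v n) < r"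
    proof (intro exI[of _ M] allI impI)
      fix m n assume "M \<le> m" "M \<le> n"
      then show "norm (v m - v n) < r"
        using diff[of m n] M[of m] M[of n] by (simp add: distrib_right)
    qed
  qed
  then obtain u where u: "v \<longlonglongrightarrow> u" using Cauchy_convergent convergent_def by blast
  have "(\<lambda>n. v n + e n *\<^sub>R w) \<longlonglongrightarrow> u + 0 *\<^sub>R w"
    by (intro tendsto_intros u e_lim)
  then have lim: "(\<lambda>n. v n + e n *\<^sub>R w) \<longlonglongrightarrow> u" by simp
  have "is_cabs z u"
    unfolding is_cabs_def
  proof (intro conjI allI impI)
    show "rpart (c *\<^sub>C z) \<le> u" if "cmod c = 1" for c
      using v_upper[OF that] by (intro lattice_LIMSEQ_le[OF tendsto_const lim])
    show "u \<le> t" if "\<forall>c. cmod c = 1 \<longrightarrow> rpart (c *\<^sub>C z) \<le> t" for t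
      using that v_least by (intro lattice_LIMSEQ_le[OF u tendsto_const]) blast
  qed
  then show ?thesis ..
qed

lemma is_cabs_cabs: "is_cabs z (cabs z)"
proof -
  obtain u where u: "is_cabs z u" using cabs_exists by blast
  show ?thesis
    unfolding cabs_def
    by (rule theI[of "is_cabs z", OF u]) (use u in \<open>auto simp: is_cabs_def intro!: order.antisym\<close>)
qed

lemma cabs_upper: "cmod c = 1 \<Longrightarrow> rpart (c *\<^sub>C z) \<le> cabs z"
  and cabs_least: "(\<And>c. cmod c = 1 \<Longrightarrow> rpart (c *\<^sub>C z) \<le> v) \<Longrightarrow> cabs z \<le> v"
  using is_cabs_cabs[of z] unfolding is_cabs_def by blast+

lemma abs_parts_le_cabs: "\<bar>rpart z\<bar> \<le> cabs z" "\<bar>ipart z\<bar> \<le> cabs z"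
  using cabs_upper[of 1 z] cabs_upper[of "-1" z] cabs_upper[of \<i> z] cabs_upper[of "- \<i>" z]
  by (auto intro!: abs_leI)

lemma cabs_nonneg [simp]: "0 \<le> cabs z"
  using abs_parts_le_cabs(1)[of z] abs_ge_zero order_trans by blast

lemma cabs_le_parts: "cabs z \<le> \<bar>rpart z\<bar> + \<bar>ipart z\<bar>"
proof (rule cabs_least)
  fix c assume "cmod c = 1"
  then show "rpart (c *\<^sub>C z) \<le> \<bar>rpart z\<bar> + \<bar>ipart z\<bar>"
    using rpart_scaleC_le[of c z] by (simp del: scaleC_parts)
qed

lemma cabs_triangle: "cabs (z + w) \<le> cabs z + cabs w"
proof (rule cabs_least)
  fix c assume "cmod c = 1"
  then have "rpart (c *\<^sub>C z) + rpart (c *\<^sub>C w) \<le> cabs z + cabs w"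
    by (intro add_mono cabs_upper)
  then show "rpart (c *\<^sub>C (z + w)) \<le> cabs z + cabs w"
    by (simp only: scaleC_complexified_algebra complexified_parts)
qed

lemma cabs_scaleC_le: "cabs (c *\<^sub>C z) \<le> cmod c *\<^sub>R cabs z"
proof (rule cabs_least)
  fix d assume d: "cmod d = 1"
  show "rpart (d *\<^sub>C c *\<^sub>C z) \<le> cmod c *\<^sub>R cabs z"
  proof (cases "c = 0")
    case False
    define b where "b = d * c / cmod c"
    have "cmod b = 1" using False d by (simp add: b_def norm_mult norm_divide)
    then have "cmod c *\<^sub>R rpart (b *\<^sub>C z) \<le> cmod c *\<^sub>R cabs z"
      by (intro scaleR_left_mono cabs_upper) auto
    moreover have "d *\<^sub>C c *\<^sub>C z = cmod c *\<^sub>R (b *\<^sub>C z)"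
    proof -
      have "d * c = complex_of_real (cmod c) * b" using False by (simp add: b_def)
      then show ?thesis by (metis scaleC_complexified_algebra(3,4))
    qed
    ultimately show ?thesis by (simp only: complexified_parts)
  qed simp
qed

lemma cabs_scaleC: "cabs (c *\<^sub>C z) = cmod c *\<^sub>R cabs z"
proof (cases "c = 0")
  case True
  then show ?thesis using cabs_scaleC_le[of c z] cabs_nonneg[of "c *\<^sub>C z"] by (auto intro: order.antisym)
next
  case False
  have "z = inverse c *\<^sub>C (c *\<^sub>C z)"
    using False scaleC_complexified_algebra(4)[of 1 z] by (simp add: scaleC_complexified_algebra(3))
  then have "cabs z \<le> cmod (inverse c) *\<^sub>R cabs (c *\<^sub>C z)"
    using cabs_scaleC_le[of "inverse c" "c *\<^sub>C z"] by simp
  then have "cmod c *\<^sub>R cabs z \<le> cmod c *\<^sub>R (cmod (inverse c) *\<^sub>R cabs (c *\<^sub>C z))"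
    by (rule scaleR_left_mono) simp
  also have "\<dots> = cabs (c *\<^sub>C z)" using False by (simp add: norm_inverse)
  finally show ?thesis using cabs_scaleC_le by (intro order.antisym)
qed

instantiation complexified :: (banach_lattice) real_normed_vector
begin

definition norm_complexified :: "'a complexified \<Rightarrow> real"
  where "norm_complexified z = norm (cabs z)"
definition dist_complexified :: "'a complexified \<Rightarrow> 'a complexified \<Rightarrow> real"
  where "dist_complexified z w = norm (z - w)"
definition uniformity_complexified :: "('a complexified \<times> 'a complexified) filter"
  where "uniformity_complexified = (INF e\<in>{0<..}. principal {(z, w). dist z w < e})"
definition open_complexified :: "'a complexified set \<Rightarrow> bool"
  where "open_complexified S = (\<forall>z\<in>S. \<forall>\<^sub>F (z', w) in uniformity. z' = z \<longrightarrow> w \<in> S)"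
definition sgn_complexified :: "'a complexified \<Rightarrow> 'a complexified"
  where "sgn_complexified z = scaleR (inverse (norm z)) z"

instance
proof
  fix z w :: "'a complexified" and r :: real
  show "norm z = 0 \<longleftrightarrow> z = 0"
  proof
    assume "norm z = 0"
    then have "\<bar>rpart z\<bar> \<le> 0" "\<bar>ipart z\<bar> \<le> 0"
      using abs_parts_le_cabs[of z] by (simp_all add: norm_complexified_def)
    then show "z = 0" by (intro complexified.expand) simp
  next
    assume "z = 0"
    then show "norm z = 0"
      using cabs_scaleC[of 0 z] scaleC_complexified_algebra(4)[of 0 z]
      by (simp add: norm_complexified_def)
  qed
  show "norm (z + w) \<le> norm z + norm w"
    using norm_mono_nonneg[OF cabs_nonneg cabs_triangle[of z w]] norm_triangle_ineq order_trans
    unfolding norm_complexified_def by blast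
  show "norm (r *\<^sub>R z) = \<bar>r\<bar> * norm z"
    by (simp add: norm_complexified_def cabs_scaleC flip: scaleC_complexified_algebra(4))
qed (rule dist_complexified_def uniformity_complexified_def open_complexified_def
       sgn_complexified_def)+

end

lemma norm_parts_le: "norm (rpart z) \<le> norm z" "norm (ipart z) \<le> norm z"
  unfolding norm_complexified_def by (intro norm_le_of_abs_le abs_parts_le_cabs)+

lemma norm_complexified_le: "norm z \<le> norm (rpart z) + norm (ipart z)"
proof -
  have "norm z \<le> norm (\<bar>rpart z\<bar> + \<bar>ipart z\<bar>)"
    unfolding norm_complexified_def by (intro norm_mono_nonneg cabs_nonneg cabs_le_parts)
  also have "\<dots> \<le> norm \<bar>rpart z\<bar> + norm \<bar>ipart z\<bar>" by (rule norm_triangle_ineq)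
  finally show ?thesis by simp
qed

instance complexified :: (banach_lattice) complex_normed_vector
  by standard (simp_all add: scaleC_complexified_algebra norm_complexified_def cabs_scaleC
    del: scaleC_parts)

instance complexified :: (banach_lattice) banach
proof
  fix X :: "nat \<Rightarrow> 'a complexified"
  assume X: "Cauchy X"
  have "Cauchy (\<lambda>n. rpart (X n))" "Cauchy (\<lambda>n. ipart (X n))"
    using X norm_parts_le unfolding Cauchy_iff
    by (metis (no_types, opaque_lifting) complexified_parts(5,6) order_le_less_trans)+
  then obtain x y where xy: "(\<lambda>n. rpart (X n)) \<longlonglongrightarrow> x" "(\<lambda>n. ipart (X n)) \<longlonglongrightarrow> y"
    using Cauchy_convergent convergent_def by metis
  have "(\<lambda>n. norm (rpart (X n) - x) + norm (ipart (X n) - y)) \<longlonglongrightarrow> 0"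
    using tendsto_add[OF tendsto_norm_zero[OF LIM_zero[OF xy(1)]]
      tendsto_norm_zero[OF LIM_zero[OF xy(2)]]] by simp
  then have "(\<lambda>n. X n - Cx x y) \<longlonglongrightarrow> 0"
    by (rule Lim_null_comparison[rotated])
       (use norm_complexified_le[of "X n - Cx x y" for n] in \<open>auto intro!: always_eventually\<close>)
  then show "convergent X" using LIM_zero_cancel convergentI by blast
qed


section \<open>Real scalars: ideals, ideal center, Arens extension\<close>

definition order_ideal :: "'e::banach_lattice set \<Rightarrow> bool"
  where "order_ideal F \<longleftrightarrow> subspace F \<and> (\<forall>x\<in>F. \<forall>y. \<bar>y\<bar> \<le> \<bar>x\<bar> \<longrightarrow> y \<in> F)"

definition ideal_center :: "('e::banach_lattice \<Rightarrow>\<^sub>L 'e) set"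
  where "ideal_center = {T. \<exists>M>0. \<forall>x\<ge>0. \<bar>blinfun_apply T x\<bar> \<le> M *\<^sub>R x}"

definition wot :: "('e::real_normed_vector \<Rightarrow>\<^sub>L 'e) topology"
  where "wot = topology_generated_by {{T. dual_apply f (blinfun_apply T x) \<in> U} |f x U. open U}"

definition unital_hom ::
    "(('k::topological_space \<Rightarrow>\<^sub>C real) \<Rightarrow>\<^sub>L ('e::real_normed_vector \<Rightarrow>\<^sub>L 'e)) \<Rightarrow> bool"
  where "unital_hom m \<longleftrightarrow> m 1 = id_blinfun \<and> (\<forall>a b. m (a * b) = m a o\<^sub>L m b)"

definition closed_invariant_are_ideals ::
    "(('k::topological_space \<Rightarrow>\<^sub>C real) \<Rightarrow>\<^sub>L ('e::banach_lattice \<Rightarrow>\<^sub>L 'e)) \<Rightarrow> bool"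
  where "closed_invariant_are_ideals m \<longleftrightarrow>
    (\<forall>F. subspace F \<and> closed F \<and> (\<forall>a. m a ` F \<subseteq> F) \<longrightarrow> order_ideal F)"

definition arens_mu ::
    "(('k::topological_space \<Rightarrow>\<^sub>C real) \<Rightarrow>\<^sub>L ('e::real_normed_vector \<Rightarrow>\<^sub>L 'e)) \<Rightarrow>
      'e \<Rightarrow> 'e dual \<Rightarrow> ('k \<Rightarrow>\<^sub>C real) dual"
  where "arens_mu m x f = Dual (Blinfun (\<lambda>a. dual_apply f (m a x)))"

definition arens_ext ::
    "(('k::topological_space \<Rightarrow>\<^sub>C real) \<Rightarrow>\<^sub>L ('e::real_normed_vector \<Rightarrow>\<^sub>L 'e)) \<Rightarrow>
      ('k \<Rightarrow>\<^sub>C real) dual dual \<Rightarrow> 'e dual \<Rightarrow>\<^sub>L 'e dual"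
  where "arens_ext m \<Phi> = Blinfun (\<lambda>f. Dual (Blinfun (\<lambda>x. dual_apply \<Phi> (arens_mu m x f))))"

text \<open>\<open>arens_ext m\<close> is the Arens extension of \<open>m\<close>, with \<open>arens_mu m x f\<close> the functional
  \<open>a \<mapsto> f (a x)\<close> on the algebra of continuous functions.\<close>

text \<open>\<open>Blinfun\<close> is unspecified on unbounded maps; the next lemmas show that it is applied to
  bounded ones here.\<close>

lemma arens_mu_apply: "dual_apply (arens_mu m x f) a = dual_apply f (m a x)"
proof -
  have "bounded_linear (\<lambda>a. dual_apply f (m a x))"
    by (intro bounded_linear_compose[OF bounded_linear_dual_apply]
        bounded_linear_compose[OF blinfun.bounded_linear_left] blinfun.bounded_linear_right)
  then show ?thesis by (simp add: arens_mu_def dual_apply_Dual)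
qed

lemma norm_arens_mu: "norm (arens_mu m x f) \<le> norm f * norm m * norm x"
proof (rule norm_dual_bound)
  fix a
  have "\<bar>dual_apply (arens_mu m x f) a\<bar> \<le> norm f * norm (m a x)"
    unfolding arens_mu_apply by (rule norm_dual_apply)
  also have "\<dots> \<le> norm f * (norm m * norm a * norm x)"
    by (intro mult_left_mono order_trans[OF norm_blinfun] mult_right_mono norm_blinfun) auto
  finally show "\<bar>dual_apply (arens_mu m x f) a\<bar> \<le> norm f * norm m * norm x * norm a"
    by (simp add: ac_simps)
qed simp

lemma arens_ext_apply: "dual_apply (arens_ext m \<Phi> f) x = dual_apply \<Phi> (arens_mu m x f)"
proof -
  have bnd: "\<bar>dual_apply \<Phi> (arens_mu m x f)\<bar> \<le> norm \<Phi> * norm m * norm f * norm x" for x f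
    using norm_dual_apply[of \<Phi> "arens_mu m x f"]
      mult_left_mono[OF norm_arens_mu[of m x f] norm_ge_zero[of \<Phi>]] by (simp add: ac_simps)
  have bl: "bounded_linear (\<lambda>x. dual_apply \<Phi> (arens_mu m x f))" for f
  proof (rule bounded_linear_intro)
    fix x y r
    have "arens_mu m (x + y) f = arens_mu m x f + arens_mu m y f"
      by (rule dual_eqI) (simp add: arens_mu_apply dual_apply_add blinfun.add_right)
    then show "dual_apply \<Phi> (arens_mu m (x + y) f) =
        dual_apply \<Phi> (arens_mu m x f) + dual_apply \<Phi> (arens_mu m y f)"
      by (simp add: dual_apply_add)
    have "arens_mu m (r *\<^sub>R x) f = r *\<^sub>R arens_mu m x f"
      by (rule dual_eqI) (simp add: arens_mu_apply dual_apply_scaleR blinfun.scaleR_right)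
    then show "dual_apply \<Phi> (arens_mu m (r *\<^sub>R x) f) = r *\<^sub>R dual_apply \<Phi> (arens_mu m x f)"
      by (simp add: dual_apply_scaleR)
    show "norm (dual_apply \<Phi> (arens_mu m x f)) \<le> norm x * (norm \<Phi> * norm m * norm f)"
      using bnd[of x f] by (simp add: ac_simps)
  qed
  define A where "A = (\<lambda>f. Dual (Blinfun (\<lambda>x. dual_apply \<Phi> (arens_mu m x f))))"
  have A: "dual_apply (A f) x = dual_apply \<Phi> (arens_mu m x f)" for f x
    by (simp add: A_def dual_apply_Dual bl)
  have "bounded_linear A"
  proof (rule bounded_linear_intro)
    fix f g r
    have "arens_mu m x (f + g) = arens_mu m x f + arens_mu m x g" for x
      by (rule dual_eqI) (simp add: arens_mu_apply)
    then show "A (f + g) = A f + A g"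
      by (intro dual_eqI) (simp add: A dual_apply_add)
    have "arens_mu m x (r *\<^sub>R f) = r *\<^sub>R arens_mu m x f" for x
      by (rule dual_eqI) (simp add: arens_mu_apply)
    then show "A (r *\<^sub>R f) = r *\<^sub>R A f"
      by (intro dual_eqI) (simp add: A dual_apply_scaleR)
    have "norm (A f) \<le> norm \<Phi> * norm m * norm f"
      by (rule norm_dual_bound) (use bnd in \<open>auto simp: A\<close>)
    then show "norm (A f) \<le> norm f * (norm \<Phi> * norm m)" by (simp add: ac_simps)
  qed
  then show ?thesis
    using A by (simp add: arens_ext_def bounded_linear_Blinfun_apply flip: A_def)
qed


section \<open>Complex scalars: ideals, ideal center, Arens extension\<close>

definition csubspace :: "'v::complex_normed_vector set \<Rightarrow> bool"
  where "csubspace F \<longleftrightarrow> 0 \<in> F \<and> (\<forall>x\<in>F. \<forall>y\<in>F. x + y \<in> F) \<and> (\<forall>c. \<forall>x\<in>F. c *\<^sub>C x \<in> F)"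

definition corder_ideal :: "'e::banach_lattice complexified set \<Rightarrow> bool"
  where "corder_ideal F \<longleftrightarrow> csubspace F \<and> (\<forall>z\<in>F. \<forall>w. cabs w \<le> cabs z \<longrightarrow> w \<in> F)"

definition cideal_center ::
    "('e::banach_lattice complexified \<Rightarrow>\<^sub>C\<^sub>L 'e complexified) set"
  where "cideal_center = {T. \<exists>M>0. \<forall>x\<ge>0. cabs (cblinfun_apply T (Cx x 0)) \<le> M *\<^sub>R x}"

text \<open>The dual of the complexification is, as a complex Banach lattice, the complexification of
  the real dual: \<open>f\<close> corresponds to \<open>g + i h\<close> with \<open>g x = Re (f x)\<close> and \<open>h x = Im (f x)\<close> for
  real \<open>x\<close>.\<close>

definition dual_parts ::
    "('e::banach_lattice complexified \<Rightarrow>\<^sub>C\<^sub>L complex) \<Rightarrow> 'e dual complexified"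
  where "dual_parts f =
    Cx (Dual (Blinfun (\<lambda>x. Re (f (Cx x 0))))) (Dual (Blinfun (\<lambda>x. Im (f (Cx x 0)))))"

lemma bounded_linear_Cx: "bounded_linear (\<lambda>x :: 'a::banach_lattice. Cx x 0)"
proof (rule bounded_linear_intro)
  fix x y :: 'a and r :: real
  show "Cx (x + y) 0 = Cx x 0 + Cx y 0" "Cx (r *\<^sub>R x) 0 = r *\<^sub>R Cx x 0"
    by (rule complexified.expand; simp)+
  show "norm (Cx x 0) \<le> norm x * 1" using norm_complexified_le[of "Cx x 0"] by simp
qed

lemma dual_parts_apply:
  "dual_apply (rpart (dual_parts f)) x = Re (f (Cx x 0))"
  "dual_apply (ipart (dual_parts f)) x = Im (f (Cx x 0))"
proof -
  have "bounded_linear (\<lambda>x. cblinfun_apply f (Cx x 0))"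
    by (rule bounded_linear_compose[OF bounded_linear_cblinfun_apply bounded_linear_Cx])
  from bounded_linear_compose[OF bounded_linear_Re this]
    bounded_linear_compose[OF bounded_linear_Im this]
  show "dual_apply (rpart (dual_parts f)) x = Re (f (Cx x 0))"
    "dual_apply (ipart (dual_parts f)) x = Im (f (Cx x 0))"
    by (simp_all add: dual_parts_def dual_apply_Dual)
qed

definition cideal_center_dual ::
    "(('e::banach_lattice complexified \<Rightarrow>\<^sub>C\<^sub>L complex) \<Rightarrow>\<^sub>C\<^sub>L
      ('e complexified \<Rightarrow>\<^sub>C\<^sub>L complex)) set"
  where "cideal_center_dual = {T. \<exists>M>0. \<forall>f g. 0 \<le> g \<and> dual_parts f = Cx g 0 \<longrightarrow>
    cabs (dual_parts (cblinfun_apply T f)) \<le> M *\<^sub>R g}"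

definition cwot :: "('v::complex_normed_vector \<Rightarrow>\<^sub>C\<^sub>L 'v) topology"
  where "cwot = topology_generated_by
    {{T. cblinfun_apply f (cblinfun_apply T x) \<in> U} |(f :: 'v \<Rightarrow>\<^sub>C\<^sub>L complex) x U. open U}"

definition cunital_hom ::
    "(('k::topological_space \<Rightarrow>\<^sub>C complex) \<Rightarrow>\<^sub>C\<^sub>L
      ('v::complex_normed_vector \<Rightarrow>\<^sub>C\<^sub>L 'v)) \<Rightarrow> bool"
  where "cunital_hom m \<longleftrightarrow> m 1 = id_cblinfun \<and> (\<forall>a b. m (a * b) = m a o\<^sub>C\<^sub>L m b)"

definition cclosed_invariant_are_ideals ::
    "(('k::topological_space \<Rightarrow>\<^sub>C complex) \<Rightarrow>\<^sub>C\<^sub>L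
      ('e::banach_lattice complexified \<Rightarrow>\<^sub>C\<^sub>L 'e complexified)) \<Rightarrow> bool"
  where "cclosed_invariant_are_ideals m \<longleftrightarrow>
    (\<forall>F. csubspace F \<and> closed F \<and> (\<forall>a. m a ` F \<subseteq> F) \<longrightarrow> corder_ideal F)"

definition carens_mu ::
    "(('k::topological_space \<Rightarrow>\<^sub>C complex) \<Rightarrow>\<^sub>C\<^sub>L
      ('v::complex_normed_vector \<Rightarrow>\<^sub>C\<^sub>L 'v)) \<Rightarrow>
      'v \<Rightarrow> ('v \<Rightarrow>\<^sub>C\<^sub>L complex) \<Rightarrow> ('k \<Rightarrow>\<^sub>C complex) \<Rightarrow>\<^sub>C\<^sub>L complex"
  where "carens_mu m x f = CBlinfun (\<lambda>a. cblinfun_apply f (m a x))"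

definition carens_ext ::
    "(('k::topological_space \<Rightarrow>\<^sub>C complex) \<Rightarrow>\<^sub>C\<^sub>L
      ('v::complex_normed_vector \<Rightarrow>\<^sub>C\<^sub>L 'v)) \<Rightarrow>
      ((('k \<Rightarrow>\<^sub>C complex) \<Rightarrow>\<^sub>C\<^sub>L complex) \<Rightarrow>\<^sub>C\<^sub>L complex) \<Rightarrow>
      ('v \<Rightarrow>\<^sub>C\<^sub>L complex) \<Rightarrow>\<^sub>C\<^sub>L ('v \<Rightarrow>\<^sub>C\<^sub>L complex)"
  where "carens_ext m \<Phi> = CBlinfun (\<lambda>f. CBlinfun (\<lambda>x. cblinfun_apply \<Phi> (carens_mu m x f)))"

lemma bounded_linear_cblinfun_left: "bounded_linear (\<lambda>f. cblinfun_apply f x)"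
  by (rule bounded_linear_intro) (auto intro: norm_cblinfun_apply)

lemma carens_mu_apply: "cblinfun_apply (carens_mu m x f) a = cblinfun_apply f (m a x)"
proof -
  have "bounded_linear (\<lambda>a. cblinfun_apply f (m a x))"
    by (intro bounded_linear_compose[OF bounded_linear_cblinfun_apply]
        bounded_linear_compose[OF bounded_linear_cblinfun_left] bounded_linear_cblinfun_apply)
  then show ?thesis
    by (simp add: carens_mu_def cblinfun_apply_CBlinfun cblinfun_apply_right)
qed

lemma norm_carens_mu: "norm (carens_mu m x f) \<le> norm f * norm m * norm x"
proof (rule norm_cblinfun_bound)
  fix a
  have "norm (cblinfun_apply (carens_mu m x f) a) \<le> norm f * norm (m a x)"
    unfolding carens_mu_apply by (rule norm_cblinfun_apply)
  also have "\<dots> \<le> norm f * (norm m * norm a * norm x)"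
    by (intro mult_left_mono order_trans[OF norm_cblinfun_apply] mult_right_mono
      norm_cblinfun_apply) auto
  finally show "norm (cblinfun_apply (carens_mu m x f) a) \<le> norm f * norm m * norm x * norm a"
    by (simp add: ac_simps)
qed simp

lemma carens_ext_apply: "cblinfun_apply (carens_ext m \<Phi> f) x = cblinfun_apply \<Phi> (carens_mu m x f)"
proof -
  have bnd: "norm (cblinfun_apply \<Phi> (carens_mu m x f)) \<le> norm \<Phi> * norm m * norm f * norm x" for x f
    using norm_cblinfun_apply[of \<Phi> "carens_mu m x f"]
      mult_left_mono[OF norm_carens_mu[of m x f] norm_ge_zero[of \<Phi>]] by (simp add: ac_simps)
  have mu_x: "carens_mu m (x + y) f = carens_mu m x f + carens_mu m y f"
    "carens_mu m (r *\<^sub>R x) f = r *\<^sub>R carens_mu m x f"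
    "carens_mu m (c *\<^sub>C x) f = c *\<^sub>C carens_mu m x f" for x y f r c
    by (rule cblinfun_eqI; simp add: carens_mu_apply cblinfun_apply_right)+
  have mu_f: "carens_mu m x (f + g) = carens_mu m x f + carens_mu m x g"
    "carens_mu m x (r *\<^sub>R f) = r *\<^sub>R carens_mu m x f"
    "carens_mu m x (c *\<^sub>C f) = c *\<^sub>C carens_mu m x f" for x f g r c
    by (rule cblinfun_eqI; simp add: carens_mu_apply cblinfun_apply_right)+
  have bl: "bounded_linear (\<lambda>x. cblinfun_apply \<Phi> (carens_mu m x f))" for f
    by (rule bounded_linear_intro[where K = "norm \<Phi> * norm m * norm f"])
       (use bnd in \<open>auto simp: mu_x cblinfun_apply_right ac_simps\<close>)
  define A where "A = (\<lambda>f. CBlinfun (\<lambda>x. cblinfun_apply \<Phi> (carens_mu m x f)))"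
  have A: "cblinfun_apply (A f) x = cblinfun_apply \<Phi> (carens_mu m x f)" for f x
    unfolding A_def by (subst cblinfun_apply_CBlinfun) (auto simp: bl mu_x cblinfun_apply_right)
  have "bounded_linear A"
  proof (rule bounded_linear_intro)
    fix f g r
    show "A (f + g) = A f + A g" "A (r *\<^sub>R f) = r *\<^sub>R A f"
      by (rule cblinfun_eqI; simp add: A mu_f cblinfun_apply_right)+
    have "norm (A f) \<le> norm \<Phi> * norm m * norm f"
      by (rule norm_cblinfun_bound) (use bnd in \<open>auto simp: A\<close>)
    then show "norm (A f) \<le> norm f * (norm \<Phi> * norm m)" by (simp add: ac_simps)
  qed
  moreover have "A (c *\<^sub>C f) = c *\<^sub>C A f" for c f
    by (rule cblinfun_eqI) (simp add: A mu_f cblinfun_apply_right)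
  ultimately have "cblinfun_apply (CBlinfun A) = A" by (rule cblinfun_apply_CBlinfun)
  then show ?thesis
    using A by (simp add: carens_ext_def flip: A_def)
qed

end

theory Submission
  imports Defs
begin

text \<open>
  (1) \<open>\<Longrightarrow>\<close> contractivity: if \<open>a b = 0\<close>, the closed orbits of \<open>a x\<close> and \<open>b x\<close> meet only in \<open>0\<close>; being
  ideals they are disjoint, so \<open>\<bar>a x + b x\<bar> = \<bar>a x\<bar> + \<bar>b x\<bar>\<close>.  Hence, for a positive functional \<open>f\<close>,
  the seminorm \<open>f \<bar>a x\<bar>\<close> is additive over disjoint families of functions.  It is therefore small on
  suitable level sets, along which \<open>K\<close> can be cut into disjoint pieces where \<open>a\<close> is almost constant;
  this gives \<open>f \<bar>a x\<bar> \<le> \<parallel>a\<parallel> f \<bar>x\<bar>\<close>.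

  (1) \<open>\<Longrightarrow>\<close> (2): the center of \<open>E'\<close> commutes with the adjoints of the \<open>m a\<close>, and the vectors \<open>a x\<close> with
  \<open>\<parallel>a\<parallel> \<le> 1\<close> are dense in the order interval \<open>[- x, x]\<close>, so Hahn--Banach produces the element of the bidual.

  (2) \<open>\<Longrightarrow>\<close> (1): if \<open>f\<close> vanishes on an invariant subspace and \<open>x\<close> lies in it, then \<open>(T f) x = 0\<close> for
  every central \<open>T\<close>; products of band projections of \<open>E'\<close> show that then \<open>\<bar>f\<bar> \<bar>x\<bar> = 0\<close>.

  (2) \<open>\<Longrightarrow>\<close> (3): the functions are weak-star dense in the bidual, which gives one inclusion; an operator in
  the closure commutes with all \<open>m a\<close> and maps \<open>x\<close> into its orbit, which bounds it by its norm.

  In the complex case, contractivity forces \<open>m a\<close> to be real for real \<open>a\<close>, which reduces everything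
  except (2) \<open>\<Longrightarrow>\<close> (1) to the real case.
\<close>


section \<open>Hahn--Banach\<close>

text \<open>A bounded homomorphism comes with no sharp constant, and \<open>K\<close> need not have
  clopen sets on which a function could be made almost constant. Cutting is possible all the same by
  a pigeonhole: over disjoint functions with values in \<open>[0, 1]\<close> the seminorm sums to at
  most a constant C that does not depend on their number, so among N disjoint tents above a range of
  values of \<open>a\<close> one costs at most C / N. Removing it separates the two sides at
  arbitrarily small cost, and the bound of \<open>m\<close> enters only through C and through terms
  that are made small. Once the constant is 1, positive parts, moduli and truncations of functions
  pass to the vectors \<open>a x\<close> with \<open>x \<ge> 0\<close>; the density statement and
  the bound for operators in the closure rest on this. For complex scalars (2) ==> (1) needs its own
  treatment, because the reality of \<open>m a\<close> is itself derived from (1). A complex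
  functional \<open>h\<close> vanishing on the subspace only yields \<open>(T h) z = 0\<close>,
  where real and imaginary parts are coupled; the annihilator lemma is therefore stated for the
  coupled system.\<close>

definition sublinear :: "('v::real_vector \<Rightarrow> real) \<Rightarrow> bool"
  where "sublinear p \<longleftrightarrow> (\<forall>x y. p (x + y) \<le> p x + p y) \<and> (\<forall>r>0. \<forall>x. p (r *\<^sub>R x) = r * p x)"

lemma sublinear_add: "sublinear p \<Longrightarrow> p (x + y) \<le> p x + p y"
  and sublinear_scale: "sublinear p \<Longrightarrow> 0 < r \<Longrightarrow> p (r *\<^sub>R x) = r * p x"
  by (auto simp: sublinear_def)

lemma sublinear_zero: "sublinear p \<Longrightarrow> p 0 = 0"
  using sublinear_scale[of p 2 0] by simp

lemma sublinear_minus: "sublinear p \<Longrightarrow> - p (- x) \<le> p x"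
  using sublinear_add[of p x "- x"] sublinear_zero[of p] by simp

lemma sublinearI:
  assumes "\<And>x y. p (x + y) \<le> p x + p y" "\<And>r x. 0 < r \<Longrightarrow> p (r *\<^sub>R x) \<le> r * p x"
  shows "sublinear p"
  unfolding sublinear_def
proof (intro conjI allI impI order.antisym)
  fix r :: real and x
  assume r: "0 < r"
  have "p (inverse r *\<^sub>R (r *\<^sub>R x)) \<le> inverse r * p (r *\<^sub>R x)"
    using r by (intro assms) auto
  then show "r * p x \<le> p (r *\<^sub>R x)" using r by (simp add: field_simps)
qed (use assms in auto)

text \<open>For a linear \<open>q\<close> the last clause reads \<open>s \<le> q w\<close>.  With a ray as \<open>W\<close>, the lemma also shows
  that minimal sublinear functionals are additive.\<close>

lemma sublinear_lower:
  fixes p :: "'v::real_vector \<Rightarrow> real"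
  assumes p: "sublinear p" and W0: "(0, 0) \<in> W"
    and Wadd: "\<And>w s w' s'. (w, s) \<in> W \<Longrightarrow> (w', s') \<in> W \<Longrightarrow> (w + w', s + s') \<in> W"
    and Wscale: "\<And>w s r. (w, s) \<in> W \<Longrightarrow> 0 < r \<Longrightarrow> (r *\<^sub>R w, r * s) \<in> W"
    and Wle: "\<And>w s. (w, s) \<in> W \<Longrightarrow> s \<le> p w"
  obtains q where "sublinear q" "\<And>v. q v \<le> p v" "\<And>w s. (w, s) \<in> W \<Longrightarrow> q (- w) \<le> - s"
proof
  \<comment> \<open>The largest sublinear function below \<open>p\<close> that meets the
    constraints: any such \<open>q'\<close> satisfies
    \<open>q' v \<le> q' (v + w) + q' (- w) \<le> p (v + w) - s\<close>.\<close>
  define q where "q v = (INF (w, s)\<in>W. p (v + w) - s)" for v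
  have low: "- p (- v) \<le> p (v + w) - s" if "(w, s) \<in> W" for v w s
    using sublinear_add[OF p, of "v + w" "- v"] Wle[OF that] by simp
  have bdd: "bdd_below ((\<lambda>(w, s). p (v + w) - s) ` W)" for v
    by (rule bdd_belowI[of _ "- p (- v)"]) (use low in auto)
  have le: "q v \<le> p (v + w) - s" if "(w, s) \<in> W" for v w s
    using cINF_lower[OF bdd that] by (simp add: q_def)
  have ge: "c \<le> q v" if "\<And>w s. (w, s) \<in> W \<Longrightarrow> c \<le> p (v + w) - s" for c v
    unfolding q_def by (rule cINF_greatest) (use W0 that in auto)
  show "sublinear q"
  proof (rule sublinearI)
    fix x y :: 'v and r :: real
    have "q (x + y) - q y \<le> q x"
    proof (rule ge)
      fix w s assume ws: "(w, s) \<in> W"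
      have "q (x + y) - (p (x + w) - s) \<le> q y"
      proof (rule ge)
        fix w' s' assume "(w', s') \<in> W"
        from le[OF Wadd[OF ws this], of "x + y"]
        show "q (x + y) - (p (x + w) - s) \<le> p (y + w') - s'"
          using sublinear_add[OF p, of "x + w" "y + w'"] by (simp add: algebra_simps)
      qed
      then show "q (x + y) - q y \<le> p (x + w) - s" by simp
    qed
    then show "q (x + y) \<le> q x + q y" by simp
    assume r: "0 < r"
    have "q (r *\<^sub>R x) / r \<le> q x"
    proof (rule ge)
      fix w s assume "(w, s) \<in> W"
      from le[OF Wscale[OF this r], of "r *\<^sub>R x"]
      show "q (r *\<^sub>R x) / r \<le> p (x + w) - s"
        using r sublinear_scale[OF p r, of "x + w"]
        by (simp add: field_simps scaleR_add_right)
    qed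
    then show "q (r *\<^sub>R x) \<le> r * q x" using r by (simp add: field_simps)
  qed
  show "q v \<le> p v" for v using le[OF W0, of v] by simp
  show "q (- w) \<le> - s" if "(w, s) \<in> W" for w s
    using le[OF that, of "- w"] sublinear_zero[OF p] by simp
qed

text \<open>Zorn's lemma, applied downwards. The bound \<open>- p (- v)\<close> keeps the infimum of
  a chain finite, and this infimum is subadditive because the smaller of two members of the chain
  serves for both vectors.\<close>

lemma sublinear_minimal:
  fixes p :: "'v::real_vector \<Rightarrow> real"
  assumes p: "sublinear p"
  obtains q where "sublinear q" "q \<le> p" "\<And>q'. sublinear q' \<Longrightarrow> q' \<le> q \<Longrightarrow> q' = q"
proof -
  define A where "A = {q. sublinear q \<and> q \<le> p}"
  \<comment> \<open>Reversed, since \<open>predicate_Zorn\<close> yields maximal elements.\<close>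
  define P where "P = (\<lambda>q q' :: 'v \<Rightarrow> real. q' \<le> q)"
  have "\<exists>m\<in>A. \<forall>a\<in>A. P m a \<longrightarrow> a = m"
  proof (rule predicate_Zorn)
    show "partial_order_on A (relation_of P A)"
      by (rule partial_order_on_relation_ofI) (auto simp: P_def)
    fix C assume C: "C \<in> Chains (relation_of P A)"
    then have CA: "C \<subseteq> A" and chain: "\<And>a b. a \<in> C \<Longrightarrow> b \<in> C \<Longrightarrow> a \<le> b \<or> b \<le> a"
      by (auto simp: Chains_def relation_of_def P_def)
    show "\<exists>u\<in>A. \<forall>a\<in>C. P a u"
    proof (cases "C = {}")
      case True
      then show ?thesis using p by (auto simp: A_def)
    next
      case False
      define u where "u v = (INF q\<in>C. q v)" for v
      have "- p (- v) \<le> q v" if "q \<in> C" for q v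
      proof -
        have q: "sublinear q" "q (- v) \<le> p (- v)" using that CA by (auto simp: A_def le_fun_def)
        show ?thesis using sublinear_minus[OF q(1), of v] q(2) by simp
      qed
      then have bdd: "bdd_below ((\<lambda>q. q v) ` C)" for v by (intro bdd_belowI) auto
      have le: "u v \<le> q v" if "q \<in> C" for q v
        unfolding u_def using that by (rule cINF_lower[OF bdd])
      have ge: "c \<le> u v" if "\<And>q. q \<in> C \<Longrightarrow> c \<le> q v" for c v
        unfolding u_def using that by (intro cINF_greatest False)
      have sub: "sublinear q" if "q \<in> C" for q using CA that by (auto simp: A_def)
      have "sublinear u"
      proof (rule sublinearI)
        fix x y :: 'v and r :: real
        have "u (x + y) - u y \<le> u x"
        proof (rule ge)
          fix q assume q: "q \<in> C"
          have "u (x + y) - q x \<le> u y"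
          proof (rule ge)
            fix q' assume q': "q' \<in> C"
            from chain[OF q q'] show "u (x + y) - q x \<le> q' y"
            proof
              assume "q \<le> q'"
              then show ?thesis
                using le[OF q, of "x + y"] sublinear_add[OF sub[OF q], of x y]
                by (smt (verit) le_funD)
            next
              assume "q' \<le> q"
              then show ?thesis
                using le[OF q', of "x + y"] sublinear_add[OF sub[OF q'], of x y]
                by (smt (verit) le_funD)
            qed
          qed
          then show "u (x + y) - u y \<le> q x" by simp
        qed
        then show "u (x + y) \<le> u x + u y" by simp
        assume r: "0 < r"
        have "u (r *\<^sub>R x) / r \<le> u x"
        proof (rule ge)
          fix q assume "q \<in> C"
          from le[OF this, of "r *\<^sub>R x"] sub[OF this] show "u (r *\<^sub>R x) / r \<le> q x"
            using r by (simp add: sublinear_scale field_simps)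
        qed
        then show "u (r *\<^sub>R x) \<le> r * u x" using r by (simp add: field_simps)
      qed
      moreover have "u \<le> p"
      proof -
        obtain q where "q \<in> C" using False by blast
        then show ?thesis using le[of q] CA unfolding A_def le_fun_def by (blast intro: order_trans)
      qed
      moreover have "u \<le> q" if "q \<in> C" for q using le[OF that] by (simp add: le_fun_def)
      ultimately show ?thesis unfolding A_def P_def by blast
    qed
  qed
  then show ?thesis using that by (auto simp: A_def P_def intro: order_trans)
qed

text \<open>A minimal sublinear \<open>L\<close> is additive: lowering it along the ray of
  \<open>y\<close> cannot change it, so \<open>L (- y) \<le> - L y\<close>. The constraints in
  \<open>W\<close> are built in beforehand, by passing from \<open>p\<close> to a smaller
  \<open>p'\<close>, and survive every further decrease.\<close>

theorem Hahn_Banach_cone: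
  fixes p :: "'v::real_vector \<Rightarrow> real"
  assumes p: "sublinear p" and W0: "(0, 0) \<in> W"
    and Wadd: "\<And>w s w' s'. (w, s) \<in> W \<Longrightarrow> (w', s') \<in> W \<Longrightarrow> (w + w', s + s') \<in> W"
    and Wscale: "\<And>w s r. (w, s) \<in> W \<Longrightarrow> 0 < r \<Longrightarrow> (r *\<^sub>R w, r * s) \<in> W"
    and Wle: "\<And>w s. (w, s) \<in> W \<Longrightarrow> s \<le> p w"
  obtains L where "linear L" "\<And>v. L v \<le> p v" "\<And>w s. (w, s) \<in> W \<Longrightarrow> s \<le> L w"
proof -
  obtain p' where p': "sublinear p'" "\<And>v. p' v \<le> p v" "\<And>w s. (w, s) \<in> W \<Longrightarrow> p' (- w) \<le> - s"
    by (rule sublinear_lower[OF p W0 Wadd Wscale Wle]) blast+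
  obtain L where L: "sublinear L" "L \<le> p'" and min: "\<And>q. sublinear q \<Longrightarrow> q \<le> L \<Longrightarrow> q = L"
    using sublinear_minimal[OF p'(1)] by blast
  have "L x + L y \<le> L (x + y)" for x y
  proof -
    have "\<exists>q. sublinear q \<and> (\<forall>v. q v \<le> L v) \<and>
        (\<forall>w s. (w, s) \<in> {(t *\<^sub>R y, t * L y) | t. 0 \<le> t} \<longrightarrow> q (- w) \<le> - s)"
      by (rule sublinear_lower[OF L(1), of "{(t *\<^sub>R y, t * L y) | t. 0 \<le> t}"])
         (auto simp: sublinear_scale[OF L(1)] sublinear_zero[OF L(1)] order_le_less
           distrib_right scaleR_add_left intro: exI[of _ 0] exI[of _ "_ + _"] exI[of _ "_ * _"])
    then obtain q where q: "sublinear q" "\<And>v. q v \<le> L v"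
      "\<And>t. 0 \<le> t \<Longrightarrow> q (- (t *\<^sub>R y)) \<le> - (t * L y)"
      by blast
    from q(1,2) have "q = L" by (intro min) (auto simp: le_fun_def)
    with q(3)[of 1] have "L (- y) \<le> - L y" by simp
    then show ?thesis using sublinear_add[OF L(1), of "x + y" "- y"] by simp
  qed
  then have add: "L (x + y) = L x + L y" for x y
    using sublinear_add[OF L(1)] by (simp add: order.antisym)
  then have neg: "L (- x) = - L x" for x
    using sublinear_zero[OF L(1)] add[of x "- x"] by simp
  have "linear L"
  proof (rule linearI)
    fix r :: real and x
    consider "r > 0" | "r = 0" | "- r > 0" by linarith
    then show "L (r *\<^sub>R x) = r *\<^sub>R L x"
    proof cases
      case 3
      then show ?thesis using sublinear_scale[OF L(1) 3, of x] neg[of "r *\<^sub>R x"] by simp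
    qed (simp_all add: sublinear_scale[OF L(1)] sublinear_zero[OF L(1)])
  qed (rule add)
  moreover have "s \<le> L w" if "(w, s) \<in> W" for w s
  proof -
    have "L (- w) \<le> - s" using p'(3)[OF that] L(2) by (meson le_funD order_trans)
    then show ?thesis using neg by simp
  qed
  moreover have "L v \<le> p v" for v using L(2) p'(2) by (meson le_funD order_trans)
  ultimately show ?thesis using that by blast
qed

lemma Hahn_Banach_peak:
  fixes p :: "'v::real_vector \<Rightarrow> real"
  assumes p: "sublinear p"
  obtains L where "linear L" "\<And>v. L v \<le> p v" "L y = p y"
proof -
  define W where "W = {(t *\<^sub>R y, t * p y) |t. 0 \<le> t}"
  have W: "(t *\<^sub>R y, t * p y) \<in> W" if "0 \<le> t" for t
    using that by (auto simp: W_def)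
  have "(0, 0) \<in> W" using W[of 0] by simp
  moreover have "(w + w', s + s') \<in> W" if "(w, s) \<in> W" "(w', s') \<in> W" for w s w' s'
  proof -
    from that obtain t t' where "w = t *\<^sub>R y" "s = t * p y" "0 \<le> t"
      "w' = t' *\<^sub>R y" "s' = t' * p y" "0 \<le> t'" by (auto simp: W_def)
    then show ?thesis using W[of "t + t'"] by (simp add: scaleR_add_left distrib_right)
  qed
  moreover have "(r *\<^sub>R w, r * s) \<in> W" if "(w, s) \<in> W" "0 < r" for w s r
  proof -
    from that(1) obtain t where "w = t *\<^sub>R y" "s = t * p y" "0 \<le> t"
      by (auto simp: W_def)
    then show ?thesis using W[of "r * t"] that(2) by (simp add: mult.assoc)
  qed
  moreover have "s \<le> p w" if "(w, s) \<in> W" for w s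
    using that by (auto simp: W_def order_le_less sublinear_scale[OF p] sublinear_zero[OF p])
  ultimately obtain L where L: "linear L" "\<And>v. L v \<le> p v" "\<And>w s. (w, s) \<in> W \<Longrightarrow> s \<le> L w"
    by (rule Hahn_Banach_cone[OF p]) blast+
  then show ?thesis using that[of L] W[of 1] by (auto intro: order.antisym)
qed

lemma bounded_linear_of_le_norm:
  fixes L :: "'v::real_normed_vector \<Rightarrow> real"
  assumes "linear L" "\<And>v. L v \<le> C * norm v"
  shows "bounded_linear L" "\<bar>L v\<bar> \<le> C * norm v"
proof -
  have abs: "\<bar>L v\<bar> \<le> C * norm v" for v
    using assms(2)[of v] assms(2)[of "- v"] linear_neg[OF assms(1)] by (simp add: abs_le_iff)
  show "\<bar>L v\<bar> \<le> C * norm v" by (rule abs)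
  show "bounded_linear L"
    using assms(1) abs by (intro bounded_linear_intro[where K = C])
      (auto simp: linear_add linear_scale mult.commute)
qed

lemma sublinear_norm: "0 \<le> C \<Longrightarrow> sublinear (\<lambda>v. C * norm v)"
  by (rule sublinearI) (auto simp: norm_triangle_ineq mult_left_mono simp flip: distrib_left)

text \<open>A linear relation in place of a functional on a subspace: the bound, applied to pairs
  \<open>(0, s)\<close>, forces single-valuedness, so that applications need not show anything well
  defined. Equality comes from using both \<open>(w, s)\<close> and its negative.\<close>

lemma Hahn_Banach_relation:
  fixes W :: "('v::real_normed_vector \<times> real) set"
  assumes "subspace W" "\<And>w s. (w, s) \<in> W \<Longrightarrow> s \<le> C * norm w" "0 \<le> C"
  obtains f where "norm f \<le> C" "\<And>w s. (w, s) \<in> W \<Longrightarrow> dual_apply f w = s"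
proof -
  have W: "(0, 0) \<in> W" "\<And>w s w' s'. (w, s) \<in> W \<Longrightarrow> (w', s') \<in> W \<Longrightarrow> (w + w', s + s') \<in> W"
    "\<And>w s r. (w, s) \<in> W \<Longrightarrow> (r *\<^sub>R w, r * s) \<in> W"
    using subspace_0[OF assms(1)] subspace_add[OF assms(1)] subspace_scale[OF assms(1)]
    by (force simp: zero_prod_def)+
  obtain L where L: "linear L" "\<And>v. L v \<le> C * norm v" "\<And>w s. (w, s) \<in> W \<Longrightarrow> s \<le> L w"
    by (rule Hahn_Banach_cone[OF sublinear_norm[OF assms(3)] W(1,2) W(3) assms(2)]) blast+
  note bl = bounded_linear_of_le_norm[OF L(1,2)]
  show ?thesis
  proof
    show "norm (Dual (Blinfun L)) \<le> C"
      by (rule norm_dual_bound) (use bl assms(3) in \<open>auto simp: dual_apply_Dual\<close>)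
    show "dual_apply (Dual (Blinfun L)) w = s" if "(w, s) \<in> W" for w s
      using L(3)[OF that] L(3)[OF W(3)[OF that, of "- 1"]] linear_neg[OF L(1), of w]
      by (simp add: dual_apply_Dual bl(1))
  qed
qed

lemma Hahn_Banach_separation:
  fixes F :: "'v::real_normed_vector set"
  assumes F: "subspace F" "closed F" and y: "y \<notin> F"
  obtains f where "\<And>x. x \<in> F \<Longrightarrow> dual_apply f x = 0" "dual_apply f y = 1"
proof -
  obtain d where "d > 0" "ball y d \<subseteq> - F"
    using open_contains_ball[of "- F"] F(2) y by (auto simp: closed_def)
  then have d: "d > 0" "\<And>x. x \<in> F \<Longrightarrow> d \<le> norm (y - x)"
    by (auto simp: dist_norm subset_iff) (meson linorder_not_less)
  \<comment> \<open>The graph of \<open>x + t y \<mapsto> t\<close>. Its norm is at most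
    \<open>1 / d\<close>, since \<open>d\<close> bounds the distance from \<open>y\<close> to
    \<open>F\<close> from below.\<close>
  define W where "W = {(x + t *\<^sub>R y, t) |x t. x \<in> F}"
  have "subspace W"
    unfolding subspace_def
  proof (intro conjI ballI allI)
    show "0 \<in> W"
      using subspace_0[OF F(1)] by (auto simp: W_def zero_prod_def intro!: exI[of _ 0])
    fix a b :: "'v \<times> real" and c
    assume "a \<in> W"
    then obtain x t where a: "a = (x + t *\<^sub>R y, t)" "x \<in> F" by (auto simp: W_def)
    have "c *\<^sub>R a = (c *\<^sub>R x + (c * t) *\<^sub>R y, c * t)" by (simp add: a(1) scaleR_add_right)
    then show "c *\<^sub>R a \<in> W" using subspace_scale[OF F(1) a(2), of c] by (auto simp: W_def)
    assume "b \<in> W"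
    then obtain x' t' where b: "b = (x' + t' *\<^sub>R y, t')" "x' \<in> F" by (auto simp: W_def)
    have "a + b = ((x + x') + (t + t') *\<^sub>R y, t + t')" by (simp add: a(1) b(1) scaleR_add_left)
    then show "a + b \<in> W" using subspace_add[OF F(1) a(2) b(2)] by (auto simp: W_def)
  qed
  moreover have "s \<le> 1 / d * norm w" if "(w, s) \<in> W" for w s
  proof (cases "s = 0")
    case False
    from that obtain x where x: "w = x + s *\<^sub>R y" "x \<in> F" by (auto simp: W_def)
    have "d \<le> norm (y - (- inverse s) *\<^sub>R x)" using d(2) subspace_scale[OF F(1) x(2)] by blast
    then have "\<bar>s\<bar> * d \<le> \<bar>s\<bar> * norm (y + inverse s *\<^sub>R x)" by (intro mult_left_mono) auto
    also have "\<dots> = norm w" using False by (simp add: x algebra_simps flip: norm_scaleR)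
    finally have "s * d \<le> norm w"
      using mult_right_mono[OF abs_ge_self[of s], of d] d(1) by linarith
    then show ?thesis using d(1) by (simp add: field_simps)
  qed (use d in auto)
  ultimately obtain f where f: "\<And>w s. (w, s) \<in> W \<Longrightarrow> dual_apply f w = s"
    by (rule Hahn_Banach_relation[of W "1 / d"]) (use d(1) in auto)
  show ?thesis
  proof
    show "dual_apply f x = 0" if "x \<in> F" for x
      using that by (intro f) (auto simp: W_def intro!: exI[of _ x])
    show "dual_apply f y = 1"
      using subspace_0[OF F(1)] by (intro f) (auto simp: W_def intro!: exI[of _ 0])
  qed
qed


section \<open>Banach lattices and their duals\<close>

lemma inf_add_le:
  fixes p q s :: "'a::lattice_ab_group_add"
  assumes "0 \<le> p" "0 \<le> q" "0 \<le> s"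
  shows "inf p (q + s) \<le> inf p q + inf p s"
proof -
  have "inf p q + inf p s = inf (inf (p + p) (q + p)) (inf (p + s) (q + s))"
    by (simp add: add_inf_distrib_left add_inf_distrib_right)
  moreover have "inf p (q + s) \<le> inf (inf (p + p) (q + p)) (inf (p + s) (q + s))"
    using assms by (auto intro: le_infI1 add_increasing add_increasing2)
  ultimately show ?thesis by simp
qed

text \<open>Disjointness lets \<open>q\<close> be dropped from \<open>p \<le> s + q\<close>, by
  \<open>inf_add_le\<close>, and the sum of disjoint elements is their supremum. Stated without
  moduli, so that it applies to \<open>\<bar>_\<bar>\<close> and to \<open>cabs\<close>
  alike.\<close>

lemma disjoint_add_le:
  fixes p q s :: "'a::lattice_ab_group_add"
  assumes "0 \<le> p" "0 \<le> q" "0 \<le> s" "inf p q = 0" "p \<le> s + q" "q \<le> s + p"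
  shows "p + q \<le> s"
proof -
  have "p \<le> s" using inf_add_le[of p s q] assms by (simp add: inf.absorb1 le_iff_inf)
  moreover have "q \<le> s"
    using inf_add_le[of q s p] assms by (simp add: inf.absorb1 inf.commute le_iff_inf)
  ultimately show ?thesis
    using add_eq_inf_sup[of p q] assms(4) by simp
qed

lemma abs_add_disjoint:
  fixes a b :: "'a::lattice_ab_group_add_abs"
  assumes "inf \<bar>a\<bar> \<bar>b\<bar> = 0"
  shows "\<bar>a + b\<bar> = \<bar>a\<bar> + \<bar>b\<bar>"
proof (rule order.antisym[OF abs_triangle_ineq])
  show "\<bar>a\<bar> + \<bar>b\<bar> \<le> \<bar>a + b\<bar>"
    using abs_triangle_ineq4[of "a + b" b] abs_triangle_ineq4[of "a + b" a] assms
    by (intro disjoint_add_le) auto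
qed

lemma sup_diff_zero_disjoint:
  fixes p n :: "'a::lattice_ab_group_add"
  assumes "inf p n = 0"
  shows "sup (p - n) 0 = p"
proof -
  have "sup (p - n) 0 + n = sup p n" by (simp add: add_sup_distrib_right)
  also have "\<dots> = p + n" using add_eq_inf_sup[of p n] assms by simp
  finally show ?thesis by (simp only: add_right_cancel)
qed

lemma inf_sup_zero_parts:
  fixes x :: "'a::lattice_ab_group_add"
  shows "inf (sup x 0) (sup (- x) 0) = 0"
proof -
  have "sup x 0 = x + sup (- x) 0" by (simp add: add_sup_distrib_left sup.commute)
  then have "inf (sup x 0) (sup (- x) 0) = inf x 0 + sup (- x) 0"
    by (simp add: add_inf_distrib_right)
  also have "inf x 0 = - sup (- x) 0"
    unfolding inf_eq_neg_sup[of x 0] minus_zero ..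
  also have "- sup (- x) 0 + sup (- x) 0 = 0" by (rule left_minus)
  finally show ?thesis .
qed

lemma pos_part_le_abs: "sup x 0 \<le> \<bar>x\<bar>" "sup (- x) 0 \<le> \<bar>x\<bar>"
  for x :: "'a::lattice_ab_group_add_abs"
  by (auto simp: abs_ge_self abs_ge_minus_self)

lemma norm_pos_part_le: "norm (sup x 0) \<le> norm x" for x :: "'a::banach_lattice"
  using norm_mono_nonneg[OF _ pos_part_le_abs(1)[of x]] by simp

lemma abs_add_self: "\<bar>x\<bar> + x = 2 *\<^sub>R sup x 0" for x :: "'a::banach_lattice"
proof -
  define p n where "p = sup x 0" and "n = sup (- x) 0"
  have "x = p - n" "\<bar>x\<bar> = p + n" unfolding p_def n_def by (rule pos_neg_parts)+
  then have "\<bar>x\<bar> + x = 2 *\<^sub>R p" by (simp only: scaleR_2) (simp add: algebra_simps)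
  then show ?thesis by (simp only: p_def)
qed

lemma pos_part_scaleR:
  fixes x :: "'a::banach_lattice"
  assumes "0 \<le> r"
  shows "sup (r *\<^sub>R x) 0 = r *\<^sub>R sup x 0"
proof -
  from abs_add_self[of "r *\<^sub>R x"] abs_add_self[of x] have "2 *\<^sub>R sup (r *\<^sub>R x) 0 = 2 *\<^sub>R (r *\<^sub>R sup x 0)"
    using assms by (simp only: abs_scaleR_lattice abs_of_nonneg flip: scaleR_add_right)
      (simp only: scaleR_left_commute)
  then show ?thesis by (subst (asm) scaleR_cancel_left) simp
qed

lemma pos_part_add_le:
  fixes x y :: "'a::lattice_ab_group_add"
  shows "sup (x + y) 0 \<le> sup x 0 + sup y 0"
  by (intro le_supI add_mono add_nonneg_nonneg sup_ge1 sup_ge2)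

section \<open>Positive functionals on a Banach lattice\<close>

lemma dual_leD: "f \<le> g \<Longrightarrow> 0 \<le> x \<Longrightarrow> dual_apply f x \<le> dual_apply g x"
  and dual_leI: "(\<And>x. 0 \<le> x \<Longrightarrow> dual_apply f x \<le> dual_apply g x) \<Longrightarrow> f \<le> g"
  by (auto simp: less_eq_dual_def)

lemma dual_nonneg: "0 \<le> f \<Longrightarrow> 0 \<le> x \<Longrightarrow> 0 \<le> dual_apply f x"
  using dual_leD[of 0 f x] by simp

lemma dual_mono: "0 \<le> f \<Longrightarrow> x \<le> y \<Longrightarrow> dual_apply f x \<le> dual_apply f y"
  for x y :: "'a::banach_lattice"
  using dual_nonneg[of f "y - x"] by (simp add: dual_apply_diff)

lemma dual_apply_zero [simp]: "dual_apply f 0 = 0"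
  using dual_apply_diff[of f 0 0] by simp

lemma dual_apply_parts: "dual_apply f x = dual_apply f (sup x 0) - dual_apply f (sup (- x) 0)"
  for x :: "'a::banach_lattice"
  using pos_neg_parts(1)[of x] by (metis dual_apply_diff)

lemma dual_abs_bound: "\<bar>dual_apply f x\<bar> \<le> dual_apply \<bar>f\<bar> \<bar>x\<bar>"
  for x :: "'a::banach_lattice"
  using rk_upper[of x "\<bar>x\<bar>" f] rk_upper[of "- x" "\<bar>x\<bar>" f]
  by (simp add: abs_dual_apply dual_apply_minus abs_le_iff)

lemma dual_pos_abs_bound: "0 \<le> f \<Longrightarrow> \<bar>dual_apply f x\<bar> \<le> dual_apply f \<bar>x\<bar>"
  for x :: "'a::banach_lattice"
  using dual_abs_bound[of f x] by (simp add: abs_of_nonneg)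

lemma dual_abs_leI:
  fixes x :: "'a::banach_lattice"
  assumes "0 \<le> x" "\<And>y. \<bar>y\<bar> \<le> x \<Longrightarrow> dual_apply f y \<le> b"
  shows "dual_apply \<bar>f\<bar> x \<le> b"
  unfolding abs_dual_apply[OF assms(1)] using assms by (rule rk_least)

lemma sublinear_dual_pos_part:
  fixes f :: "'a::banach_lattice dual"
  assumes "0 \<le> f"
  shows "sublinear (\<lambda>u. dual_apply f (sup u 0))"
proof (rule sublinearI)
  show "dual_apply f (sup (x + y) 0) \<le> dual_apply f (sup x 0) + dual_apply f (sup y 0)" for x y
    using dual_mono[OF assms pos_part_add_le[of x y]] by (simp add: dual_apply_add)
qed (simp add: pos_part_scaleR dual_apply_scaleR)

text \<open>Domination by the positive part forces positivity: for \<open>v \<ge> 0\<close> it gives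
  \<open>L (- v) \<le> 0\<close>.\<close>

lemma nonneg_dual_of_le_pos_part:
  fixes L :: "'a::banach_lattice \<Rightarrow> real"
  assumes L: "linear L" "\<And>v. L v \<le> C * norm (sup v 0)" and C: "0 \<le> C"
  obtains g where "0 \<le> g" "\<And>v. dual_apply g v = L v"
proof -
  have "L v \<le> C * norm v" for v
    using L(2)[of v] mult_left_mono[OF norm_pos_part_le[of v] C] by simp
  from bounded_linear_of_le_norm(1)[OF L(1) this]
  have g: "dual_apply (Dual (Blinfun L)) v = L v" for v by (simp add: dual_apply_Dual)
  have "0 \<le> Dual (Blinfun L)"
  proof (rule dual_leI)
    fix v :: 'a assume "0 \<le> v"
    then show "dual_apply 0 v \<le> dual_apply (Dual (Blinfun L)) v"
      using L(2)[of "- v"] linear_neg[OF L(1), of v] by (simp add: g sup_absorb2)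
  qed
  then show ?thesis using that g by blast
qed

text \<open>In a function model \<open>g\<close> is \<open>f\<close> restricted to the set where
  \<open>x\<close> is positive. It is a functional below \<open>u \<mapsto> f (sup u 0)\<close> that
  touches at \<open>x\<close>: then \<open>f (sup x 0) = g (sup x 0) - g (sup (- x) 0)\<close>, and
  \<open>0 \<le> g \<le> f\<close> leaves only the asserted values.\<close>

lemma dual_peak_at_pos_part:
  fixes f :: "'a::banach_lattice dual"
  assumes f: "0 \<le> f"
  obtains g where "0 \<le> g" "g \<le> f" "dual_apply g (sup x 0) = dual_apply f (sup x 0)"
    "dual_apply g (sup (- x) 0) = 0"
proof -
  obtain L where L: "linear L" "\<And>v. L v \<le> dual_apply f (sup v 0)" "L x = dual_apply f (sup x 0)"
    by (rule Hahn_Banach_peak[OF sublinear_dual_pos_part[OF f], of x]) blast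
  have "L v \<le> norm f * norm (sup v 0)" for v
    using L(2)[of v] norm_dual_apply[of f "sup v 0"] by linarith
  then obtain g where g0: "0 \<le> g" and g: "\<And>v. dual_apply g v = L v"
    by (rule nonneg_dual_of_le_pos_part[OF L(1)]) (use norm_ge_zero in blast)+
  have gf: "g \<le> f"
    by (rule dual_leI) (use L(2) in \<open>metis g sup_absorb1\<close>)
  have "dual_apply f (sup x 0) \<le> dual_apply g (sup x 0) - dual_apply g (sup (- x) 0)"
    using L(3) dual_apply_parts[of g x] g[of x] by simp
  then have "dual_apply g (sup x 0) = dual_apply f (sup x 0)" "dual_apply g (sup (- x) 0) = 0"
    using dual_leD[OF gf, of "sup x 0"] dual_nonneg[OF g0, of "sup (- x) 0"] by auto
  then show ?thesis using that g0 gf by blast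
qed

text \<open>A functional below \<open>\<lambda>v. norm (sup v 0)\<close> that touches at
  \<open>- x\<close> is positive and takes the norm of the negative part of \<open>x\<close> as its
  value at \<open>- x\<close>; by hypothesis this value is at most 0.\<close>

lemma nonneg_if_dual_nonneg:
  fixes x :: "'a::banach_lattice"
  assumes "\<And>f. 0 \<le> f \<Longrightarrow> 0 \<le> dual_apply f x"
  shows "0 \<le> x"
proof -
  define p where "p v = norm (sup v 0)" for v :: 'a
  define n where "n = - x"
  have p: "sublinear p"
  proof (rule sublinearI)
    show "p (u + v) \<le> p u + p v" for u v
      unfolding p_def using norm_mono_nonneg[OF _ pos_part_add_le[of u v]]
      by (metis norm_triangle_le sup_ge2 norm_triangle_ineq order_trans)
  qed (simp add: p_def pos_part_scaleR)
  obtain L where L: "linear L" "\<And>v. L v \<le> p v" "L n = p n"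
    by (rule Hahn_Banach_peak[OF p, of n]) blast
  have "L v \<le> 1 * norm (sup v 0)" for v using L(2)[of v] by (simp add: p_def)
  then obtain g where "0 \<le> g" "\<And>v. dual_apply g v = L v"
    by (rule nonneg_dual_of_le_pos_part[OF L(1)]) auto
  then have "0 \<le> L x" using assms by metis
  moreover have "p n = - L x" using L(3) linear_neg[OF L(1), of x] by (simp add: n_def)
  ultimately have "norm (sup (- x) 0) \<le> 0" unfolding p_def n_def by linarith
  then have "sup (- x) 0 = 0" by (simp only: norm_le_zero_iff)
  then show ?thesis by (metis neg_le_0_iff_le sup_ge1)
qed

lemma le_if_dual_le:
  fixes x y :: "'a::banach_lattice"
  assumes "\<And>f. 0 \<le> f \<Longrightarrow> dual_apply f x \<le> dual_apply f y"
  shows "x \<le> y"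
  using nonneg_if_dual_nonneg[of "y - x"] assms by (simp add: dual_apply_diff)

section \<open>Band projections in the dual\<close>

text \<open>Needed at two levels in the construction of band projections, for the functional
  \<open>\<phi> g\<close> on the lattice and then for the operator \<open>\<psi>\<close> on its
  dual; hence the arbitrary normed codomain.\<close>

lemma positive_cone_extension:
  fixes \<phi> :: "'a::banach_lattice \<Rightarrow> 'b::real_normed_vector"
  assumes add: "\<And>u v. 0 \<le> u \<Longrightarrow> 0 \<le> v \<Longrightarrow> \<phi> (u + v) = \<phi> u + \<phi> v"
    and scale: "\<And>r u. 0 < r \<Longrightarrow> 0 \<le> u \<Longrightarrow> \<phi> (r *\<^sub>R u) = r *\<^sub>R \<phi> u"
    and bound: "\<And>u. 0 \<le> u \<Longrightarrow> norm (\<phi> u) \<le> C * norm u"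
  obtains T where "bounded_linear T" "\<And>u. 0 \<le> u \<Longrightarrow> T u = \<phi> u"
proof
  define T where "T x = \<phi> (sup x 0) - \<phi> (sup (- x) 0)" for x
  have zero: "\<phi> 0 = 0" using add[of 0 0] by simp
  have diff: "T (u - v) = \<phi> u - \<phi> v" if "0 \<le> u" "0 \<le> v" for u v
  proof -
    define p n where "p = sup (u - v) 0" and "n = sup (- (u - v)) 0"
    have pn: "0 \<le> p" "0 \<le> n" unfolding p_def n_def by (rule sup_ge2)+
    have "u - v = p - n" unfolding p_def n_def by (rule pos_neg_parts(1))
    then have "u + n = v + p" by (simp add: algebra_simps)
    then have "\<phi> u + \<phi> n = \<phi> v + \<phi> p" using that pn by (metis add)
    then show ?thesis
      unfolding T_def p_def[symmetric] n_def[symmetric] by (simp add: algebra_simps)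
  qed
  show T: "T u = \<phi> u" if "0 \<le> u" for u using diff[OF that order_refl] zero by simp
  have parts: "\<exists>p n. x = p - n \<and> 0 \<le> p \<and> 0 \<le> n" for x :: 'a
    using pos_neg_parts(1)[of x] sup_ge2 by blast
  have C: "norm (\<phi> u) \<le> \<bar>C\<bar> * norm u" if "0 \<le> u" for u
    using bound[OF that] by (rule order_trans) (auto intro: mult_right_mono)
  show "bounded_linear T"
  proof (rule bounded_linear_intro)
    fix x y :: 'a and r :: real
    obtain p n where x: "x = p - n" "0 \<le> p" "0 \<le> n" using parts by blast
    obtain q k where y: "y = q - k" "0 \<le> q" "0 \<le> k" using parts by blast
    have "x + y = (p + q) - (n + k)" by (simp add: x y)
    then show "T (x + y) = T x + T y" using x y by (simp only: diff add add_nonneg_nonneg) simp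
    consider "r = 0" | "r > 0" | "- r > 0" by linarith
    then show "T (r *\<^sub>R x) = r *\<^sub>R T x"
    proof cases
      case 1
      then show ?thesis using T[of 0] zero by simp
    next
      case 2
      have "r *\<^sub>R x = r *\<^sub>R p - r *\<^sub>R n" by (simp add: x scaleR_diff_right)
      then show ?thesis
        using diff[of "r *\<^sub>R p" "r *\<^sub>R n"] 2 x diff[of p n]
        by (simp add: scale scaleR_nonneg_nonneg scaleR_diff_right)
    next
      case 3
      have "r *\<^sub>R x = (- r) *\<^sub>R n - (- r) *\<^sub>R p" by (simp add: x scaleR_diff_right)
      also have "T \<dots> = (- r) *\<^sub>R \<phi> n - (- r) *\<^sub>R \<phi> p"
        using 3 x by (subst diff) (auto simp: scaleR_nonpos_nonneg scale[of "- r", simplified])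
      finally show ?thesis using x diff[of p n] by (simp add: scaleR_diff_right)
    qed
    have "norm (T x) \<le> norm (\<phi> (sup x 0)) + norm (\<phi> (sup (- x) 0))"
      unfolding T_def by (rule norm_triangle_ineq4)
    also have "\<dots> \<le> \<bar>C\<bar> * norm (sup x 0) + \<bar>C\<bar> * norm (sup (- x) 0)"
      by (intro add_mono C) auto
    also have "\<dots> \<le> \<bar>C\<bar> * norm x + \<bar>C\<bar> * norm x"
      using norm_pos_part_le[of x] norm_pos_part_le[of "- x"]
      by (intro add_mono mult_left_mono) auto
    finally show "norm (T x) \<le> norm x * (2 * \<bar>C\<bar>)" by (simp add: algebra_simps)
  qed
qed

lemma mono_tendsto_Sup:
  fixes h :: "real \<Rightarrow> real"
  assumes "mono h" "bdd_above (range h)"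
  shows "(h \<longlongrightarrow> Sup (range h)) at_top"
proof (rule order_tendstoI)
  fix a assume "a < Sup (range h)"
  then obtain s where s: "a < h s" using less_cSup_iff[of "range h" a] assms(2) by auto
  show "\<forall>\<^sub>F t in at_top. a < h t"
    using eventually_ge_at_top[of s]
    by eventually_elim (use s assms(1) in \<open>meson monoD order_less_le_trans\<close>)
next
  fix a assume "Sup (range h) < a"
  then show "\<forall>\<^sub>F t in at_top. h t < a"
    using cSup_upper[OF _ assms(2)] by (intro always_eventually) (metis order_le_less_trans rangeI)
qed

lemma inf_scaleR_mono:
  fixes g w :: "'a::banach_lattice"
  assumes "0 \<le> w" "s \<le> t"
  shows "inf g (s *\<^sub>R w) \<le> inf g (t *\<^sub>R w)"
  using assms by (intro inf_mono order_refl scaleR_right_mono)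

text \<open>The limit exists because \<open>(inf g (s *\<^sub>R w)) u\<close> increases with \<open>s\<close> and is bounded by \<open>g u\<close>;
  this replaces order completeness of the dual.\<close>

lemma dual_band_projection:
  fixes w :: "'a::banach_lattice dual"
  assumes w: "0 \<le> w"
  obtains P :: "'a dual \<Rightarrow>\<^sub>L 'a dual" where
    "\<And>g u. 0 \<le> g \<Longrightarrow> 0 \<le> u \<Longrightarrow>
      ((\<lambda>s. dual_apply (inf g (s *\<^sub>R w)) u) \<longlongrightarrow> dual_apply (P g) u) at_top"
proof -
  define \<phi> where "\<phi> g u = (SUP s. dual_apply (inf g (s *\<^sub>R w)) u)" for g u
  have le: "dual_apply (inf g (s *\<^sub>R w)) u \<le> dual_apply g u" if "0 \<le> u" for g u s
    using that by (intro dual_leD) auto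
  have lim: "((\<lambda>s. dual_apply (inf g (s *\<^sub>R w)) u) \<longlongrightarrow> \<phi> g u) at_top" if "0 \<le> u" for g u
    unfolding \<phi>_def
  proof (rule mono_tendsto_Sup)
    show "mono (\<lambda>s. dual_apply (inf g (s *\<^sub>R w)) u)"
      using that w by (intro monoI dual_leD inf_scaleR_mono)
    show "bdd_above (range (\<lambda>s. dual_apply (inf g (s *\<^sub>R w)) u))"
      using le[OF that] by (intro bdd_aboveI) auto
  qed
  have nonneg: "0 \<le> \<phi> g u" and below: "\<phi> g u \<le> dual_apply g u" if "0 \<le> g" "0 \<le> u" for g u
  proof -
    have "\<forall>\<^sub>F s in at_top. 0 \<le> dual_apply (inf g (s *\<^sub>R w)) u"
      using eventually_ge_at_top[of 0]
      by eventually_elim (auto intro!: dual_nonneg that scaleR_nonneg_nonneg w)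
    then show "0 \<le> \<phi> g u" using tendsto_lowerbound[OF lim[OF that(2)]] by simp
    show "\<phi> g u \<le> dual_apply g u"
      using tendsto_upperbound[OF lim[OF that(2)]] le[OF that(2)] by simp
  qed
  have "\<exists>f. \<forall>u\<ge>0. dual_apply f u = \<phi> g u" if g: "0 \<le> g" for g
  proof -
    obtain T where T: "bounded_linear T" "\<And>u. 0 \<le> u \<Longrightarrow> T u = \<phi> g u"
    proof (rule positive_cone_extension[of "\<phi> g" "norm g"])
      fix u v :: 'a and r :: real assume u: "0 \<le> u"
      show "\<phi> g (u + v) = \<phi> g u + \<phi> g v" if "0 \<le> v"
        using tendsto_unique[OF _ lim[of "u + v" g] tendsto_add[OF lim[of u g] lim[of v g],
              folded dual_apply_add]] u that by simp
      show "\<phi> g (r *\<^sub>R u) = r *\<^sub>R \<phi> g u" if "0 < r"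
        using tendsto_unique[OF _ lim[of "r *\<^sub>R u" g] tendsto_mult_left[OF lim[of u g], of r,
              folded dual_apply_scaleR]] u that by (simp add: scaleR_nonneg_nonneg)
      show "norm (\<phi> g u) \<le> norm g * norm u"
        using nonneg[OF g u] below[OF g u] norm_dual_apply[of g u] by simp
    qed blast
    then show ?thesis by (intro exI[of _ "Dual (Blinfun T)"]) (simp add: dual_apply_Dual)
  qed
  then obtain \<psi> where \<psi>: "\<And>g u. 0 \<le> g \<Longrightarrow> 0 \<le> u \<Longrightarrow> dual_apply (\<psi> g) u = \<phi> g u" by metis
  have eqI: "f = g" if "\<And>u. 0 \<le> u \<Longrightarrow> dual_apply f u = dual_apply g u" for f g :: "'a dual"
    using that by (intro order.antisym dual_leI) auto
  obtain T where T: "bounded_linear T" "\<And>g. 0 \<le> g \<Longrightarrow> T g = \<psi> g"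
  proof (rule positive_cone_extension[of \<psi> 1])
    fix g h :: "'a dual" and r :: real assume g: "0 \<le> g"
    show "\<psi> (g + h) = \<psi> g + \<psi> h" if h: "0 \<le> h"
    proof (rule eqI)
      fix u :: 'a assume u: "0 \<le> u"
      have "\<phi> (g + h) u \<le> \<phi> g u + \<phi> h u"
      proof (rule tendsto_le[OF _ tendsto_add[OF lim[OF u] lim[OF u]] lim[OF u]])
        show "\<forall>\<^sub>F s in at_top. dual_apply (inf (g + h) (s *\<^sub>R w)) u
            \<le> dual_apply (inf g (s *\<^sub>R w)) u + dual_apply (inf h (s *\<^sub>R w)) u"
          using eventually_ge_at_top[of 0]
        proof eventually_elim
          fix s :: real assume "0 \<le> s"
          then have "inf (s *\<^sub>R w) (g + h) \<le> inf (s *\<^sub>R w) g + inf (s *\<^sub>R w) h"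
            using g h w by (intro inf_add_le scaleR_nonneg_nonneg)
          from dual_leD[OF this u] show "dual_apply (inf (g + h) (s *\<^sub>R w)) u
            \<le> dual_apply (inf g (s *\<^sub>R w)) u + dual_apply (inf h (s *\<^sub>R w)) u"
            by (simp add: inf.commute)
        qed
      qed simp
      \<comment> \<open>The truncations of \<open>g\<close> and \<open>h\<close> at \<open>s\<close>
        add up to something below the truncation of \<open>g + h\<close> at \<open>2 * s\<close>,
        and along \<open>2 * s\<close> the limit is the same.\<close>
      moreover have "\<phi> g u + \<phi> h u \<le> \<phi> (g + h) u"
      proof (rule tendsto_le[OF _ _ tendsto_add[OF lim[OF u] lim[OF u]]])
        show "((\<lambda>s. dual_apply (inf (g + h) ((2 * s) *\<^sub>R w)) u) \<longlongrightarrow> \<phi> (g + h) u) at_top"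
          by (rule filterlim_compose[OF lim[OF u]]) (rule filterlim_tendsto_pos_mult_at_top[OF
            tendsto_const _ filterlim_ident], simp)
        show "\<forall>\<^sub>F s in at_top. dual_apply (inf g (s *\<^sub>R w)) u + dual_apply (inf h (s *\<^sub>R w)) u
            \<le> dual_apply (inf (g + h) ((2 * s) *\<^sub>R w)) u"
        proof (intro always_eventually allI)
          fix s
          have "inf g (s *\<^sub>R w) + inf h (s *\<^sub>R w) \<le> s *\<^sub>R w + s *\<^sub>R w" "inf g (s *\<^sub>R w) + inf h (s *\<^sub>R w) \<le> g + h"
            by (intro add_mono inf_le1 inf_le2)+
          then have "inf g (s *\<^sub>R w) + inf h (s *\<^sub>R w) \<le> inf (g + h) ((2 * s) *\<^sub>R w)"
            by (simp flip: scaleR_add_left)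
          from dual_leD[OF this u] show "dual_apply (inf g (s *\<^sub>R w)) u + dual_apply (inf h (s *\<^sub>R w)) u
            \<le> dual_apply (inf (g + h) ((2 * s) *\<^sub>R w)) u" by simp
        qed
      qed simp
      ultimately show "dual_apply (\<psi> (g + h)) u = dual_apply (\<psi> g + \<psi> h) u"
        using g h u by (simp add: \<psi>)
    qed
    show "\<psi> (r *\<^sub>R g) = r *\<^sub>R \<psi> g" if r: "0 < r"
    proof (rule eqI)
      fix u :: 'a assume u: "0 \<le> u"
      have eq: "inf (r *\<^sub>R g) ((r * s) *\<^sub>R w) = r *\<^sub>R inf g (s *\<^sub>R w)" for s
      proof (rule order.antisym)
        have "inverse r *\<^sub>R inf (r *\<^sub>R g) ((r * s) *\<^sub>R w) \<le> inverse r *\<^sub>R (r *\<^sub>R g)"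
          "inverse r *\<^sub>R inf (r *\<^sub>R g) ((r * s) *\<^sub>R w) \<le> inverse r *\<^sub>R ((r * s) *\<^sub>R w)"
          using r by (intro scaleR_left_mono inf_le1 inf_le2; simp)+
        then have "inverse r *\<^sub>R inf (r *\<^sub>R g) ((r * s) *\<^sub>R w) \<le> inf g (s *\<^sub>R w)"
          using r by (simp flip: mult.assoc)
        then have "r *\<^sub>R inverse r *\<^sub>R inf (r *\<^sub>R g) ((r * s) *\<^sub>R w) \<le> r *\<^sub>R inf g (s *\<^sub>R w)"
          using r by (intro scaleR_left_mono) auto
        then show "inf (r *\<^sub>R g) ((r * s) *\<^sub>R w) \<le> r *\<^sub>R inf g (s *\<^sub>R w)" using r by simp
        have "r *\<^sub>R inf g (s *\<^sub>R w) \<le> r *\<^sub>R g" "r *\<^sub>R inf g (s *\<^sub>R w) \<le> r *\<^sub>R (s *\<^sub>R w)"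
          using r by (intro scaleR_left_mono inf_le1 inf_le2; simp)+
        then show "r *\<^sub>R inf g (s *\<^sub>R w) \<le> inf (r *\<^sub>R g) ((r * s) *\<^sub>R w)" by simp
      qed
      have "((\<lambda>s. dual_apply (inf (r *\<^sub>R g) ((r * s) *\<^sub>R w)) u) \<longlongrightarrow> \<phi> (r *\<^sub>R g) u) at_top"
        by (rule filterlim_compose[OF lim[OF u]]) (rule filterlim_tendsto_pos_mult_at_top[OF
            tendsto_const _ filterlim_ident], rule r)
      then have "\<phi> (r *\<^sub>R g) u = r * \<phi> g u"
        using tendsto_unique[OF _ _ tendsto_mult_left[OF lim[OF u, of g], of r]] by (simp add: eq)
      then show "dual_apply (\<psi> (r *\<^sub>R g)) u = dual_apply (r *\<^sub>R \<psi> g) u"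
        using g u r by (simp add: \<psi> scaleR_nonneg_nonneg)
    qed
    have "0 \<le> \<psi> g" "\<psi> g \<le> g"
      using nonneg[OF g] below[OF g] g by (auto intro!: dual_leI simp: \<psi>)
    then show "norm (\<psi> g) \<le> 1 * norm g" using norm_mono_nonneg by simp
  qed blast
  show ?thesis
  proof
    fix g :: "'a dual" and u :: 'a assume "0 \<le> g" "0 \<le> u"
    then show "((\<lambda>s. dual_apply (inf g (s *\<^sub>R w)) u) \<longlongrightarrow> dual_apply (Blinfun T g) u) at_top"
      using lim by (simp add: bounded_linear_Blinfun_apply T \<psi>)
  qed
qed

text \<open>Plays the part of the multiplications by functions with values in \<open>[0, 1]\<close>.
  It is closed under composition, so restrictions to bands can be iterated.\<close>

definition unit_center :: "('a::banach_lattice \<Rightarrow>\<^sub>L 'a) set"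
  where "unit_center = {T. \<forall>g\<ge>0. 0 \<le> blinfun_apply T g \<and> blinfun_apply T g \<le> g}"

lemma unit_centerD: "T \<in> unit_center \<Longrightarrow> 0 \<le> g \<Longrightarrow> 0 \<le> T g"
  "T \<in> unit_center \<Longrightarrow> 0 \<le> g \<Longrightarrow> T g \<le> g"
  by (auto simp: unit_center_def)

lemma unit_center_mono: "T \<in> unit_center \<Longrightarrow> g \<le> h \<Longrightarrow> T g \<le> T h"
  using unit_centerD(1)[of T "h - g"] by (simp add: blinfun.diff_right)

lemma unit_center_compose: "S \<in> unit_center \<Longrightarrow> T \<in> unit_center \<Longrightarrow> S o\<^sub>L T \<in> unit_center"
  unfolding unit_center_def by (simp, blast intro: order_trans)

lemma unit_center_subset: "unit_center \<subseteq> ideal_center"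
proof
  fix T :: "'a \<Rightarrow>\<^sub>L 'a" assume T: "T \<in> unit_center"
  have "\<bar>T x\<bar> \<le> 1 *\<^sub>R x" if "0 \<le> x" for x
    using unit_centerD[OF T that] by (simp only: abs_of_nonneg scaleR_one)
  then show "T \<in> ideal_center" unfolding ideal_center_def using zero_less_one by blast
qed

lemma inf_scaleR_disjoint:
  fixes g w :: "'a::banach_lattice"
  assumes g: "0 \<le> g" and gw: "inf g w = 0" and s: "1 \<le> s"
  shows "inf g (s *\<^sub>R w) \<le> 0"
proof -
  have "inverse s *\<^sub>R inf g (s *\<^sub>R w) \<le> inverse s *\<^sub>R g"
    "inverse s *\<^sub>R inf g (s *\<^sub>R w) \<le> inverse s *\<^sub>R s *\<^sub>R w"
    using s by (intro scaleR_left_mono inf_le1 inf_le2; simp)+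
  moreover have "inverse s *\<^sub>R g \<le> 1 *\<^sub>R g"
    using s g by (intro scaleR_right_mono) (auto simp: inverse_le_1_iff)
  ultimately have "inverse s *\<^sub>R inf g (s *\<^sub>R w) \<le> inf g w" using s by auto
  then have "s *\<^sub>R inverse s *\<^sub>R inf g (s *\<^sub>R w) \<le> s *\<^sub>R 0"
    using s gw by (intro scaleR_left_mono) auto
  then show ?thesis using s by simp
qed

text \<open>In a function model \<open>P\<close> multiplies by the indicator of the set where
  \<open>w\<close> is positive. Each property comes from an estimate for
  \<open>inf g (s *\<^sub>R w)\<close> with \<open>1 \<le> s\<close>, which \<open>low\<close> and
  \<open>up\<close> carry to the limit.\<close>

lemma dual_band_projection_props:
  fixes w :: "'a::banach_lattice dual"
  assumes w: "0 \<le> w"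
  obtains P where "P \<in> unit_center" "\<And>g. w \<le> g \<Longrightarrow> w \<le> blinfun_apply P g"
    "\<And>g u. 0 \<le> g \<Longrightarrow> 0 \<le> u \<Longrightarrow> dual_apply w u = 0 \<Longrightarrow> dual_apply (P g) u = 0"
    "\<And>g. 0 \<le> g \<Longrightarrow> inf g w = 0 \<Longrightarrow> P g = 0"
proof -
  obtain P :: "'a dual \<Rightarrow>\<^sub>L 'a dual" where lim: "\<And>g u. 0 \<le> g \<Longrightarrow> 0 \<le> u \<Longrightarrow>
      ((\<lambda>s. dual_apply (inf g (s *\<^sub>R w)) u) \<longlongrightarrow> dual_apply (P g) u) at_top"
    by (rule dual_band_projection[OF w]) blast
  have low: "h \<le> P g" if "0 \<le> g" "\<And>s. 1 \<le> s \<Longrightarrow> h \<le> inf g (s *\<^sub>R w)" for h g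
  proof (rule dual_leI)
    fix u :: 'a assume u: "0 \<le> u"
    have "\<forall>\<^sub>F s in at_top. dual_apply h u \<le> dual_apply (inf g (s *\<^sub>R w)) u"
      using eventually_ge_at_top[of 1] by eventually_elim (intro dual_leD that(2) u)
    then show "dual_apply h u \<le> dual_apply (P g) u"
      by (intro tendsto_lowerbound[OF lim[OF that(1) u]]) auto
  qed
  have up: "dual_apply (P g) u \<le> c"
    if "0 \<le> g" "0 \<le> u" "\<And>s. 1 \<le> s \<Longrightarrow> dual_apply (inf g (s *\<^sub>R w)) u \<le> c" for g u c
  proof -
    have "\<forall>\<^sub>F s in at_top. dual_apply (inf g (s *\<^sub>R w)) u \<le> c"
      using eventually_ge_at_top[of 1] by eventually_elim (rule that(3))
    then show ?thesis by (intro tendsto_upperbound[OF lim[OF that(1,2)]]) auto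
  qed
  have nonneg: "0 \<le> P g" if "0 \<le> g" for g
    using that w by (intro low) (auto intro: scaleR_nonneg_nonneg)
  show ?thesis
  proof
    have "P g \<le> g" if "0 \<le> g" for g
      by (rule dual_leI, rule up[OF that], assumption, rule dual_leD[OF inf_le1])
    then show "P \<in> unit_center" unfolding unit_center_def using nonneg by blast
    show "w \<le> P g" if "w \<le> g" for g
    proof (rule low)
      fix s :: real assume "1 \<le> s"
      then have "1 *\<^sub>R w \<le> s *\<^sub>R w" using w by (intro scaleR_right_mono)
      then show "w \<le> inf g (s *\<^sub>R w)" using that by simp
    qed (use that w in simp)
    show "dual_apply (P g) u = 0" if g: "0 \<le> g" and u: "0 \<le> u" and wu: "dual_apply w u = 0" for g u
    proof (rule order.antisym)
      show "dual_apply (P g) u \<le> 0"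
      proof (rule up[OF g u])
        fix s :: real
        have "dual_apply (inf g (s *\<^sub>R w)) u \<le> dual_apply (s *\<^sub>R w) u" using u by (intro dual_leD) auto
        then show "dual_apply (inf g (s *\<^sub>R w)) u \<le> 0" using wu by simp
      qed
      show "0 \<le> dual_apply (P g) u" by (intro dual_nonneg nonneg g u)
    qed
    show "P g = 0" if g: "0 \<le> g" and gw: "inf g w = 0" for g
    proof (rule order.antisym[OF _ nonneg[OF g]])
      show "P g \<le> 0"
        by (intro dual_leI, unfold dual_apply_simps(1)) (rule up[OF g],
          use dual_leD[OF inf_scaleR_disjoint[OF g gw]] in auto)
    qed
  qed
qed

text \<open>Two restrictions: \<open>P\<close> to the set where \<open>u\<close> is positive, so
  that \<open>P u = sup u 0\<close>, and then \<open>Q\<close> to the band of a functional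
  \<open>g\<close> that kills the negative part of \<open>x\<close> but loses nothing on the
  positive part.\<close>

lemma unit_center_sign:
  fixes u :: "'a::banach_lattice dual" and x :: 'a
  assumes pos: "0 < dual_apply (sup u 0) (sup x 0)"
  obtains T where "T \<in> unit_center" "0 \<le> blinfun_apply T u" "0 < dual_apply (T u) x"
    "\<And>h. 0 \<le> h \<Longrightarrow> dual_apply (T h) (sup (- x) 0) = 0"
proof -
  obtain g where g: "0 \<le> g" "g \<le> sup u 0" "dual_apply g (sup x 0) = dual_apply (sup u 0) (sup x 0)"
    "dual_apply g (sup (- x) 0) = 0"
    using dual_peak_at_pos_part[of "sup u 0" x] by auto
  obtain P where P: "P \<in> unit_center" "\<And>h. sup u 0 \<le> h \<Longrightarrow> sup u 0 \<le> blinfun_apply P h"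
    "\<And>h. 0 \<le> h \<Longrightarrow> inf h (sup u 0) = 0 \<Longrightarrow> P h = 0"
    by (rule dual_band_projection_props[OF sup_ge2[of 0 u]]) blast
  obtain Q where Q: "Q \<in> unit_center" "\<And>h. g \<le> h \<Longrightarrow> g \<le> blinfun_apply Q h"
    "\<And>h v. 0 \<le> h \<Longrightarrow> 0 \<le> v \<Longrightarrow> dual_apply g v = 0 \<Longrightarrow> dual_apply (Q h) v = 0"
    by (rule dual_band_projection_props[OF g(1)]) blast
  have "P (sup u 0) = sup u 0"
    by (rule order.antisym[OF unit_centerD(2)[OF P(1) sup_ge2] P(2)[OF order_refl]])
  moreover have "P (sup (- u) 0) = 0"
    using inf_sup_zero_parts[of u] by (intro P(3)) (auto simp: inf.commute)
  ultimately have Pu: "P u = sup u 0"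
    using pos_neg_parts(1)[of u] by (metis blinfun.diff_right diff_zero)
  have neg: "dual_apply (Q h) (sup (- x) 0) = 0" if "0 \<le> h" for h using that g(4) by (intro Q(3)) auto
  show ?thesis
  proof
    show "Q o\<^sub>L P \<in> unit_center" by (intro unit_center_compose Q P)
    show "0 \<le> (Q o\<^sub>L P) u" by (simp add: Pu unit_centerD(1)[OF Q(1)])
    show "dual_apply ((Q o\<^sub>L P) h) (sup (- x) 0) = 0" if "0 \<le> h" for h
      using neg unit_centerD(1)[OF P(1) that] by simp
    have "dual_apply g (sup x 0) \<le> dual_apply (Q (sup u 0)) (sup x 0)"
      by (intro dual_leD Q g) auto
    then show "0 < dual_apply ((Q o\<^sub>L P) u) x"
      using dual_apply_parts[of "Q (sup u 0)" x] neg[of "sup u 0"] pos g(3) by (simp add: Pu)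
  qed
qed

text \<open>In a function model the hypothesis on \<open>(u + i v) (x + i y)\<close> reads \<open>u x = v y\<close> and
  \<open>u y = - v x\<close> pointwise.  Restricted to the set where \<open>u\<close>, \<open>x\<close>, \<open>v\<close>, \<open>y\<close> are positive this
  is impossible; the set where \<open>v\<close> and \<open>y\<close> are negative is the other case, by symmetry.\<close>

lemma unit_center_product_sign:
  fixes u v :: "'a::banach_lattice dual" and x y :: 'a
  assumes H: "\<And>T. T \<in> unit_center \<Longrightarrow>
      dual_apply (blinfun_apply T u) x = dual_apply (T v) y \<and> dual_apply (T u) y = - dual_apply (T v) x"
    and T: "T \<in> unit_center" "0 \<le> blinfun_apply T u"
      "\<And>h. 0 \<le> h \<Longrightarrow> dual_apply (T h) (sup (- x) 0) = 0"
    and pos: "0 < dual_apply (sup (T v) 0) (sup y 0)"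
  shows False
proof -
  \<comment> \<open>A further restriction, to where \<open>T v\<close> and \<open>y\<close> are
    positive.\<close>
  obtain S where S: "S \<in> unit_center" "0 \<le> blinfun_apply S (T v)" "0 < dual_apply (S (T v)) y"
    "\<And>h. 0 \<le> h \<Longrightarrow> dual_apply (S h) (sup (- y) 0) = 0"
    by (rule unit_center_sign[OF pos]) blast
  define u1 v1 where "u1 = S (T u)" and "v1 = S (T v)"
  have u1: "0 \<le> u1" unfolding u1_def by (rule unit_centerD(1)[OF S(1) T(2)])
  have v1: "0 \<le> v1" "0 < dual_apply v1 y" using S by (simp_all add: v1_def)
  have u1y: "dual_apply u1 (sup (- y) 0) = 0" unfolding u1_def by (rule S(4)[OF T(2)])
  have "v1 \<le> S (T \<bar>v\<bar>)"
    unfolding v1_def by (intro unit_center_mono[OF S(1)] unit_center_mono[OF T(1)] abs_ge_self)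
  also have "\<dots> \<le> T \<bar>v\<bar>" by (intro unit_centerD S T) simp
  finally have "dual_apply v1 (sup (- x) 0) \<le> dual_apply (T \<bar>v\<bar>) (sup (- x) 0)"
    by (rule dual_leD) simp
  also have "\<dots> = 0" by (rule T(3)) simp
  finally have v1x: "dual_apply v1 (sup (- x) 0) = 0"
    using dual_nonneg[OF v1(1), of "sup (- x) 0"] by simp
  have ST: "S o\<^sub>L T \<in> unit_center" by (rule unit_center_compose[OF S(1) T(1)])
  have eq: "dual_apply u1 x = dual_apply v1 y" "dual_apply u1 y = - dual_apply v1 x"
    using H[OF ST] by (simp_all add: u1_def v1_def)
  \<comment> \<open>In \<open>eq(2)\<close> the left side is now nonnegative and the right side
    nonpositive, so both vanish.\<close>
  have "dual_apply u1 (sup y 0) = 0"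
    using eq(2) dual_apply_parts[of u1 y] dual_apply_parts[of v1 x] u1y v1x
      dual_nonneg[OF u1, of "sup y 0"] dual_nonneg[OF v1(1), of "sup x 0"] by simp
  \<comment> \<open>The projection onto the band of \<open>u1\<close> fixes \<open>u1\<close> and
    turns \<open>v1\<close> into a functional that kills \<open>y\<close>. The first equation then
    gives \<open>u1 x = 0\<close>, against \<open>u1 x = v1 y > 0\<close>.\<close>
  obtain P where P: "P \<in> unit_center" "\<And>h. u1 \<le> h \<Longrightarrow> u1 \<le> blinfun_apply P h"
    "\<And>h w. 0 \<le> h \<Longrightarrow> 0 \<le> w \<Longrightarrow> dual_apply u1 w = 0 \<Longrightarrow> dual_apply (P h) w = 0"
    by (rule dual_band_projection_props[OF u1]) blast
  have "P u1 = u1" using P(2)[of u1] unit_centerD(2)[OF P(1) u1] by auto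
  then have "dual_apply u1 x = dual_apply (P v1) y"
    using H[OF unit_center_compose[OF P(1) ST]] by (simp add: u1_def v1_def)
  also have "\<dots> = 0"
    using P(3)[OF v1(1) _ u1y] P(3)[OF v1(1) _ \<open>dual_apply u1 (sup y 0) = 0\<close>]
      dual_apply_parts[of "P v1" y] by simp
  finally show False using eq(1) v1(2) by simp
qed

text \<open>\<open>\<bar>u\<bar> \<bar>x\<bar>\<close> is the sum of four products of positive and
  negative parts. The sign changes that carry one product into another preserve the hypothesis if
  \<open>v\<close> and \<open>y\<close> change sign along with \<open>u\<close> and
  \<open>x\<close>.\<close>

lemma unit_center_annihilator:
  fixes u v :: "'a::banach_lattice dual" and x y :: 'a
  assumes H: "\<And>T. T \<in> unit_center \<Longrightarrow>
      dual_apply (blinfun_apply T u) x = dual_apply (T v) y \<and> dual_apply (T u) y = - dual_apply (T v) x"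
  shows "dual_apply \<bar>u\<bar> \<bar>x\<bar> = 0"
proof -
  have zero: "dual_apply (sup u 0) (sup x 0) = 0"
    if H: "\<And>T. T \<in> unit_center \<Longrightarrow> dual_apply (blinfun_apply T u) x = dual_apply (T v) y \<and>
      dual_apply (T u) y = - dual_apply (T v) x" for u v :: "'a dual" and x y :: 'a
  proof (rule ccontr)
    assume "dual_apply (sup u 0) (sup x 0) \<noteq> 0"
    then have "0 < dual_apply (sup u 0) (sup x 0)" using dual_nonneg[of "sup u 0" "sup x 0"] by simp
    then obtain T where T: "T \<in> unit_center" "0 \<le> blinfun_apply T u" "0 < dual_apply (T u) x"
      "\<And>h. 0 \<le> h \<Longrightarrow> dual_apply (T h) (sup (- x) 0) = 0"
      by (rule unit_center_sign) blast
    define v' where "v' = T v"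
    \<comment> \<open>\<open>v' y = (T u) x\<close> is positive and a signed sum of four nonnegative
      terms, so one of the two with a plus sign is positive.\<close>
    have "0 < dual_apply v' y" using H[OF T(1)] T(3) by (simp add: v'_def)
    moreover have "dual_apply v' y = dual_apply (sup v' 0) (sup y 0) - dual_apply (sup v' 0) (sup (- y) 0)
      - dual_apply (sup (- v') 0) (sup y 0) + dual_apply (sup (- v') 0) (sup (- y) 0)"
      using pos_neg_parts(1)[of v'] dual_apply_parts[of v' y]
      by (metis (no_types, lifting) add.commute add_diff_eq diff_diff_eq2 diff_diff_add dual_apply_simps(3))
    moreover have "0 \<le> dual_apply (sup v' 0) (sup (- y) 0)" "0 \<le> dual_apply (sup (- v') 0) (sup y 0)"
      by (simp_all add: dual_nonneg)
    ultimately consider "0 < dual_apply (sup v' 0) (sup y 0)"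
      | "0 < dual_apply (sup (- v') 0) (sup (- y) 0)" by linarith
    then show False
    proof cases
      case 1
      then show False using unit_center_product_sign[OF H T(1,2,4)] by (simp add: v'_def)
    next
      case 2
      then show False
        using unit_center_product_sign[of u x "- v" "- y", OF _ T(1,2,4)] H
        by (simp add: v'_def blinfun.minus_right dual_apply_minus)
    qed
  qed
  have "dual_apply (sup u 0) (sup x 0) = 0" by (rule zero[OF H])
  moreover have "dual_apply (sup (- u) 0) (sup x 0) = 0"
    by (rule zero[of "- u" x "- v" y]) (use H in \<open>simp add: blinfun.minus_right\<close>)
  moreover have "dual_apply (sup u 0) (sup (- x) 0) = 0"
    by (rule zero[of u "- x" v "- y"]) (use H in \<open>simp add: dual_apply_minus\<close>)
  moreover have "dual_apply (sup (- u) 0) (sup (- x) 0) = 0"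
    by (rule zero[of "- u" "- x" "- v" "- y"])
      (use H in \<open>simp add: blinfun.minus_right dual_apply_minus\<close>)
  ultimately show ?thesis
    using pos_neg_parts(2)[of u] pos_neg_parts(2)[of x] by (simp add: dual_apply_add)
qed


section \<open>Functional calculus in the algebra of bounded continuous functions\<close>

lemma apply_Bcontfun:
  assumes "continuous_on UNIV f" "\<And>t. norm (f t) \<le> b"
  shows "apply_bcontfun (Bcontfun f) = f"
  using assms by (intro Bcontfun_inverse bcontfun_normI)

definition bcomp :: "('c \<Rightarrow> 'b) \<Rightarrow> ('k::topological_space \<Rightarrow>\<^sub>C 'c::{real_normed_vector,heine_borel})
    \<Rightarrow> ('k \<Rightarrow>\<^sub>C 'b::real_normed_vector)"
  where "bcomp \<phi> a = Bcontfun (\<lambda>t. \<phi> (a t))"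

text \<open>\<open>a\<close> has relatively compact range, so \<phi> is bounded on it although it
  may be unbounded elsewhere; \<open>Bcontfun\<close> is thus applied to a bounded function.\<close>

lemma apply_bcomp:
  fixes a :: "'k::topological_space \<Rightarrow>\<^sub>C 'c::{real_normed_vector,heine_borel}"
  assumes "continuous_on UNIV \<phi>"
  shows "apply_bcontfun (bcomp \<phi> a) t = \<phi> (a t)"
proof -
  have "compact (closure (range (apply_bcontfun a)))" by simp
  then have "compact (\<phi> ` closure (range (apply_bcontfun a)))"
    using assms by (intro compact_continuous_image) (auto intro: continuous_on_subset)
  then have "bounded (\<phi> ` closure (range (apply_bcontfun a)))" by (rule compact_imp_bounded)
  then obtain b where b: "\<And>y. y \<in> \<phi> ` closure (range (apply_bcontfun a)) \<Longrightarrow> norm y \<le> b"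
    unfolding bounded_iff by blast
  have "norm (\<phi> (a t)) \<le> b" for t
    by (intro b imageI subsetD[OF closure_subset]) simp
  moreover have "continuous_on UNIV (\<lambda>t. \<phi> (a t))"
    by (rule continuous_on_compose2[OF assms continuous_on_apply_bcontfun]) auto
  ultimately show ?thesis unfolding bcomp_def by (subst apply_Bcontfun) auto
qed

lemma sum_bcontfun_apply [simp]: "apply_bcontfun (\<Sum>i\<in>I. f i) t = (\<Sum>i\<in>I. f i t)"
  by (induction I rule: infinite_finite_induct) auto

lemma norm_bcontfun_le: "(\<And>t. norm (apply_bcontfun a t) \<le> b) \<Longrightarrow> norm a \<le> b"
  by (rule norm_bound)

text \<open>Cutting is done with real functions for both scalar fields; through
  \<open>bembed\<close> they act on the vectors.\<close>

definition bembed :: "('k::topological_space \<Rightarrow>\<^sub>C real) \<Rightarrow> ('k \<Rightarrow>\<^sub>C 's::real_normed_algebra_1)"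
  where "bembed = bcomp of_real"

lemma apply_bembed [simp]: "apply_bcontfun (bembed a) t = of_real (a t)"
  unfolding bembed_def by (intro apply_bcomp continuous_intros)

lemma bembed_simps:
  "bembed 1 = 1" "bembed 0 = 0" "bembed (a + b) = bembed a + bembed b"
  "bembed (a - b) = bembed a - bembed b" "bembed (a * b) = bembed a * bembed b"
  by (rule bcontfun_eqI; simp)+

lemma bembed_scaleR: "bembed (r *\<^sub>R a) = r *\<^sub>R bembed a"
  by (rule bcontfun_eqI, simp only: scaleR_bcontfun.rep_eq apply_bembed) (simp add: scaleR_conv_of_real)

lemma bembed_sum: "bembed (\<Sum>i\<in>I. f i) = (\<Sum>i\<in>I. bembed (f i))"
  by (rule bcontfun_eqI) simp

lemma norm_bembed: "norm (bembed a) = norm a"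
  by (intro order.antisym norm_bcontfun_le) (use norm_bounded[of a] norm_bounded[of "bembed a"] in force)+


section \<open>Cutting a continuous function along small level sets\<close>

text \<open>The properties of \<open>r \<mapsto> f \<bar>(b r) x\<bar>\<close> that cutting needs.
  The point is that one \<open>C\<close> bounds the sums over disjoint families of every
  length.\<close>

definition disjointly_bounded :: "(('k::topological_space \<Rightarrow>\<^sub>C real) \<Rightarrow> real) \<Rightarrow> real \<Rightarrow> bool"
  where "disjointly_bounded p C \<longleftrightarrow> (\<forall>r. 0 \<le> p r) \<and> (\<forall>r s. p (r + s) \<le> p r + p s) \<and>
    (\<forall>n r. (\<forall>i<n. \<forall>t. 0 \<le> apply_bcontfun (r i) t \<and> apply_bcontfun (r i) t \<le> 1) \<longrightarrow>
      (\<forall>i<n. \<forall>j<n. i \<noteq> j \<longrightarrow> r i * r j = 0) \<longrightarrow> (\<Sum>i<(n::nat). p (r i)) \<le> C)"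

lemma disjointly_bounded_nonneg: "disjointly_bounded p C \<Longrightarrow> 0 \<le> p r"
  and disjointly_bounded_add: "disjointly_bounded p C \<Longrightarrow> p (r + s) \<le> p r + p s"
  and disjointly_bounded_sum: "disjointly_bounded p C \<Longrightarrow>
    (\<And>i t. i < (n::nat) \<Longrightarrow> 0 \<le> apply_bcontfun (f i) t) \<Longrightarrow>
    (\<And>i t. i < n \<Longrightarrow> apply_bcontfun (f i) t \<le> 1) \<Longrightarrow>
    (\<And>i j. i < n \<Longrightarrow> j < n \<Longrightarrow> i \<noteq> j \<Longrightarrow> f i * f j = 0) \<Longrightarrow> (\<Sum>i<n. p (f i)) \<le> C"
  unfolding disjointly_bounded_def by blast+

text \<open>The zero function is disjoint from itself, so \<open>n\<close> copies of it form an
  admissible family for every \<open>n\<close>.\<close>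

lemma disjointly_bounded_zero:
  assumes "disjointly_bounded p C"
  shows "p 0 = 0"
proof (rule ccontr)
  assume "p 0 \<noteq> 0"
  then have "0 < p 0" using disjointly_bounded_nonneg[OF assms, of 0] by simp
  then obtain n where "C < of_nat n * p 0" using reals_Archimedean3 by blast
  moreover have "(\<Sum>i<n. p 0) \<le> C" by (rule disjointly_bounded_sum[OF assms]) auto
  ultimately show False by simp
qed

text \<open>Allows cutting to continue inside a piece \<open>E\<close> with the same
  constant.\<close>

lemma disjointly_bounded_mult:
  fixes E :: "'k::topological_space \<Rightarrow>\<^sub>C real"
  assumes p: "disjointly_bounded p C" and E: "\<And>t. 0 \<le> apply_bcontfun E t" "\<And>t. apply_bcontfun E t \<le> 1"
  shows "disjointly_bounded (\<lambda>r. p (E * r)) C"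
  unfolding disjointly_bounded_def
proof (intro conjI allI impI)
  show "0 \<le> p (E * r)" for r by (rule disjointly_bounded_nonneg[OF p])
  show "p (E * (r + s)) \<le> p (E * r) + p (E * s)" for r s
    using disjointly_bounded_add[OF p, of "E * r" "E * s"] by (simp add: distrib_left)
  fix n :: nat and r :: "nat \<Rightarrow> 'k \<Rightarrow>\<^sub>C real"
  assume r: "\<forall>i<n. \<forall>t. 0 \<le> apply_bcontfun (r i) t \<and> apply_bcontfun (r i) t \<le> 1"
    and d: "\<forall>i<n. \<forall>j<n. i \<noteq> j \<longrightarrow> r i * r j = 0"
  show "(\<Sum>i<n. p (E * r i)) \<le> C"
  proof (rule disjointly_bounded_sum[OF p])
    fix i j assume "i < n" "j < n" "i \<noteq> j"
    then have *: "r i * r j = 0" using d by simp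
    show "E * r i * (E * r j) = 0"
    proof (rule bcontfun_eqI)
      fix t
      have "r i t * r j t = 0" using arg_cong[OF *, of "\<lambda>f. apply_bcontfun f t"] by simp
      then show "apply_bcontfun (E * r i * (E * r j)) t = apply_bcontfun 0 t" by auto
    qed
  qed (use r E in \<open>auto intro: mult_le_one\<close>)
qed

definition ramp :: "real \<Rightarrow> real" where "ramp s = max 0 (min 1 s)"

lemma continuous_on_ramp [continuous_intros]:
  "continuous_on S g \<Longrightarrow> continuous_on S (\<lambda>x. ramp (g x))"
  unfolding ramp_def by (intro continuous_intros)

text \<open>Pigeonhole: of many disjoint tents over \<open>[\<alpha>, \<beta>]\<close>, composed with \<open>h\<close>, one has small \<open>p\<close>.\<close>

lemma disjointly_bounded_cut:
  fixes h :: "'k::topological_space \<Rightarrow>\<^sub>C real"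
  assumes p: "disjointly_bounded p C" and \<alpha>\<beta>: "\<alpha> < \<beta>" and \<epsilon>: "0 < \<epsilon>"
  obtains L U :: "'k \<Rightarrow>\<^sub>C real" where "\<And>t. 0 \<le> L t" "\<And>t. 0 \<le> U t" "\<And>t. L t + U t \<le> 1"
    "\<And>t. L t = 0 \<or> U t = 0" "\<And>t. L t \<noteq> 0 \<Longrightarrow> h t \<le> \<beta>" "\<And>t. U t \<noteq> 0 \<Longrightarrow> \<alpha> \<le> h t"
    "p (1 - L - U) \<le> \<epsilon>"
proof -
  obtain N :: nat where N: "C < real N * \<epsilon>" using reals_Archimedean3[OF \<epsilon>] by blast
  have C: "0 \<le> C" using disjointly_bounded_sum[OF p, of 0 "\<lambda>_. 0"] by simp
  with N \<epsilon> have N0: "0 < N" by (cases N) auto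
  \<comment> \<open>Half the width of a tent: \<open>N\<close> tents of width \<open>2 * w\<close>,
    with centres \<open>c j\<close>, fill the interval from \<alpha> to \<beta>.\<close>
  define w where "w = (\<beta> - \<alpha>) / (2 * real N)"
  have w: "0 < w" using \<alpha>\<beta> N0 by (simp add: w_def)
  define c where "c j = \<alpha> + (2 * real j + 1) * w" for j :: nat
  define L where "L j = bcomp (\<lambda>s. ramp ((c j - s) / w)) h" for j
  define U where "U j = bcomp (\<lambda>s. ramp ((s - c j) / w)) h" for j
  have L: "L j t = ramp ((c j - h t) / w)" and U: "U j t = ramp ((h t - c j) / w)" for j t
    unfolding L_def U_def by (rule apply_bcomp, intro continuous_intros, use w in simp)+
  define r where "r j = 1 - L j - U j" for j
  have r: "0 \<le> r j t" "r j t \<le> 1" "r j t \<noteq> 0 \<Longrightarrow> \<bar>h t - c j\<bar> < w" for j t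
    using w by (auto simp: r_def L U ramp_def max_def min_def field_simps split: if_splits)
  have "(\<Sum>j<N. p (r j)) \<le> C"
  proof (rule disjointly_bounded_sum[OF p])
    fix i j :: nat assume ij: "i \<noteq> j"
    show "r i * r j = 0"
    proof (rule bcontfun_eqI, rule ccontr)
      fix t assume "apply_bcontfun (r i * r j) t \<noteq> apply_bcontfun 0 t"
      then have "\<bar>h t - c i\<bar> < w" "\<bar>h t - c j\<bar> < w" using r(3) by auto
      then have "\<bar>c i - c j\<bar> < 2 * w" by linarith
      moreover have "c i - c j = 2 * (real i - real j) * w" by (simp add: c_def algebra_simps)
      then have "\<bar>c i - c j\<bar> = 2 * \<bar>real i - real j\<bar> * w"
        using w by (simp only: abs_mult)
      ultimately have "\<bar>real i - real j\<bar> < 1" using w by simp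
      with ij show False by linarith
    qed
  qed (use r in auto)
  then have "\<exists>j<N. p (r j) \<le> \<epsilon>"
  proof -
    have False if "\<forall>j<N. \<epsilon> < p (r j)"
    proof -
      have "(\<Sum>j<N. \<epsilon>) \<le> (\<Sum>j<N. p (r j))" using that by (intro sum_mono) (auto simp: less_imp_le)
      with N \<open>(\<Sum>j<N. p (r j)) \<le> C\<close> show False by simp
    qed
    then show ?thesis by (meson not_le)
  qed
  then obtain j where j: "j < N" "p (r j) \<le> \<epsilon>" by blast
  have "real j + 1 \<le> real N" using j(1) by linarith
  then have "(2 * real j + 1) * w \<le> 2 * real N * w" using w by (intro mult_right_mono) auto
  moreover have "2 * real N * w = \<beta> - \<alpha>" using N0 by (simp add: w_def)
  moreover have "0 \<le> (2 * real j + 1) * w" using w by simp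
  ultimately have cb: "\<alpha> \<le> c j" "c j \<le> \<beta>" by (simp_all add: c_def)
  show ?thesis
  proof
    show "p (1 - L j - U j) \<le> \<epsilon>" using j(2) by (simp add: r_def)
    show "L j t + U j t \<le> 1" for t using r(1)[of j t] by (simp add: r_def)
    show "L j t = 0 \<or> U j t = 0" for t
      using w by (auto simp: L U ramp_def max_def min_def field_simps)
    show "h t \<le> \<beta>" if "L j t \<noteq> 0" for t
    proof -
      have "0 < (c j - h t) / w" using that by (rule contrapos_np) (simp add: L ramp_def)
      then show ?thesis using w cb by (simp add: zero_less_divide_iff)
    qed
    show "\<alpha> \<le> h t" if "U j t \<noteq> 0" for t
    proof -
      have "0 < (h t - c j) / w" using that by (rule contrapos_np) (simp add: U ramp_def)
      then show ?thesis using w cb by (simp add: zero_less_divide_iff)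
    qed
  qed (auto simp: L U ramp_def)
qed

text \<open>Disjoint continuous functions rarely add up to 1, so in place of a partition of unity
  there is a remainder on which \<open>p\<close> is small.\<close>

definition cutting_family :: "(('k::topological_space \<Rightarrow>\<^sub>C real) \<Rightarrow> real) \<Rightarrow> ('k \<Rightarrow>\<^sub>C real) set \<Rightarrow>
    real \<Rightarrow> real \<Rightarrow> 'i set \<Rightarrow> ('i \<Rightarrow> 'k \<Rightarrow>\<^sub>C real) \<Rightarrow> bool"
  where "cutting_family p H \<delta> \<epsilon> I e \<longleftrightarrow> finite I \<and> (\<forall>i\<in>I. \<forall>t. 0 \<le> e i t) \<and> (\<forall>t. (\<Sum>i\<in>I. e i t) \<le> 1) \<and>
    (\<forall>i\<in>I. \<forall>j\<in>I. i \<noteq> j \<longrightarrow> e i * e j = 0) \<and>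
    (\<forall>h\<in>H. \<forall>i\<in>I. \<forall>s t. e i s \<noteq> 0 \<longrightarrow> e i t \<noteq> 0 \<longrightarrow> \<bar>h s - h t\<bar> \<le> \<delta>) \<and> p (1 - (\<Sum>i\<in>I. e i)) \<le> \<epsilon>"

lemma cutting_familyD:
  assumes "cutting_family p H \<delta> \<epsilon> I e"
  shows "finite I" "i \<in> I \<Longrightarrow> 0 \<le> apply_bcontfun (e i) t" "(\<Sum>i\<in>I. apply_bcontfun (e i) t) \<le> 1"
    "i \<in> I \<Longrightarrow> j \<in> I \<Longrightarrow> i \<noteq> j \<Longrightarrow> e i * e j = 0"
    "h \<in> H \<Longrightarrow> i \<in> I \<Longrightarrow> apply_bcontfun (e i) s \<noteq> 0 \<Longrightarrow> apply_bcontfun (e i) t \<noteq> 0 \<Longrightarrow> \<bar>apply_bcontfun h s - apply_bcontfun h t\<bar> \<le> \<delta>"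
    "p (1 - (\<Sum>i\<in>I. e i)) \<le> \<epsilon>"
proof -
  note c = assms[unfolded cutting_family_def]
  show "finite I" by (rule c[THEN conjunct1])
  show "i \<in> I \<Longrightarrow> 0 \<le> apply_bcontfun (e i) t"
    by (rule c[THEN conjunct2, THEN conjunct1, THEN bspec, THEN spec])
  show "(\<Sum>i\<in>I. apply_bcontfun (e i) t) \<le> 1"
    by (rule c[THEN conjunct2, THEN conjunct2, THEN conjunct1, THEN spec])
  note c = c[THEN conjunct2, THEN conjunct2, THEN conjunct2]
  show "i \<in> I \<Longrightarrow> j \<in> I \<Longrightarrow> i \<noteq> j \<Longrightarrow> e i * e j = 0"
    by (rule c[THEN conjunct1, THEN bspec, THEN bspec, THEN mp])
  show "h \<in> H \<Longrightarrow> i \<in> I \<Longrightarrow> apply_bcontfun (e i) s \<noteq> 0 \<Longrightarrow> apply_bcontfun (e i) t \<noteq> 0 \<Longrightarrow>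
      \<bar>apply_bcontfun h s - apply_bcontfun h t\<bar> \<le> \<delta>"
    by (rule c[THEN conjunct2, THEN conjunct1, THEN bspec, THEN bspec, THEN spec, THEN spec,
      THEN mp, THEN mp])
  show "p (1 - (\<Sum>i\<in>I. e i)) \<le> \<epsilon>" by (rule c[THEN conjunct2, THEN conjunct2])
qed

lemma cutting_familyI:
  assumes "finite I" "\<And>i t. i \<in> I \<Longrightarrow> 0 \<le> apply_bcontfun (e i) t" "\<And>t. (\<Sum>i\<in>I. apply_bcontfun (e i) t) \<le> 1"
    "\<And>i j. i \<in> I \<Longrightarrow> j \<in> I \<Longrightarrow> i \<noteq> j \<Longrightarrow> e i * e j = 0"
    "\<And>h i s t. h \<in> H \<Longrightarrow> i \<in> I \<Longrightarrow> apply_bcontfun (e i) s \<noteq> 0 \<Longrightarrow> apply_bcontfun (e i) t \<noteq> 0 \<Longrightarrow> \<bar>apply_bcontfun h s - apply_bcontfun h t\<bar> \<le> \<delta>"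
    "p (1 - (\<Sum>i\<in>I. e i)) \<le> \<epsilon>"
  shows "cutting_family p H \<delta> \<epsilon> I e"
  unfolding cutting_family_def by (intro conjI ballI allI impI assms)

text \<open>Induction on the number of strips of height \<delta> that contain the range of
  \<open>h\<close>. The cut runs through the strip below the top one, so the upper piece spans two
  strips, which explains \<open>2 * \<delta>\<close>. The lower piece is left to the induction
  hypothesis for \<open>\<lambda>r. p (L * r)\<close>.\<close>

lemma cutting_family_exists_aux:
  fixes h :: "'k::topological_space \<Rightarrow>\<^sub>C real"
  assumes "disjointly_bounded p C" "0 < \<delta>" "0 < \<epsilon>" "\<And>t. c \<le> h t" "\<And>t. h t \<le> c + real n * \<delta>"
  shows "\<exists>(N::nat) e. cutting_family p {h} (2 * \<delta>) \<epsilon> {..<N} e"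
  using assms
proof (induction n arbitrary: p h \<epsilon>)
  case 0
  have h: "h t = c" for t using 0(4)[of t] 0(5)[of t] by simp
  have "cutting_family p {h} (2 * \<delta>) \<epsilon> {..<1::nat} (\<lambda>_. 1)"
    using disjointly_bounded_zero[OF 0(1)] 0(2,3) by (intro cutting_familyI) (auto simp: h)
  then show ?case by blast
next
  case (Suc n)
  have lt: "c + (real n - 1) * \<delta> < c + real n * \<delta>" using Suc.prems(2) by simp
  have half: "0 < \<epsilon> / 2" using Suc.prems(3) by simp
  obtain L U :: "'k \<Rightarrow>\<^sub>C real" where LU: "\<And>t. 0 \<le> L t" "\<And>t. 0 \<le> U t" "\<And>t. L t + U t \<le> 1"
    "\<And>t. L t = 0 \<or> U t = 0" "\<And>t. L t \<noteq> 0 \<Longrightarrow> h t \<le> c + real n * \<delta>"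
    "\<And>t. U t \<noteq> 0 \<Longrightarrow> c + (real n - 1) * \<delta> \<le> h t" "p (1 - L - U) \<le> \<epsilon> / 2"
    by (rule disjointly_bounded_cut[OF Suc.prems(1) lt half, of h]) blast
  have L1: "L t \<le> 1" for t using LU(2,3)[of t] by simp
  \<comment> \<open>The induction hypothesis asks for the upper bound everywhere; where
    \<open>L\<close> is nonzero this truncation changes nothing.\<close>
  define h' where "h' = bcomp (\<lambda>s. min s (c + real n * \<delta>)) h"
  have h': "h' t = min (h t) (c + real n * \<delta>)" for t
    unfolding h'_def by (intro apply_bcomp continuous_intros)
  have "0 \<le> real n * \<delta>" using Suc.prems(2) by simp
  then have "\<exists>(N::nat) e. cutting_family (\<lambda>r. p (L * r)) {h'} (2 * \<delta>) (\<epsilon> / 2) {..<N} e"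
    using Suc.prems(4)
    by (intro Suc.IH disjointly_bounded_mult[OF Suc.prems(1)] LU L1 half Suc.prems(2)) (auto simp: h')
  then obtain N :: nat and e where cf: "cutting_family (\<lambda>r. p (L * r)) {h'} (2 * \<delta>) (\<epsilon> / 2) {..<N} e"
    by blast
  have e: "\<And>i t. i < N \<Longrightarrow> 0 \<le> apply_bcontfun (e i) t"
    "\<And>t. (\<Sum>i<N. e i t) \<le> 1" "\<And>i j. i < N \<Longrightarrow> j < N \<Longrightarrow> i \<noteq> j \<Longrightarrow> e i * e j = 0"
    "\<And>i s t. i < N \<Longrightarrow> e i s \<noteq> 0 \<Longrightarrow> e i t \<noteq> 0 \<Longrightarrow> \<bar>h' s - h' t\<bar> \<le> 2 * \<delta>"
    "p (L * (1 - (\<Sum>i<N. e i))) \<le> \<epsilon> / 2"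
    using cutting_familyD[OF cf] by simp_all
  define e' where "e' i = (if i < N then L * e i else U)" for i
  have sum: "(\<Sum>i<Suc N. e' i) = L * (\<Sum>i<N. e i) + U"
    by (simp add: e'_def sum_distrib_left)
  have disj: "L * a * U = 0" "U * (L * a) = 0" for a :: "'k \<Rightarrow>\<^sub>C real"
    by (rule bcontfun_eqI, use LU(4) in force)+
  have "cutting_family p {h} (2 * \<delta>) \<epsilon> {..<Suc N} e'"
  proof (rule cutting_familyI)
    show "finite {..<Suc N}" by simp
  next
    fix i t assume "i \<in> {..<Suc N}"
    then show "0 \<le> apply_bcontfun (e' i) t" using e(1) LU(1,2) by (auto simp: e'_def)
  next
    fix t
    have "(\<Sum>i<Suc N. e' i t) = L t * (\<Sum>i<N. e i t) + U t"
      using arg_cong[OF sum, of "\<lambda>f. apply_bcontfun f t"] by (simp del: sum.lessThan_Suc)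
    also have "\<dots> \<le> L t * 1 + U t"
      using e(2)[of t] LU(1)[of t] by (intro add_right_mono mult_left_mono) auto
    finally show "(\<Sum>i<Suc N. e' i t) \<le> 1" using LU(3)[of t] by simp
  next
    fix i j assume "i \<in> {..<Suc N}" "j \<in> {..<Suc N}" "i \<noteq> j"
    then have "i < Suc N" "j < Suc N" "i \<noteq> j" by auto
    then consider "i < N" "j < N" "i \<noteq> j" | "i < N" "j = N" | "i = N" "j < N" by linarith
    then show "e' i * e' j = 0"
    proof cases
      case 1
      then have "e i * e j = 0" by (rule e(3))
      then have "L * L * (e i * e j) = 0" by simp
      moreover have "L * e i * (L * e j) = L * L * (e i * e j)"
        by (rule bcontfun_eqI) (simp add: ac_simps)
      ultimately show ?thesis using 1 by (simp add: e'_def)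
    qed (simp_all add: e'_def disj)
  next
    fix g i s t assume g: "g \<in> {h}" and st: "e' i s \<noteq> 0" "e' i t \<noteq> 0"
    have "\<bar>h s - h t\<bar> \<le> 2 * \<delta>"
    proof (cases "i < N")
      case True
      then have "e i s \<noteq> 0" "e i t \<noteq> 0" "L s \<noteq> 0" "L t \<noteq> 0" using st by (auto simp: e'_def)
      then show ?thesis using e(4)[OF True, of s t] LU(5)[of s] LU(5)[of t] by (simp add: h')
    next
      case False
      then have "U s \<noteq> 0" "U t \<noteq> 0" using st by (auto simp: e'_def)
      from this[THEN LU(6)] show ?thesis
        using Suc.prems(5)[of s] Suc.prems(5)[of t] by (simp add: algebra_simps abs_le_iff)
    qed
    then show "\<bar>g s - g t\<bar> \<le> 2 * \<delta>" using g by simp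
  next
    have eq: "1 - (\<Sum>i<Suc N. e' i) = (1 - L - U) + L * (1 - (\<Sum>i<N. e i))"
      unfolding sum by (simp add: algebra_simps)
    show "p (1 - (\<Sum>i<Suc N. e' i)) \<le> \<epsilon>"
      unfolding eq
      using disjointly_bounded_add[OF Suc.prems(1), of "1 - L - U" "L * (1 - (\<Sum>i<N. e i))"] LU(7) e(5)
      by simp
  qed
  then show ?case by blast
qed

lemma cutting_family_exists:
  fixes h :: "'k::topological_space \<Rightarrow>\<^sub>C real"
  assumes "disjointly_bounded p C" "0 < \<delta>" "0 < \<epsilon>"
  obtains N :: nat and e where "cutting_family p {h} \<delta> \<epsilon> {..<N} e"
proof -
  have half: "0 < \<delta> / 2" using assms(2) by simp
  obtain n :: nat where n: "2 * norm h < real n * (\<delta> / 2)" using reals_Archimedean3[OF half] by blast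
  have "- norm h \<le> h t" "h t \<le> - norm h + real n * (\<delta> / 2)" for t
    using norm_bounded[of h t] n by (auto simp: abs_le_iff)
  from cutting_family_exists_aux[OF assms(1) half assms(3) this] show ?thesis using that by auto
qed

text \<open>Two functions, to serve the real and the imaginary part of a complex one. The remainder
  of the cut for \<open>h2\<close> is measured by \<open>\<lambda>r. p (E * r)\<close>, since its
  pieces get multiplied by those for \<open>h1\<close>.\<close>

lemma cutting_family_exists2:
  fixes h1 h2 :: "'k::topological_space \<Rightarrow>\<^sub>C real"
  assumes p: "disjointly_bounded p C" and \<delta>: "0 < \<delta>" and \<epsilon>: "0 < \<epsilon>"
  obtains I :: "(nat \<times> nat) set" and e where "cutting_family p {h1, h2} \<delta> \<epsilon> I e"
proof -
  have half: "0 < \<epsilon> / 2" using \<epsilon> by auto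
  obtain M :: nat and a where cfa: "cutting_family p {h1} \<delta> (\<epsilon> / 2) {..<M} a"
    by (rule cutting_family_exists[OF p \<delta> half])
  note a = cutting_familyD(2-)[OF cfa, simplified]
  define E where "E = (\<Sum>i<M. a i)"
  have E: "0 \<le> E t" "E t \<le> 1" for t using a(1,2) by (auto simp: E_def intro: sum_nonneg)
  obtain N :: nat and b where cfb: "cutting_family (\<lambda>r. p (E * r)) {h2} \<delta> (\<epsilon> / 2) {..<N} b"
    by (rule cutting_family_exists[OF disjointly_bounded_mult[OF p E] \<delta> half])
  note b = cutting_familyD(2-)[OF cfb, simplified]
  define I where "I = {..<M} \<times> {..<N}"
  define e where "e = (\<lambda>(i, j). a i * b j)"
  have sum: "(\<Sum>i\<in>I. e i) = E * (\<Sum>j<N. b j)"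
    unfolding I_def e_def E_def by (simp add: sum_product sum.cartesian_product)
  have "cutting_family p {h1, h2} \<delta> \<epsilon> I e"
  proof (rule cutting_familyI)
    show "finite I" by (simp add: I_def)
    show "0 \<le> e i t" if "i \<in> I" for i t using that a(1) b(1) by (auto simp: I_def e_def)
    show "(\<Sum>i\<in>I. e i t) \<le> 1" for t
    proof -
      have "(\<Sum>i\<in>I. e i t) = E t * (\<Sum>j<N. b j t)"
        using arg_cong[OF sum, of "\<lambda>f. apply_bcontfun f t"] by simp
      also have "\<dots> \<le> 1" using E[of t] b(1,2) by (intro mult_le_one sum_nonneg) auto
      finally show ?thesis .
    qed
    show "e i * e j = 0" if "i \<in> I" "j \<in> I" "i \<noteq> j" for i j
    proof -
      obtain i1 i2 j1 j2 where ij: "i = (i1, i2)" "j = (j1, j2)" by fastforce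
      then have lt: "i1 < M" "i2 < N" "j1 < M" "j2 < N" using that by (auto simp: I_def)
      have "a i1 t * a j1 t = 0 \<or> b i2 t * b j2 t = 0" for t
      proof (cases "i1 = j1")
        case True
        then have "b i2 * b j2 = 0" using that ij lt by (intro b(3)) auto
        then show ?thesis by (metis times_bcontfun.rep_eq zero_bcontfun.rep_eq)
      next
        case False
        then have "a i1 * a j1 = 0" using lt by (intro a(3)) auto
        then show ?thesis by (metis times_bcontfun.rep_eq zero_bcontfun.rep_eq)
      qed
      then show ?thesis by (intro bcontfun_eqI) (auto simp: ij e_def)
    qed
    show "\<bar>h s - h t\<bar> \<le> \<delta>" if "h \<in> {h1, h2}" "i \<in> I" "e i s \<noteq> 0" "e i t \<noteq> 0" for h i s t
      using that a(4)[of h1 "fst i" s t] b(4)[of h2 "snd i" s t] by (auto simp: I_def e_def)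
    have eq: "1 - (\<Sum>i\<in>I. e i) = (1 - E) + E * (1 - (\<Sum>i<N. b i))"
      unfolding sum by (simp add: algebra_simps)
    show "p (1 - (\<Sum>i\<in>I. e i)) \<le> \<epsilon>"
      unfolding eq using disjointly_bounded_add[OF p, of "1 - E" "E * (1 - (\<Sum>i<N. b i))"] a(5) b(5)
      by (simp add: E_def)
  qed
  then show ?thesis using that by blast
qed


text \<open>At each point at most one summand is nonzero.\<close>

lemma norm_disjoint_sum_le:
  fixes r :: "nat \<Rightarrow> 'k::topological_space \<Rightarrow>\<^sub>C real"
  assumes r: "\<And>i t. i < n \<Longrightarrow> 0 \<le> apply_bcontfun (r i) t" "\<And>i t. i < n \<Longrightarrow> apply_bcontfun (r i) t \<le> 1"
    and disj: "\<And>i j. i < n \<Longrightarrow> j < n \<Longrightarrow> i \<noteq> j \<Longrightarrow> r i * r j = 0"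
  shows "norm (\<Sum>i<n. r i) \<le> 1"
proof (rule norm_bcontfun_le)
  fix t
  have nn: "0 \<le> (\<Sum>i<n. r i t)" using r by (intro sum_nonneg) auto
  have "(\<Sum>i<n. r i t) \<le> 1"
  proof (cases "\<exists>i<n. r i t \<noteq> 0")
    case True
    then obtain i where i: "i < n" "r i t \<noteq> 0" by blast
    have "r j t = 0" if "j < n" "j \<noteq> i" for j
    proof -
      have "r i t * r j t = 0"
        using arg_cong[OF disj[of i j], of "\<lambda>f. apply_bcontfun f t"] i that by auto
      then show ?thesis using i by simp
    qed
    then have "(\<Sum>j<n. r j t) = (\<Sum>j\<in>{i}. r j t)" using i by (intro sum.mono_neutral_right) auto
    then show ?thesis using r(2)[OF i(1)] by simp
  qed (simp add: sum.neutral)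
  then show "norm (apply_bcontfun (\<Sum>i<n. r i) t) \<le> 1" using nn by simp
qed

lemma disjointly_bounded_plus:
  fixes p q :: "('x::topological_space \<Rightarrow>\<^sub>C real) \<Rightarrow> real"
  assumes p: "disjointly_bounded p C" and q: "disjointly_bounded q D"
  shows "disjointly_bounded (\<lambda>r. p r + q r) (C + D)"
  unfolding disjointly_bounded_def
proof (intro conjI allI impI)
  show "0 \<le> p r + q r" for r
    using disjointly_bounded_nonneg[OF p, of r] disjointly_bounded_nonneg[OF q, of r] by simp
  show "p (r + s) + q (r + s) \<le> p r + q r + (p s + q s)" for r s
    using disjointly_bounded_add[OF p, of r s] disjointly_bounded_add[OF q, of r s] by simp
  fix n :: nat and r :: "nat \<Rightarrow> 'x \<Rightarrow>\<^sub>C real"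
  assume "\<forall>i<n. \<forall>t. 0 \<le> r i t \<and> r i t \<le> 1" "\<forall>i<n. \<forall>j<n. i \<noteq> j \<longrightarrow> r i * r j = 0"
  then have "(\<Sum>i<n. p (r i)) \<le> C" "(\<Sum>i<n. q (r i)) \<le> D"
    by (intro disjointly_bounded_sum[OF p] disjointly_bounded_sum[OF q]; blast)+
  then show "(\<Sum>i<n. p (r i) + q (r i)) \<le> C + D" by (simp add: sum.distrib)
qed

lemma bcontfun_approximate_unit:
  fixes a b :: "'k::topological_space \<Rightarrow>\<^sub>C 's::{real_normed_field,heine_borel}"
  assumes ab: "a * b = 0"
  obtains g :: "'k \<Rightarrow>\<^sub>C 's" where "g * a = 0" "norm g \<le> 1" "norm (g * b - b) \<le> 1 / real (Suc n)"
proof -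
  define k where "k = real (Suc n)"
  have k: "0 < k" by (simp add: k_def)
  have nz: "1 + k * norm z \<noteq> 0" for z :: 's using k by (smt (verit) mult_nonneg_nonneg norm_ge_zero)
  define g where "g = bcomp (\<lambda>z. of_real (k * norm z / (1 + k * norm z)) :: 's) b"
  have g: "g t = of_real (k * norm (b t) / (1 + k * norm (b t)))" for t
    unfolding g_def
    by (rule apply_bcomp[where \<phi> = "\<lambda>z. of_real (k * norm z / (1 + k * norm z))"],
      intro continuous_intros) (use nz in auto)
  show ?thesis
  proof
    show "g * a = 0"
    proof (rule bcontfun_eqI)
      fix t
      have "a t * b t = 0" using ab by (metis times_bcontfun.rep_eq zero_bcontfun.rep_eq)
      then show "apply_bcontfun (g * a) t = apply_bcontfun 0 t" by (auto simp: g)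
    qed
    show "norm g \<le> 1"
    proof (rule norm_bcontfun_le)
      fix t
      have "0 < 1 + k * norm (b t)" using k by (simp add: add_pos_nonneg)
      then show "norm (apply_bcontfun g t) \<le> 1"
        using k unfolding g norm_of_real by (simp add: divide_le_eq)
    qed
    show "norm (g * b - b) \<le> 1 / real (Suc n)"
    proof (rule norm_bcontfun_le)
      fix t
      define s where "s = norm (b t)"
      have s: "0 \<le> s" "0 < 1 + k * s" using k by (auto simp: s_def add_pos_nonneg)
      have "apply_bcontfun (g * b - b) t = of_real (k * s / (1 + k * s) - 1) * b t"
        by (simp add: g s_def left_diff_distrib)
      then have "norm (apply_bcontfun (g * b - b) t) = \<bar>k * s / (1 + k * s) - 1\<bar> * s"
        by (simp only: norm_mult norm_of_real s_def)
      also have "k * s / (1 + k * s) - 1 = - (1 / (1 + k * s))" using s(2) by (simp add: field_simps)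
      also have "\<bar>- (1 / (1 + k * s))\<bar> * s = s / (1 + k * s)" using s by simp
      also have "\<dots> \<le> 1 / k" using s k by (simp add: field_simps)
      finally show "norm (apply_bcontfun (g * b - b) t) \<le> 1 / real (Suc n)" by (simp only: k_def)
    qed
  qed
qed

section \<open>Disjointness preserving actions are contractive\<close>

text \<open>A common frame for real and complex scalars, which act through the constant
  functions.\<close>

locale bcontfun_action =
  fixes A :: "('k::topological_space \<Rightarrow>\<^sub>C 's::{real_normed_field,heine_borel}) \<Rightarrow> 'v::real_normed_vector \<Rightarrow> 'v"
    and B :: real
  assumes A_add_left: "A (a + b) v = A a v + A b v"
    and A_add_right: "A a (u + v) = A a u + A a v"
    and A_mult: "A (a * b) v = A a (A b v)"
    and A_one: "A 1 v = v"
    and A_bound: "norm (A a v) \<le> B * norm a * norm v"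
begin

lemma A_zero_left [simp]: "A 0 v = 0"
  using A_add_left[of 0 0 v] by simp

lemma A_zero_right [simp]: "A a 0 = 0"
  using A_add_right[of a 0 0] by simp

lemma A_minus_left: "A (- a) v = - A a v"
  using A_add_left[of a "- a" v] by (simp add: eq_neg_iff_add_eq_0 add.commute)

lemma A_minus_right: "A a (- v) = - A a v"
  using A_add_right[of a v "- v"] by (simp add: eq_neg_iff_add_eq_0 add.commute)

lemma A_diff_left: "A (a - b) v = A a v - A b v"
  using A_add_left[of a "- b" v] by (simp add: A_minus_left)

lemma A_diff_right: "A a (u - v) = A a u - A a v"
  using A_add_right[of a u "- v"] by (simp add: A_minus_right)

lemma A_commute: "A a (A b v) = A b (A a v)"
proof -
  have "a * b = b * a" by (rule bcontfun_eqI) (simp add: mult.commute)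
  then show ?thesis by (metis A_mult)
qed

lemma A_sum: "A (\<Sum>i\<in>I. a i) v = (\<Sum>i\<in>I. A (a i) v)"
  by (induction I rule: infinite_finite_induct) (auto simp: A_add_left)

lemma A_bound_abs: "norm (A a v) \<le> \<bar>B\<bar> * norm a * norm v"
  using A_bound[of a v] mult_right_mono[OF abs_ge_self[of B], of "norm a * norm v"]
  by (simp add: mult.assoc)


definition orbit :: "'v \<Rightarrow> 'v set"
  where "orbit v = closure (range (\<lambda>a. A a v))"

lemma closed_orbit: "closed (orbit v)"
  by (simp add: orbit_def)

lemma orbit_self: "v \<in> orbit v"
  unfolding orbit_def by (rule subsetD[OF closure_subset]) (metis A_one rangeI)

lemma A_in_orbit: "A a v \<in> orbit v"
  unfolding orbit_def by (rule subsetD[OF closure_subset]) simp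

lemma orbit_approx:
  assumes "u \<in> orbit v" "0 < e"
  obtains b where "norm (A b v - u) < e"
  using assms unfolding orbit_def closure_approachable dist_norm by auto

lemma orbitI:
  assumes "\<And>e. 0 < e \<Longrightarrow> \<exists>b. norm (A b v - u) < e"
  shows "u \<in> orbit v"
  using assms unfolding orbit_def closure_approachable dist_norm by auto

lemma orbit_invariant:
  assumes "u \<in> orbit v"
  shows "A a u \<in> orbit v"
proof (rule orbitI)
  fix e :: real assume e: "0 < e"
  have pos: "0 < \<bar>B\<bar> * norm a + 1" by (simp add: add_nonneg_pos)
  obtain b where b: "norm (A b v - u) < e / (\<bar>B\<bar> * norm a + 1)"
    by (rule orbit_approx[OF assms, of "e / (\<bar>B\<bar> * norm a + 1)"]) (use e pos in auto)
  have "norm (A (a * b) v - A a u) \<le> \<bar>B\<bar> * norm a * norm (A b v - u)"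
    using A_bound_abs[of a "A b v - u"] by (simp add: A_mult A_diff_right)
  also have "\<dots> \<le> (\<bar>B\<bar> * norm a + 1) * norm (A b v - u)" by (intro mult_right_mono) auto
  also have "\<dots> < e" using b pos by (simp add: field_simps)
  finally show "\<exists>b. norm (A b v - A a u) < e" by blast
qed

lemma orbit_add:
  assumes "u \<in> orbit v" "w \<in> orbit v"
  shows "u + w \<in> orbit v"
proof (rule orbitI)
  fix e :: real assume "0 < e"
  then have e: "0 < e / 2" by simp
  obtain b where b: "norm (A b v - u) < e / 2" by (rule orbit_approx[OF assms(1) e])
  obtain c where c: "norm (A c v - w) < e / 2" by (rule orbit_approx[OF assms(2) e])
  have "A (b + c) v - (u + w) = (A b v - u) + (A c v - w)" by (simp add: A_add_left)
  then have "norm (A (b + c) v - (u + w)) < e"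
    using norm_triangle_ineq[of "A b v - u" "A c v - w"] b c by (simp only:)
  then show "\<exists>b. norm (A b v - (u + w)) < e" by blast
qed

text \<open>The functions \<open>n \<bar>b\<bar> / (1 + n \<bar>b\<bar>)\<close> form an approximate unit for \<open>b\<close> and annihilate \<open>a\<close>.\<close>

lemma orbit_disjoint:
  fixes a b :: "'k \<Rightarrow>\<^sub>C 's"
  assumes ab: "a * b = 0" and y: "y \<in> orbit (A a u)" "y \<in> orbit (A b v)"
  shows "y = 0"
proof -
  have annihilate: "A g y = 0" if "g * a = 0" for g
  proof -
    have "norm (A g y) < e" if e: "0 < e" for e
    proof -
      have pos: "0 < \<bar>B\<bar> * norm g + 1" by (simp add: add_nonneg_pos)
      obtain c where c: "norm (A c (A a u) - y) < e / (\<bar>B\<bar> * norm g + 1)"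
        by (rule orbit_approx[OF y(1), of "e / (\<bar>B\<bar> * norm g + 1)"]) (use e pos in auto)
      have "A g (A c (A a u)) = A c (A (g * a) u)" by (simp add: A_mult A_commute[of g c])
      then have "norm (A g y) = norm (A g (A c (A a u) - y))"
        using \<open>g * a = 0\<close> by (simp add: A_diff_right)
      also have "\<dots> \<le> \<bar>B\<bar> * norm g * norm (A c (A a u) - y)" by (rule A_bound_abs)
      also have "\<dots> \<le> (\<bar>B\<bar> * norm g + 1) * norm (A c (A a u) - y)" by (intro mult_right_mono) auto
      also have "\<dots> < e" using c pos by (simp add: field_simps)
      finally show ?thesis .
    qed
    then show ?thesis by (metis less_irrefl zero_less_norm_iff)
  qed
  \<comment> \<open>\<open>y\<close> is close to \<open>A c (A b v)\<close>, which a suitable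
    \<open>g\<close> almost fixes while it kills \<open>y\<close>. How good the approximate unit
    must be depends on \<open>c\<close>, so \<open>n\<close> is chosen after
    \<open>c\<close>.\<close>
  have "norm y \<le> 0 + e" if e: "0 < e" for e
  proof -
    have pos: "0 < \<bar>B\<bar> + 1" by (simp add: add_nonneg_pos)
    obtain c where c: "norm (A c (A b v) - y) < e / 2 / (\<bar>B\<bar> + 1)"
      by (rule orbit_approx[OF y(2), of "e / 2 / (\<bar>B\<bar> + 1)"]) (use e pos in auto)
    define K where "K = \<bar>B\<bar> * norm c * (\<bar>B\<bar> * norm v)"
    have K: "0 \<le> K" by (simp add: K_def)
    obtain n where n: "2 * K / e < real (Suc n)" using reals_Archimedean2 less_Suc_eq
      by (metis of_nat_less_iff order_less_trans)
    obtain g where g: "g * a = 0" "norm g \<le> 1" "norm (g * b - b) \<le> 1 / real (Suc n)"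
      by (rule bcontfun_approximate_unit[OF ab])
    define z where "z = A c (A b v)"
    have "A g z - z = A c (A (g * b - b) v)"
      by (simp add: z_def A_diff_left A_diff_right A_mult A_commute[of g c])
    then have "norm (A g z - z) \<le> \<bar>B\<bar> * norm c * (\<bar>B\<bar> * norm (g * b - b) * norm v)"
      using order_trans[OF A_bound_abs mult_left_mono[OF A_bound_abs]] by auto
    also have "\<dots> = K * norm (g * b - b)" by (simp add: K_def)
    also have "\<dots> \<le> K * (1 / real (Suc n))" by (intro mult_left_mono g K)
    also have "\<dots> \<le> e / 2" using n e by (simp add: field_simps)
    finally have 1: "norm (A g z - z) \<le> e / 2" .
    have "norm (A g (z - y)) \<le> \<bar>B\<bar> * norm g * norm (z - y)" by (rule A_bound_abs)
    also have "\<dots> \<le> \<bar>B\<bar> * 1 * norm (z - y)" by (intro mult_right_mono mult_left_mono g) auto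
    finally have "norm (A g (z - y)) + norm (z - y) \<le> (\<bar>B\<bar> + 1) * norm (z - y)"
      by (simp add: algebra_simps)
    also have "\<dots> \<le> e / 2" using c pos by (simp add: z_def field_simps)
    finally have 2: "norm (A g (z - y)) + norm (z - y) \<le> e / 2" .
    have "y = A g (z - y) - (A g z - z) - (z - y)"
      using annihilate[OF g(1)] by (simp add: A_diff_right)
    then have "norm y \<le> norm (A g (z - y)) + norm (A g z - z) + norm (z - y)"
      by (metis norm_triangle_ineq4 order_trans add_right_mono)
    then show ?thesis using 1 2 by simp
  qed
  then have "norm y \<le> 0" by (rule field_le_epsilon)
  then show ?thesis by simp
qed

end

text \<open>\<open>'v\<close> stands for the lattice \<open>'e\<close> or for its complexification, and \<open>N\<close> for the modulus.\<close>

locale modulus_action = bcontfun_action A B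
  for A :: "('k::topological_space \<Rightarrow>\<^sub>C 's::{real_normed_field,heine_borel}) \<Rightarrow> 'v::real_normed_vector \<Rightarrow> 'v"
    and B :: real +
  fixes N :: "'v \<Rightarrow> 'e::banach_lattice"
  assumes N_add: "N (u + v) \<le> N u + N v"
    and N_const: "N (A (const_bcontfun s) u) = norm s *\<^sub>R N u"
    and norm_N: "norm (N u) = norm u"
    and N_nonneg: "0 \<le> N u"
    and N_disjoint: "a * b = 0 \<Longrightarrow> N (A a u) + N (A b u) \<le> N (A a u + A b u)"
begin

lemma N_zero: "N 0 = 0"
  using norm_N[of 0] by simp

lemma N_minus: "N (- u) = N u"
proof -
  have "const_bcontfun (- 1) = (- 1 :: 'k \<Rightarrow>\<^sub>C 's)" by (rule bcontfun_eqI) simp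
  then show ?thesis using N_const[of "- 1" u] by (simp add: A_minus_left A_one)
qed

lemma N_sum_le: "N (\<Sum>i\<in>I. f i) \<le> (\<Sum>i\<in>I. N (f i))"
  by (induction I rule: infinite_finite_induct) (auto simp: N_zero intro: order_trans[OF N_add])

lemma N_sum_disjoint:
  assumes "finite I" "\<And>i j. i \<in> I \<Longrightarrow> j \<in> I \<Longrightarrow> i \<noteq> j \<Longrightarrow> a i * a j = 0"
  shows "(\<Sum>i\<in>I. N (A (a i) x)) \<le> N (A (\<Sum>i\<in>I. a i) x)"
  using assms
proof (induction I rule: finite_induct)
  case (insert j I)
  then have "a j * (\<Sum>i\<in>I. a i) = 0" by (auto simp: sum_distrib_left intro!: sum.neutral)
  then have "N (A (a j) x) + N (A (\<Sum>i\<in>I. a i) x) \<le> N (A (a j) x + A (\<Sum>i\<in>I. a i) x)"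
    by (rule N_disjoint)
  moreover have "(\<Sum>i\<in>I. N (A (a i) x)) \<le> N (A (\<Sum>i\<in>I. a i) x)"
    using insert by (intro insert.IH) auto
  ultimately have "N (A (a j) x) + (\<Sum>i\<in>I. N (A (a i) x)) \<le> N (A (a j) x + A (\<Sum>i\<in>I. a i) x)"
    by (meson add_left_mono order_trans)
  then show ?case using insert by (simp add: A_add_left)
qed (simp add: N_zero)

text \<open>By disjointness the values add up to at most the value at \<open>\<Sum>i<n. r i\<close>,
  a function of norm at most 1; this keeps \<open>n\<close> out of the constant.\<close>

lemma disjointly_bounded_action:
  assumes f: "0 \<le> f"
  shows "disjointly_bounded (\<lambda>r. dual_apply f (N (A (b * bembed r) x))) (norm f * (\<bar>B\<bar> * norm b * norm x))"
  unfolding disjointly_bounded_def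
proof (intro conjI allI impI)
  show "0 \<le> dual_apply f (N (A (b * bembed r) x))" for r by (intro dual_nonneg f N_nonneg)
  show "dual_apply f (N (A (b * bembed (r + s)) x)) \<le>
      dual_apply f (N (A (b * bembed r) x)) + dual_apply f (N (A (b * bembed s) x))" for r s
    using dual_mono[OF f N_add[of "A (b * bembed r) x" "A (b * bembed s) x"]]
    by (simp add: bembed_simps distrib_left A_add_left dual_apply_add)
  fix n :: nat and r :: "nat \<Rightarrow> 'k \<Rightarrow>\<^sub>C real"
  assume r: "\<forall>i<n. \<forall>t. 0 \<le> r i t \<and> r i t \<le> 1" and d: "\<forall>i<n. \<forall>j<n. i \<noteq> j \<longrightarrow> r i * r j = 0"
  have d': "b * bembed (r i) * (b * bembed (r j)) = 0" if "i < n" "j < n" "i \<noteq> j" for i j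
  proof -
    have "r i * r j = 0" using d that by simp
    then have "r i t * r j t = 0" for t by (metis times_bcontfun.rep_eq zero_bcontfun.rep_eq)
    then show ?thesis by (intro bcontfun_eqI) auto
  qed
  have "(\<Sum>i<n. dual_apply f (N (A (b * bembed (r i)) x))) = dual_apply f (\<Sum>i<n. N (A (b * bembed (r i)) x))"
    by (induction n) (auto simp: dual_apply_add)
  also have "\<dots> \<le> dual_apply f (N (A (\<Sum>i<n. b * bembed (r i)) x))"
    by (intro dual_mono f N_sum_disjoint) (auto simp: d')
  also have "(\<Sum>i<n. b * bembed (r i)) = b * bembed (\<Sum>i<n. r i)"
    by (simp add: bembed_sum sum_distrib_left)
  also have "dual_apply f (N (A (b * bembed (\<Sum>i<n. r i)) x)) \<le> norm f * norm (A (b * bembed (\<Sum>i<n. r i)) x)"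
    using norm_dual_apply[of f "N (A (b * bembed (\<Sum>i<n. r i)) x)"] by (simp add: norm_N)
  also have "\<dots> \<le> norm f * (\<bar>B\<bar> * norm (b * bembed (\<Sum>i<n. r i)) * norm x)"
    by (intro mult_left_mono A_bound_abs) simp
  also have "\<dots> \<le> norm f * (\<bar>B\<bar> * norm b * norm x)"
  proof (intro mult_left_mono mult_right_mono)
    have "norm (\<Sum>i<n. r i) \<le> 1" using r d by (intro norm_disjoint_sum_le) auto
    then have "norm b * norm (bembed (\<Sum>i<n. r i) :: 'k \<Rightarrow>\<^sub>C 's) \<le> norm b * 1"
      by (intro mult_left_mono) (simp_all add: norm_bembed)
    then show "norm (b * bembed (\<Sum>i<n. r i)) \<le> norm b" using norm_mult_ineq order_trans by fastforce
  qed auto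
  finally show "(\<Sum>i<n. dual_apply f (N (A (b * bembed (r i)) x))) \<le> norm f * (\<bar>B\<bar> * norm b * norm x)" .
qed

text \<open>\<open>a\<close> is a combination \<open>a1\<close> of disjoint pieces, plus a uniformly
  small \<open>a2\<close>, plus a remainder that \<open>f\<close> hardly sees. Apart from the
  constant of \<open>p\<close>, the bound \<open>B\<close> is used for \<open>a2\<close> only;
  \<open>a1\<close> gets the constant \<open>norm a\<close>, because \<open>N\<close> is additive
  over its pieces. The hypothesis \<open>osc\<close> reduces the oscillation of \<open>a\<close> to
  that of real functions, which can be cut.\<close>

theorem N_contractive:
  assumes osc: "\<And>s t. norm (apply_bcontfun a s - apply_bcontfun a t) \<le> \<bar>apply_bcontfun h1 s - h1 t\<bar> + \<bar>apply_bcontfun h2 s - h2 t\<bar>"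
  shows "N (A a x) \<le> norm a *\<^sub>R N x"
proof (rule le_if_dual_le)
  fix f :: "'e dual" assume f: "0 \<le> f"
  define q where "q v = dual_apply f (N v)" for v
  have q_add: "q (u + v) \<le> q u + q v" for u v
    unfolding q_def using dual_mono[OF f N_add[of u v]] by (simp add: dual_apply_add)
  have q_nonneg: "0 \<le> q v" for v unfolding q_def by (intro dual_nonneg f N_nonneg)
  have q_norm: "q v \<le> norm f * norm v" for v
    unfolding q_def using norm_dual_apply[of f "N v"] by (simp add: norm_N)
  have q_sum: "dual_apply f (\<Sum>i\<in>I. N (g i)) = (\<Sum>i\<in>I. q (g i))" for I :: "(nat \<times> nat) set" and g
    unfolding q_def by (induction I rule: infinite_finite_induct) (auto simp: dual_apply_add)
  \<comment> \<open>A single cut has to make the remainder small both for \<open>1\<close> and for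
    \<open>a\<close>.\<close>
  define p where "p r = q (A (1 * bembed r) x) + q (A (a * bembed r) x)" for r
  have p: "disjointly_bounded p (norm f * (\<bar>B\<bar> * norm (1 :: 'k \<Rightarrow>\<^sub>C 's) * norm x) + norm f * (\<bar>B\<bar> * norm a * norm x))"
    unfolding p_def[abs_def] q_def
    by (intro disjointly_bounded_plus disjointly_bounded_action f)
  have "q (A a x) \<le> norm a * q x + e" if e: "0 < e" for e
  proof -
    define K where "K = norm f * (\<bar>B\<bar> * norm x)"
    have K: "0 \<le> K" by (simp add: K_def)
    \<comment> \<open>\<epsilon> pays for the remainder, which occurs with total weight
      \<open>norm a + 1\<close>, and \<delta> for \<open>a2\<close>, which costs at most
      \<open>K * (2 * \<delta>)\<close>; each gets half of \<open>e\<close>.\<close>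
    define \<epsilon> where "\<epsilon> = e / 2 / (norm a + 1)"
    define \<delta> where "\<delta> = e / 4 / (K + 1)"
    have pos: "0 < norm a + 1" "0 < K + 1" using K by (auto simp: add_nonneg_pos)
    have \<epsilon>: "0 < \<epsilon>" and \<delta>: "0 < \<delta>" using e pos by (auto simp: \<epsilon>_def \<delta>_def)
    obtain I :: "(nat \<times> nat) set" and g where cf: "cutting_family p {h1, h2} \<delta> \<epsilon> I g"
      by (rule cutting_family_exists2[OF p \<delta> \<epsilon>])
    note g = cutting_familyD[OF cf]
    define r where "r = 1 - (\<Sum>i\<in>I. g i)"
    have r: "q (A (bembed r) x) \<le> \<epsilon>" "q (A (a * bembed r) x) \<le> \<epsilon>"
      "q (A (bembed r) x) + q (A (a * bembed r) x) \<le> \<epsilon>"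
      using g(6) q_nonneg[of "A (bembed r) x"] q_nonneg[of "A (a * bembed r) x"]
      by (simp_all add: p_def r_def)
    \<comment> \<open>If \<open>g i\<close> vanishes identically, the point is arbitrary: the piece
      contributes nothing, and \<open>norm (s i) \<le> norm a\<close> holds in any case.\<close>
    define s where "s i = a (SOME t. g i t \<noteq> 0)" for i
    have s: "norm (s i) \<le> norm a" for i unfolding s_def by (rule norm_bounded)
    have as: "norm (a t - s i) \<le> 2 * \<delta>" if "i \<in> I" "g i t \<noteq> 0" for i t
    proof -
      have "g i (SOME t. g i t \<noteq> 0) \<noteq> 0" using that(2) by (rule someI)
      from g(5)[OF _ that(1,2) this] have "\<bar>h1 t - h1 (SOME t. g i t \<noteq> 0)\<bar> \<le> \<delta>"
        "\<bar>h2 t - h2 (SOME t. g i t \<noteq> 0)\<bar> \<le> \<delta>" by auto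
      then show ?thesis unfolding s_def using osc[of t "SOME t. g i t \<noteq> 0"] by linarith
    qed
    define a1 where "a1 = (\<Sum>i\<in>I. const_bcontfun (s i) * bembed (g i))"
    define a2 where "a2 = (\<Sum>i\<in>I. (a - const_bcontfun (s i)) * bembed (g i))"
    have a_eq: "a = a1 + a2 + a * bembed r"
    proof -
      have "a1 + a2 = a * (\<Sum>i\<in>I. bembed (g i))"
        by (simp add: a1_def a2_def sum_distrib_left algebra_simps flip: sum.distrib)
      also have "(\<Sum>i\<in>I. bembed (g i)) = (1 - bembed r :: 'k \<Rightarrow>\<^sub>C 's)"
        by (simp add: r_def bembed_simps bembed_sum)
      finally show ?thesis by (simp add: algebra_simps)
    qed
    have "norm a2 \<le> 2 * \<delta>"
    proof (rule norm_bcontfun_le)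
      fix t
      have "norm (apply_bcontfun a2 t) \<le> (\<Sum>i\<in>I. 2 * \<delta> * g i t)"
        unfolding a2_def sum_bcontfun_apply
      proof (rule sum_norm_le)
        fix i assume i: "i \<in> I"
        show "norm (apply_bcontfun ((a - const_bcontfun (s i)) * bembed (g i)) t) \<le> 2 * \<delta> * g i t"
          using as[OF i, of t] g(2)[OF i, of t] by (cases "g i t = 0") (auto simp: norm_mult mult_right_mono)
      qed
      also have "\<dots> = 2 * \<delta> * (\<Sum>i\<in>I. g i t)" by (simp add: sum_distrib_left)
      also have "\<dots> \<le> 2 * \<delta> * 1" using g(3)[of t] \<delta> by (intro mult_left_mono) auto
      finally show "norm (apply_bcontfun a2 t) \<le> 2 * \<delta>" by simp
    qed
    have "q (A a2 x) \<le> norm f * (\<bar>B\<bar> * norm a2 * norm x)"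
      by (intro order_trans[OF q_norm] mult_left_mono A_bound_abs) simp
    also have "\<dots> = K * norm a2" by (simp add: K_def ac_simps)
    also have "\<dots> \<le> (K + 1) * (2 * \<delta>)" using K \<open>norm a2 \<le> 2 * \<delta>\<close> by (intro mult_mono) auto
    also have "\<dots> = e / 2" using pos by (simp add: \<delta>_def field_simps)
    finally have a2: "q (A a2 x) \<le> e / 2" .
    have "q (A a1 x) \<le> dual_apply f (\<Sum>i\<in>I. N (A (const_bcontfun (s i) * bembed (g i)) x))"
      unfolding q_def a1_def A_sum by (intro dual_mono f N_sum_le)
    also have "\<dots> = (\<Sum>i\<in>I. norm (s i) * q (A (bembed (g i)) x))"
      unfolding q_sum by (simp add: A_mult q_def N_const dual_apply_scaleR)
    also have "\<dots> \<le> (\<Sum>i\<in>I. norm a * q (A (bembed (g i)) x))"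
      by (intro sum_mono mult_right_mono s q_nonneg)
    also have "\<dots> = norm a * dual_apply f (\<Sum>i\<in>I. N (A (bembed (g i)) x))"
      unfolding q_sum by (simp add: sum_distrib_left)
    also have "\<dots> \<le> norm a * q (A (\<Sum>i\<in>I. bembed (g i)) x)"
      unfolding q_def
    proof (intro mult_left_mono dual_mono f N_sum_disjoint g(1))
      fix i j assume "i \<in> I" "j \<in> I" "i \<noteq> j"
      then have "g i * g j = 0" by (rule g(4))
      then show "bembed (g i) * bembed (g j) = (0 :: 'k \<Rightarrow>\<^sub>C 's)" by (metis bembed_simps(2,5))
    qed simp
    also have "(\<Sum>i\<in>I. bembed (g i)) = (1 - bembed r :: 'k \<Rightarrow>\<^sub>C 's)"
      by (simp add: r_def bembed_simps bembed_sum)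
    also have "norm a * q (A (1 - bembed r) x) \<le> norm a * (q x + q (A (bembed r) x))"
      using q_add[of x "- A (bembed r) x"]
      by (intro mult_left_mono) (simp_all add: A_diff_left A_one q_def N_minus)
    finally have a1: "q (A a1 x) \<le> norm a * (q x + q (A (bembed r) x))" .
    have "q (A a x) \<le> q (A a1 x) + q (A a2 x) + q (A (a * bembed r) x)"
      by (subst (1) a_eq) (simp only: A_add_left, meson q_add add_right_mono order_trans)
    also have "\<dots> \<le> norm a * q x + e / 2 + (norm a * q (A (bembed r) x) + q (A (a * bembed r) x))"
      using a1 a2 by (simp add: algebra_simps)
    also have "norm a * q (A (bembed r) x) \<le> norm a * \<epsilon>" by (intro mult_left_mono r) simp
    then have "norm a * q (A (bembed r) x) + q (A (a * bembed r) x) \<le> (norm a + 1) * \<epsilon>"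
      using r(2) by (simp add: algebra_simps)
    also have "(norm a + 1) * \<epsilon> = e / 2" using pos by (simp add: \<epsilon>_def field_simps)
    finally show ?thesis by simp
  qed
  then have "q (A a x) \<le> norm a * q x" by (rule field_le_epsilon)
  then show "dual_apply f (N (A a x)) \<le> dual_apply f (norm a *\<^sub>R N x)"
    by (simp add: q_def dual_apply_scaleR)
qed

end


section \<open>Real scalars: invariant subspaces are ideals\<close>

lemma unital_hom_action:
  assumes "unital_hom m"
  shows "bcontfun_action (\<lambda>a. blinfun_apply (blinfun_apply m a)) (norm m)"
proof
  fix a b u v
  show "norm (m a v) \<le> norm m * norm a * norm v"
    by (intro order_trans[OF norm_blinfun] mult_right_mono norm_blinfun norm_ge_zero)
qed (use assms in \<open>simp_all add: unital_hom_def blinfun.add_left blinfun.add_right\<close>)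

lemma const_bcontfun_scaleR: "const_bcontfun (r::real) = r *\<^sub>R (1 :: 'k::topological_space \<Rightarrow>\<^sub>C real)"
  by (rule bcontfun_eqI) simp

lemma order_idealD:
  assumes "order_ideal F" "x \<in> F" "\<bar>y\<bar> \<le> \<bar>x\<bar>"
  shows "y \<in> F"
  using assms unfolding order_ideal_def by blast

locale ideal_hom =
  fixes m :: "('k::t2_space \<Rightarrow>\<^sub>C real) \<Rightarrow>\<^sub>L ('e::banach_lattice \<Rightarrow>\<^sub>L 'e)"
  assumes hom: "unital_hom m" and ideals: "closed_invariant_are_ideals m"
begin

sublocale bcontfun_action "\<lambda>a. blinfun_apply (blinfun_apply m a)" "norm m"
  by (rule unital_hom_action[OF hom])

lemma order_ideal_orbit: "order_ideal (orbit x)"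
proof -
  have "c *\<^sub>R u \<in> orbit x" if "u \<in> orbit x" for c u
    using orbit_invariant[OF that, of "const_bcontfun c"] A_one[of u]
    by (simp add: const_bcontfun_scaleR blinfun.scaleR_right blinfun.scaleR_left)
  moreover have "0 \<in> orbit x" using A_in_orbit[of 0 x] by simp
  ultimately have "subspace (orbit x)" by (simp add: subspace_def orbit_add)
  then show ?thesis
    using ideals closed_orbit orbit_invariant unfolding closed_invariant_are_ideals_def by blast
qed

lemma disjoint_orbits:
  assumes "a * b = 0"
  shows "inf \<bar>m a u\<bar> \<bar>m b v\<bar> = 0"
proof (rule orbit_disjoint[OF assms])
  show "inf \<bar>m a u\<bar> \<bar>m b v\<bar> \<in> orbit (m a u)" "inf \<bar>m a u\<bar> \<bar>m b v\<bar> \<in> orbit (m b v)"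
    by (rule order_idealD[OF order_ideal_orbit orbit_self], simp add: abs_of_nonneg)+
qed

sublocale modulus_action "\<lambda>a. blinfun_apply (blinfun_apply m a)" "norm m" abs
proof
  fix a b u v s
  show "\<bar>u + v\<bar> \<le> \<bar>u\<bar> + \<bar>v\<bar>" for u v :: 'e by (rule abs_triangle_ineq)
  show "\<bar>m (const_bcontfun s) u\<bar> = norm s *\<^sub>R \<bar>u\<bar>"
    using A_one[of u]
    by (simp add: const_bcontfun_scaleR blinfun.scaleR_right blinfun.scaleR_left abs_scaleR_lattice)
  show "\<bar>m a u\<bar> + \<bar>m b u\<bar> \<le> \<bar>m a u + m b u\<bar>" if "a * b = 0"
    using abs_add_disjoint[OF disjoint_orbits[OF that]] by simp
qed auto

lemma contractive: "\<bar>m a x\<bar> \<le> norm a *\<^sub>R \<bar>x\<bar>"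
  by (rule N_contractive[where ?h1.0 = a and ?h2.0 = 0]) simp

lemma contractive_norm: "norm (m a x) \<le> norm a * norm x"
  using norm_le_of_abs_le[OF contractive[of a x]] by simp

text \<open>For \<open>a \<ge> 0\<close> the function \<open>norm a - a\<close> again has norm at
  most \<open>norm a\<close>, so contractivity bounds \<open>norm a *\<^sub>R x - m a x\<close> by
  \<open>norm a *\<^sub>R x\<close>.\<close>

lemma nonneg: "0 \<le> m a x" if a: "\<And>t. 0 \<le> apply_bcontfun a t" and x: "0 \<le> x"
proof -
  define c where "c = norm a *\<^sub>R 1 - a"
  have "norm c \<le> norm a"
    using a norm_bounded[of a] by (intro norm_bcontfun_le) (auto simp: c_def abs_le_iff)
  have "m c x = norm a *\<^sub>R x - m a x"
    using A_one[of x] by (simp add: c_def A_diff_left blinfun.scaleR_right blinfun.scaleR_left)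
  then have "norm a *\<^sub>R x - m a x \<le> \<bar>m c x\<bar>" using abs_ge_self[of "m c x"] by simp
  also have "\<dots> \<le> norm c *\<^sub>R \<bar>x\<bar>" by (rule contractive)
  also have "\<dots> \<le> norm a *\<^sub>R x" using x \<open>norm c \<le> norm a\<close> by (simp add: abs_of_nonneg scaleR_right_mono)
  finally show ?thesis by simp
qed

lemma mono: "m a x \<le> m b x" if "\<And>t. apply_bcontfun a t \<le> apply_bcontfun b t" "0 \<le> x"
  using nonneg[of "b - a" x] that by (simp add: A_diff_left)

lemma abs_le:
  assumes "\<And>t. \<bar>apply_bcontfun a t\<bar> \<le> apply_bcontfun b t"
  shows "\<bar>m a y\<bar> \<le> m b \<bar>y\<bar>"
proof -
  have *: "\<bar>m a z\<bar> \<le> m b z" if "0 \<le> z" for z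
  proof (rule abs_leI)
    show "m a z \<le> m b z" using assms that by (intro mono) (auto simp: abs_le_iff)
    have "m (- a) z \<le> m b z" using assms that by (intro mono) (auto simp: abs_le_iff)
    then show "- m a z \<le> m b z" by (simp add: A_minus_left)
  qed
  have "\<bar>m a y\<bar> = \<bar>m a (sup y 0) - m a (sup (- y) 0)\<bar>"
    using pos_neg_parts(1)[of y] by (metis A_diff_right)
  also have "\<dots> \<le> \<bar>m a (sup y 0)\<bar> + \<bar>m a (sup (- y) 0)\<bar>" by (rule abs_triangle_ineq4)
  also have "\<dots> \<le> m b (sup y 0) + m b (sup (- y) 0)" by (intro add_mono *) auto
  also have "\<dots> = m b \<bar>y\<bar>" by (simp add: pos_neg_parts(2) A_add_right)
  finally show ?thesis .
qed

lemma mono_right: "m b x \<le> m b y" if "\<And>t. 0 \<le> apply_bcontfun b t" "x \<le> y"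
  using nonneg[of b "y - x"] that by (simp add: A_diff_right)

text \<open>The positive and negative parts of \<open>a\<close> are disjoint functions, so they send
  \<open>x\<close> to disjoint positive vectors, and these can only be the two parts of
  \<open>m a x\<close>. Functional calculus on \<open>a\<close> thus computes lattice operations on
  \<open>m a x\<close>.\<close>

lemma pos_part:
  assumes x: "0 \<le> x"
  shows "sup (m a x) 0 = m (bcomp (\<lambda>s. max s 0) a) x"
proof -
  define p n where "p = bcomp (\<lambda>s. max s 0) a" and "n = bcomp (\<lambda>s. max (- s) 0) a"
  have p: "p t = max (a t) 0" and n: "n t = max (- a t) 0" for t
    unfolding p_def n_def by (intro apply_bcomp continuous_intros)+
  have pn: "p * n = 0" "a = p - n" by (rule bcontfun_eqI; simp add: p n max_def)+
  have "0 \<le> m p x" "0 \<le> m n x" using x by (intro nonneg; simp add: p n)+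
  then have "inf (m p x) (m n x) = 0"
    using disjoint_orbits[OF pn(1), of x x] by (simp only: abs_of_nonneg)
  from sup_diff_zero_disjoint[OF this] have "sup (m a x) 0 = m p x"
    by (simp only: A_diff_left pn(2))
  then show ?thesis by (simp only: p_def)
qed

lemma modulus:
  assumes x: "0 \<le> x"
  shows "\<bar>m a x\<bar> = m (bcomp abs a) x"
proof -
  define p q where "p = bcomp (\<lambda>s. max s 0) a" and "q = bcomp abs a"
  have pq: "p t = max (a t) 0" "q t = \<bar>a t\<bar>" for t
    unfolding p_def q_def by (intro apply_bcomp continuous_intros)+
  have "\<bar>m a x\<bar> = 2 *\<^sub>R m p x - m a x"
    using abs_add_self[of "m a x"] by (simp add: pos_part[OF x] p_def algebra_simps)
  also have "\<dots> = m (2 *\<^sub>R p - a) x"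
    by (simp add: A_diff_left blinfun.scaleR_right blinfun.scaleR_left)
  also have "2 *\<^sub>R p - a = q"
    by (rule bcontfun_eqI) (simp add: pq max_def)
  finally show ?thesis by (simp only: q_def)
qed

text \<open>Clamping an approximating \<open>b\<close> to \<open>[- 1, 1]\<close> costs no more than
  the approximation itself: the loss is at most the positive part of
  \<open>\<bar>m b x\<bar> - x\<close>, and this is below \<open>\<bar>m b x - y\<bar>\<close>
  because \<open>\<bar>y\<bar> \<le> x\<close>.\<close>

lemma clamped_approx:
  assumes y: "\<bar>y\<bar> \<le> x" and e: "0 < e"
  obtains c where "norm c \<le> 1" "norm (m c x - y) < e"
proof -
  have x: "0 \<le> x" using y abs_ge_zero order_trans by blast
  have "y \<in> orbit x"
    by (rule order_idealD[OF order_ideal_orbit orbit_self]) (use y x in \<open>simp add: abs_of_nonneg\<close>)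
  then obtain b where b: "norm (m b x - y) < e / 2"
    by (rule orbit_approx[where e = "e / 2"]) (use e in auto)
  define c where "c = bcomp (\<lambda>s. max (- 1) (min 1 s)) b"
  define d where "d = bcomp (\<lambda>s. max s 0) (bcomp abs b - 1)"
  have c: "c t = max (- 1) (min 1 (b t))" for t unfolding c_def by (intro apply_bcomp continuous_intros)
  have d: "d t = max (\<bar>b t\<bar> - 1) 0" for t unfolding d_def by (simp add: apply_bcomp continuous_intros)
  have "\<bar>m (b - c) x\<bar> \<le> m d \<bar>x\<bar>" by (rule abs_le) (auto simp: c d)
  also have "\<dots> = sup (m (bcomp abs b - 1) x) 0" using x by (simp add: pos_part d_def abs_of_nonneg)
  also have "\<dots> = sup (\<bar>m b x\<bar> - x) 0" using x by (simp add: A_diff_left A_one modulus)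
  also have "\<dots> \<le> sup \<bar>m b x - y\<bar> 0"
  proof (intro sup_mono order_refl)
    have "\<bar>m b x\<bar> - x \<le> \<bar>m b x\<bar> - \<bar>y\<bar>" using y by (rule diff_left_mono)
    also have "\<dots> \<le> \<bar>m b x - y\<bar>" by (rule abs_triangle_ineq2)
    finally show "\<bar>m b x\<bar> - x \<le> \<bar>m b x - y\<bar>" .
  qed
  also have "\<dots> = \<bar>m b x - y\<bar>" by (simp add: sup_absorb1)
  finally have "norm (m (b - c) x) \<le> norm (m b x - y)" by (rule norm_mono_abs)
  moreover have "m c x - y = (m b x - y) - m (b - c) x" by (simp add: A_diff_left)
  then have "norm (m c x - y) \<le> norm (m b x - y) + norm (m (b - c) x)"
    by (simp only: norm_triangle_ineq4)
  ultimately have "norm (m c x - y) < e" using b by simp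
  moreover have "norm c \<le> 1" by (rule norm_bcontfun_le) (auto simp: c)
  ultimately show ?thesis using that by blast
qed

end


section \<open>The center of the dual and the Arens extension\<close>

lemma ideal_centerE:
  assumes "T \<in> ideal_center"
  obtains M where "0 < M" "\<And>g. \<bar>blinfun_apply T g\<bar> \<le> M *\<^sub>R \<bar>g\<bar>"
proof -
  obtain M where M: "0 < M" "\<And>x. 0 \<le> x \<Longrightarrow> \<bar>blinfun_apply T x\<bar> \<le> M *\<^sub>R x"
    using assms unfolding ideal_center_def by blast
  have "\<bar>blinfun_apply T g\<bar> \<le> M *\<^sub>R \<bar>g\<bar>" for g
  proof -
    have "\<bar>T g\<bar> = \<bar>T (sup g 0) - T (sup (- g) 0)\<bar>"
      using pos_neg_parts(1)[of g] by (metis blinfun.diff_right)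
    also have "\<dots> \<le> \<bar>T (sup g 0)\<bar> + \<bar>T (sup (- g) 0)\<bar>" by (rule abs_triangle_ineq4)
    also have "\<dots> \<le> M *\<^sub>R sup g 0 + M *\<^sub>R sup (- g) 0" by (intro add_mono M) auto
    also have "\<dots> = M *\<^sub>R \<bar>g\<bar>" by (simp add: pos_neg_parts(2) scaleR_add_right)
    finally show ?thesis .
  qed
  then show ?thesis using that M(1) by blast
qed

definition dual_adjoint :: "('a::real_normed_vector \<Rightarrow>\<^sub>L 'a) \<Rightarrow> 'a dual \<Rightarrow> 'a dual"
  where "dual_adjoint S f = Dual (Blinfun (\<lambda>x. dual_apply f (S x)))"

lemma dual_adjoint_apply [simp]: "dual_apply (dual_adjoint S f) x = dual_apply f (S x)"
  unfolding dual_adjoint_def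
  by (simp add: dual_apply_Dual bounded_linear_compose[OF bounded_linear_dual_apply blinfun.bounded_linear_right])

lemma dual_adjoint_simps:
  "dual_adjoint 0 f = 0" "dual_adjoint (S + T) f = dual_adjoint S f + dual_adjoint T f"
  "dual_adjoint (S - T) f = dual_adjoint S f - dual_adjoint T f" "dual_adjoint (r *\<^sub>R S) f = r *\<^sub>R dual_adjoint S f"
  by (rule dual_eqI; simp add: blinfun.bilinear_simps dual_apply_add dual_apply_diff dual_apply_scaleR)+

text \<open>Here the pieces may overlap, so nothing has to remain uncovered: they are differences of
  consecutive ramps, and their sum telescopes.\<close>

lemma partition_of_unity:
  fixes b :: "'k::topological_space \<Rightarrow>\<^sub>C real"
  assumes \<delta>: "0 < \<delta>"
  obtains n :: nat and e :: "nat \<Rightarrow> 'k \<Rightarrow>\<^sub>C real" and s where "(\<Sum>i<n. e i) = 1" "\<And>i t. 0 \<le> e i t"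
    "\<And>i t. e i t \<noteq> 0 \<Longrightarrow> \<bar>b t - s i\<bar> \<le> \<delta>"
proof -
  obtain n :: nat where n: "2 * norm b < real n * \<delta>" using reals_Archimedean3[OF \<delta>] by blast
  define u where "u t = (b t + norm b) / \<delta>" for t
  define e where "e i = bcomp (\<lambda>s. ramp ((s + norm b) / \<delta> - real i + 1) - ramp ((s + norm b) / \<delta> - real i)) b" for i
  have e: "e i t = ramp (u t - real i + 1) - ramp (u t - real i)" for i t
    unfolding e_def u_def by (rule apply_bcomp, intro continuous_intros) (use \<delta> in auto)
  have u: "0 \<le> u t" "u t \<le> real n" for t
  proof -
    have "\<bar>b t\<bar> \<le> norm b" using norm_bounded[of b t] by simp
    then show "0 \<le> u t" "u t \<le> real n" using \<delta> n by (auto simp: u_def field_simps abs_le_iff)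
  qed
  show ?thesis
  proof
    \<comment> \<open>\<open>u t\<close> ranges over \<open>[0, n]\<close> and tent \<open>i\<close>
      is centred at \<open>i\<close>; with both ends included this makes \<open>Suc n\<close>
      tents.\<close>
    show "(\<Sum>i<Suc n. e i) = 1"
    proof (rule bcontfun_eqI)
      fix t
      have "(\<Sum>i<k. e i t) = ramp (u t + 1) - ramp (u t - real k + 1)" for k
        by (induction k) (auto simp: e)
      from this[of "Suc n"] show "apply_bcontfun (\<Sum>i<Suc n. e i) t = apply_bcontfun 1 t"
        using u[of t] by (simp add: ramp_def del: sum.lessThan_Suc)
    qed
    show "0 \<le> e i t" for i t by (auto simp: e ramp_def)
    show "\<bar>b t - (real i * \<delta> - norm b)\<bar> \<le> \<delta>" if "e i t \<noteq> 0" for i t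
    proof -
      have "\<bar>u t - real i\<bar> \<le> 1" using that by (rule contrapos_np) (auto simp: e ramp_def)
      then have "\<bar>u t - real i\<bar> * \<delta> \<le> 1 * \<delta>" using \<delta> by (intro mult_right_mono) auto
      also have "\<bar>u t - real i\<bar> * \<delta> = \<bar>(u t - real i) * \<delta>\<bar>" using \<delta> by (simp add: abs_mult)
      also have "(u t - real i) * \<delta> = b t - (real i * \<delta> - norm b)" using \<delta> by (simp add: u_def field_simps)
      finally show ?thesis by simp
    qed
  qed
qed

context ideal_hom
begin

text \<open>The modulus of a functional at \<open>z\<close> is a supremum over
  \<open>[- z, z]\<close>, and \<open>m a\<close> maps this interval into
  \<open>[- m b z, m b z]\<close>.\<close>

lemma dual_adjoint_abs_le:
  assumes "\<And>t. \<bar>apply_bcontfun a t\<bar> \<le> apply_bcontfun b t" "0 \<le> z"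
  shows "dual_apply \<bar>dual_adjoint (m a) f\<bar> z \<le> dual_apply \<bar>f\<bar> (m b z)"
proof (rule dual_abs_leI[OF assms(2)])
  fix y assume y: "\<bar>y\<bar> \<le> z"
  have b: "0 \<le> b t" for t using assms(1)[of t] by simp
  have "dual_apply f (m a y) \<le> dual_apply \<bar>f\<bar> \<bar>m a y\<bar>" using dual_abs_bound[of f "m a y"] by simp
  also have "\<dots> \<le> dual_apply \<bar>f\<bar> (m b z)"
    by (intro dual_mono abs_ge_zero order_trans[OF abs_le[OF assms(1)] mono_right[OF b y]])
  finally show "dual_apply (dual_adjoint (m a) f) y \<le> dual_apply \<bar>f\<bar> (m b z)" by simp
qed



text \<open>The bilinear form \<open>(a, c) \<mapsto> (T (f \<circ> a)) (c x)\<close> is dominated by \<open>\<bar>f\<bar> (\<bar>a c\<bar> x)\<close>, so it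
  depends on \<open>a c\<close> only.\<close>

lemma center_commute:
  assumes T: "T \<in> ideal_center"
  shows "dual_apply (blinfun_apply T (dual_adjoint (m b) f)) x = dual_apply (T f) (m b x)"
proof -
  obtain M where M: "0 < M" "\<And>g. \<bar>blinfun_apply T g\<bar> \<le> M *\<^sub>R \<bar>g\<bar>" by (rule ideal_centerE[OF T]) blast
  have pos: "dual_apply (T (dual_adjoint (m b) f)) x = dual_apply (T f) (m b x)" if x: "0 \<le> x" for x
  proof -
    define \<beta> where "\<beta> a c = dual_apply (T (dual_adjoint (m a) f)) (m c x)" for a c
    have \<beta>_sum: "\<beta> (\<Sum>i\<in>I. a i) c = (\<Sum>i\<in>I. \<beta> (a i) c)" "\<beta> a' (\<Sum>i\<in>I. c' i) = (\<Sum>i\<in>I. \<beta> a' (c' i))"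
      for I :: "nat set" and a c a' c'
      unfolding \<beta>_def
      by (induction I rule: infinite_finite_induct;
        simp add: blinfun.bilinear_simps dual_adjoint_simps dual_apply_add)+
    have \<beta>_simps: "\<beta> (a - a') c = \<beta> a c - \<beta> a' c" "\<beta> (r *\<^sub>R a) c = r * \<beta> a c"
      "\<beta> a (c - c') = \<beta> a c - \<beta> a c'" "\<beta> a (r *\<^sub>R c) = r * \<beta> a c" for a a' c c' r
      unfolding \<beta>_def
      by (simp_all add: blinfun.bilinear_simps dual_adjoint_simps dual_apply_diff dual_apply_scaleR)
    define \<nu> where "\<nu> d = M * dual_apply \<bar>f\<bar> (m d x)" for d
    have \<beta>_bound: "\<bar>\<beta> a c\<bar> \<le> \<nu> d" if d: "\<And>t. \<bar>a t * c t\<bar> \<le> d t" for a c d :: "'k \<Rightarrow>\<^sub>C real"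
    proof -
      have ab: "\<bar>a t\<bar> \<le> bcomp abs a t" "\<bar>c t\<bar> \<le> bcomp abs c t" for t
        by (simp_all add: apply_bcomp continuous_intros)
      have "\<bar>\<beta> a c\<bar> \<le> dual_apply \<bar>T (dual_adjoint (m a) f)\<bar> \<bar>m c x\<bar>"
        unfolding \<beta>_def by (rule dual_abs_bound)
      also have "\<dots> \<le> dual_apply (M *\<^sub>R \<bar>dual_adjoint (m a) f\<bar>) \<bar>m c x\<bar>"
        by (intro dual_leD M) simp
      also have "\<dots> \<le> M * dual_apply \<bar>f\<bar> (m (bcomp abs a) \<bar>m c x\<bar>)"
        using dual_adjoint_abs_le[OF ab(1), of "\<bar>m c x\<bar>" f] M(1) by simp
      also have "\<dots> \<le> M * dual_apply \<bar>f\<bar> (m (bcomp abs a) (m (bcomp abs c) x))"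
        using M(1) abs_le[OF ab(2), of x] x
        by (intro mult_left_mono dual_mono mono_right) (auto simp: apply_bcomp continuous_intros abs_of_nonneg)
      also have "\<dots> \<le> \<nu> d"
        unfolding \<nu>_def A_mult[symmetric] using M(1) x d
        by (intro mult_left_mono dual_mono mono) (auto simp: apply_bcomp continuous_intros abs_mult)
      finally show ?thesis .
    qed
    have "\<bar>\<beta> b 1 - \<beta> 1 b\<bar> \<le> 0 + \<epsilon>" if \<epsilon>: "0 < \<epsilon>" for \<epsilon>
    proof -
      define K where "K = \<nu> 1"
      have K: "0 \<le> K" unfolding K_def using \<beta>_bound[of 0 0 1] by simp
      \<comment> \<open>The numbers \<open>\<nu> (e i * e j)\<close> add up to \<open>K\<close>
        however fine the partition is, so the total error is at most
        \<open>2 * \<delta> * K\<close>.\<close>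
      define \<delta> where "\<delta> = \<epsilon> / 2 / (K + 1)"
      have \<delta>: "0 < \<delta>" using K \<epsilon> by (simp add: \<delta>_def)
      obtain n :: nat and e s where e: "(\<Sum>i<n. e i) = (1 :: 'k \<Rightarrow>\<^sub>C real)" "\<And>i t. 0 \<le> e i t"
        "\<And>i t. e i t \<noteq> 0 \<Longrightarrow> \<bar>b t - s i\<bar> \<le> \<delta>"
        by (rule partition_of_unity[OF \<delta>, of b]) blast
      have \<nu>_sum: "\<nu> (\<Sum>i\<in>I. d i) = (\<Sum>i\<in>I. \<nu> (d i))" for I :: "nat set" and d
        unfolding \<nu>_def A_sum by (induction I rule: infinite_finite_induct) (auto simp: dual_apply_add distrib_left)
      have bound: "\<bar>\<beta> (b * e i) (e j) - \<beta> (e i) (b * e j)\<bar> \<le> 2 * \<delta> * \<nu> (e i * e j)" for i j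
      proof -
        \<comment> \<open>The number \<open>s i\<close> may be subtracted from \<open>b\<close> in
          both slots, since the two corrections cancel; where \<open>e i * e j\<close> is nonzero,
          \<open>b\<close> is within \<delta> of it.\<close>
        have "\<beta> (b * e i) (e j) - \<beta> (e i) (b * e j) =
          \<beta> (b * e i - s i *\<^sub>R e i) (e j) - \<beta> (e i) (b * e j - s i *\<^sub>R e j)"
          by (simp add: \<beta>_simps)
        moreover have scale: "\<nu> (\<delta> *\<^sub>R (e i * e j)) = \<delta> * \<nu> (e i * e j)"
          by (simp add: \<nu>_def blinfun.scaleR_right blinfun.scaleR_left dual_apply_scaleR)
        have ptw: "\<bar>(b t - s i) * e i t * e j t\<bar> \<le> \<delta> * (e i t * e j t)" for t
          using e(3)[of i t] e(2)[of i t] e(2)[of j t]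
          by (cases "e i t = 0") (auto simp: abs_mult mult.assoc intro!: mult_right_mono)
        have "\<bar>\<beta> (b * e i - s i *\<^sub>R e i) (e j)\<bar> \<le> \<nu> (\<delta> *\<^sub>R (e i * e j))"
          using ptw by (intro \<beta>_bound) (simp add: algebra_simps)
        moreover have "\<bar>\<beta> (e i) (b * e j - s i *\<^sub>R e j)\<bar> \<le> \<nu> (\<delta> *\<^sub>R (e i * e j))"
          using ptw by (intro \<beta>_bound) (simp add: algebra_simps)
        ultimately show ?thesis unfolding scale by linarith
      qed
      have be: "b = (\<Sum>i<n. b * e i)" using e(1) by (simp flip: sum_distrib_left)
      have bs: "\<beta> b y = (\<Sum>i<n. \<beta> (b * e i) y)" "\<beta> y b = (\<Sum>i<n. \<beta> y (b * e i))"
        "\<beta> 1 y = (\<Sum>i<n. \<beta> (e i) y)" "\<beta> y 1 = (\<Sum>i<n. \<beta> y (e i))" for y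
        using \<beta>_sum(1)[of "\<lambda>i. b * e i" "{..<n}" y] \<beta>_sum(2)[of y "\<lambda>i. b * e i" "{..<n}"]
          \<beta>_sum(1)[of e "{..<n}" y] \<beta>_sum(2)[of y e "{..<n}"]
        by (simp_all only: be[symmetric] e(1))
      have "\<beta> b 1 = (\<Sum>i<n. \<Sum>j<n. \<beta> (b * e i) (e j))"
        "\<beta> 1 b = (\<Sum>i<n. \<Sum>j<n. \<beta> (e i) (b * e j))"
        by (simp_all only: bs(1)[of 1] bs(3)[of b] bs(4)[of "b * e _"] bs(2)[of "e _"])
      then have "\<bar>\<beta> b 1 - \<beta> 1 b\<bar> = \<bar>\<Sum>i<n. \<Sum>j<n. \<beta> (b * e i) (e j) - \<beta> (e i) (b * e j)\<bar>"
        by (simp add: sum_subtractf)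
      also have "\<dots> \<le> (\<Sum>i<n. \<Sum>j<n. \<bar>\<beta> (b * e i) (e j) - \<beta> (e i) (b * e j)\<bar>)"
        by (rule order_trans[OF sum_abs sum_mono[OF sum_abs]])
      also have "\<dots> \<le> (\<Sum>i<n. \<Sum>j<n. 2 * \<delta> * \<nu> (e i * e j))" by (intro sum_mono bound)
      also have "\<dots> = 2 * \<delta> * \<nu> (\<Sum>i<n. \<Sum>j<n. e i * e j)" by (simp only: \<nu>_sum) (simp only: sum_distrib_left)
      also have "(\<Sum>i<n. \<Sum>j<n. e i * e j) = 1" using e(1) by (simp flip: sum_product)
      also have "2 * \<delta> * \<nu> 1 \<le> 2 * \<delta> * (K + 1)" using \<delta> by (intro mult_left_mono) (auto simp: K_def)
      also have "\<dots> = \<epsilon>" using K by (simp add: \<delta>_def field_simps)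
      finally show ?thesis by simp
    qed
    then have "\<bar>\<beta> b 1 - \<beta> 1 b\<bar> \<le> 0" by (rule field_le_epsilon)
    moreover have "dual_adjoint (m 1) f = f" by (rule dual_eqI) (simp add: A_one)
    ultimately show ?thesis by (simp add: \<beta>_def A_one)
  qed
  have "dual_apply (T f) (m b x) = dual_apply (T f) (m b (sup x 0)) - dual_apply (T f) (m b (sup (- x) 0))"
    using pos_neg_parts(1)[of x] by (metis A_diff_right dual_apply_diff)
  then show ?thesis
    using pos[of "sup x 0"] pos[of "sup (- x) 0"] dual_apply_parts[of "T (dual_adjoint (m b) f)" x] by simp
qed

text \<open>For \<open>f \<ge> 0\<close> and \<open>\<bar>y\<bar> \<le> x\<close>, contractivity
  bounds the norm of \<open>arens_mu m y f\<close> by \<open>f x\<close>.\<close>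

lemma arens_ext_in_center: "arens_ext m \<Phi> \<in> ideal_center"
proof -
  have "\<bar>arens_ext m \<Phi> f\<bar> \<le> (norm \<Phi> + 1) *\<^sub>R f" if f: "0 \<le> f" for f
  proof (rule dual_leI)
    fix x :: 'e assume x: "0 \<le> x"
    show "dual_apply \<bar>arens_ext m \<Phi> f\<bar> x \<le> dual_apply ((norm \<Phi> + 1) *\<^sub>R f) x"
    proof (rule dual_abs_leI[OF x])
      fix y :: 'e assume y: "\<bar>y\<bar> \<le> x"
      have "norm (arens_mu m y f) \<le> dual_apply f x"
      proof (rule norm_dual_bound)
        fix a
        have "\<bar>dual_apply f (m a y)\<bar> \<le> dual_apply f \<bar>m a y\<bar>" by (rule dual_pos_abs_bound[OF f])
        also have "\<dots> \<le> dual_apply f (norm a *\<^sub>R \<bar>y\<bar>)" by (intro dual_mono f contractive)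
        also have "\<dots> \<le> norm a * dual_apply f x"
          using dual_mono[OF f y] by (simp add: dual_apply_scaleR mult_left_mono)
        finally show "\<bar>dual_apply (arens_mu m y f) a\<bar> \<le> dual_apply f x * norm a"
          by (simp add: arens_mu_apply mult.commute)
      qed (rule dual_nonneg[OF f x])
      then have "norm \<Phi> * norm (arens_mu m y f) \<le> (norm \<Phi> + 1) * dual_apply f x"
        using dual_nonneg[OF f x] by (intro mult_mono) auto
      then show "dual_apply (arens_ext m \<Phi> f) y \<le> dual_apply ((norm \<Phi> + 1) *\<^sub>R f) x"
        using norm_dual_apply[of \<Phi> "arens_mu m y f"] by (simp add: arens_ext_apply)
    qed
  qed
  moreover have "0 < norm \<Phi> + 1" by (simp add: add_nonneg_pos)
  ultimately show ?thesis unfolding ideal_center_def by blast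
qed

lemma center_in_range_arens_ext:
  assumes T: "T \<in> ideal_center"
  shows "T \<in> range (arens_ext m)"
proof -
  obtain M where M: "0 < M" "\<And>g. \<bar>blinfun_apply T g\<bar> \<le> M *\<^sub>R \<bar>g\<bar>" by (rule ideal_centerE[OF T]) blast
  txt \<open>\<open>W\<close> contains \<open>(\<mu>, (T f) z)\<close> for \<open>\<mu> = arens_mu m z f\<close>.  A pair in \<open>W\<close> is, up to \<open>\<epsilon>\<close>, of this form
    with one vector \<open>x \<ge> 0\<close>, where \<open>\<bar>T g\<bar> \<le> M \<bar>g\<bar>\<close> gives \<open>s \<le> M \<parallel>\<Psi>\<parallel>\<close>; so Hahn--Banach applies.\<close>
  define Q where "Q \<Psi> s \<epsilon> x g \<longleftrightarrow> (\<forall>c. norm c \<le> 1 \<longrightarrow> \<bar>dual_apply \<Psi> c - dual_apply g (m c x)\<bar> \<le> \<epsilon>) \<and>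
      \<bar>s - dual_apply (T g) x\<bar> \<le> \<epsilon>" for \<Psi> s \<epsilon> x g
  \<comment> \<open>Asking for all \<open>x\<close> beyond some \<open>x0\<close> gives two pairs a
    common \<open>x\<close>, as closure of \<open>W\<close> under addition requires.\<close>
  define W where "W = {(\<Psi>, s). \<exists>x0\<ge>0. \<forall>x\<ge>x0. \<forall>\<epsilon>>0. \<exists>g. Q \<Psi> s \<epsilon> x g}"
  have W_I: "(\<Psi>, s) \<in> W" if "0 \<le> x0" "\<And>x \<epsilon>. x0 \<le> x \<Longrightarrow> 0 < \<epsilon> \<Longrightarrow> \<exists>g. Q \<Psi> s \<epsilon> x g" for \<Psi> s x0
    using that unfolding W_def by blast
  have W_E: "\<exists>x0\<ge>0. \<forall>x\<ge>x0. \<forall>\<epsilon>>0. \<exists>g. Q \<Psi> s \<epsilon> x g" if "(\<Psi>, s) \<in> W" for \<Psi> s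
    using that unfolding W_def by blast
  have "subspace W"
    unfolding subspace_def
  proof (intro conjI ballI allI)
    have "(0, 0) \<in> W"
      by (rule W_I[of 0]) (auto simp: Q_def blinfun.zero_right intro!: exI[of _ 0])
    then show "0 \<in> W" by (simp add: zero_prod_def)
    fix v w :: "('k \<Rightarrow>\<^sub>C real) dual \<times> real" and r :: real
    assume v: "v \<in> W"
    obtain \<Psi> s where v_eq: "v = (\<Psi>, s)" by fastforce
    obtain x0 where x0: "0 \<le> x0" "\<And>x \<epsilon>. x0 \<le> x \<Longrightarrow> 0 < \<epsilon> \<Longrightarrow> \<exists>g. Q \<Psi> s \<epsilon> x g"
      using W_E v unfolding v_eq by blast
    have "(r *\<^sub>R \<Psi>, r * s) \<in> W"
    proof (rule W_I[OF x0(1)])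
      fix x :: 'e and \<epsilon> :: real assume "x0 \<le> x" and \<epsilon>: "0 < \<epsilon>"
      then obtain g where g: "Q \<Psi> s (\<epsilon> / (\<bar>r\<bar> + 1)) x g" using x0(2)[of x "\<epsilon> / (\<bar>r\<bar> + 1)"] by auto
      have le: "\<bar>r * u - r * w\<bar> \<le> \<epsilon>" if "\<bar>u - w\<bar> \<le> \<epsilon> / (\<bar>r\<bar> + 1)" for u w
      proof -
        have "\<bar>r * u - r * w\<bar> = \<bar>r\<bar> * \<bar>u - w\<bar>" by (simp flip: abs_mult right_diff_distrib)
        also have "\<dots> \<le> (\<bar>r\<bar> + 1) * (\<epsilon> / (\<bar>r\<bar> + 1))" by (intro mult_mono that) auto
        finally show ?thesis by simp
      qed
      have "Q (r *\<^sub>R \<Psi>) (r * s) \<epsilon> x (r *\<^sub>R g)"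
        using g unfolding Q_def by (auto simp: blinfun.scaleR_right intro!: le)
      then show "\<exists>g. Q (r *\<^sub>R \<Psi>) (r * s) \<epsilon> x g" ..
    qed
    then show "r *\<^sub>R v \<in> W" by (simp add: v_eq)
    assume w: "w \<in> W"
    obtain \<Psi>' s' where w_eq: "w = (\<Psi>', s')" by fastforce
    obtain x1 where x1: "0 \<le> x1" "\<And>x \<epsilon>. x1 \<le> x \<Longrightarrow> 0 < \<epsilon> \<Longrightarrow> \<exists>g. Q \<Psi>' s' \<epsilon> x g"
      using W_E w unfolding w_eq by blast
    have "(\<Psi> + \<Psi>', s + s') \<in> W"
    proof (rule W_I[of "x0 + x1"])
      show "0 \<le> x0 + x1" using x0 x1 by simp
      fix x :: 'e and \<epsilon> :: real assume x: "x0 + x1 \<le> x" and \<epsilon>: "0 < \<epsilon>"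
      have "x0 \<le> x0 + x1" "x1 \<le> x0 + x1" using x0(1) x1(1) by simp_all
      then have "x0 \<le> x" "x1 \<le> x" using x by (blast intro: order_trans)+
      then obtain g g' where g: "Q \<Psi> s (\<epsilon> / 2) x g" "Q \<Psi>' s' (\<epsilon> / 2) x g'"
        using x0(2)[of x "\<epsilon> / 2"] x1(2)[of x "\<epsilon> / 2"] \<epsilon> by auto
      have le: "\<bar>u + u' - (w + w')\<bar> \<le> \<epsilon>" if "\<bar>u - w\<bar> \<le> \<epsilon> / 2" "\<bar>u' - w'\<bar> \<le> \<epsilon> / 2" for u u' w w'
        using that by linarith
      have "Q (\<Psi> + \<Psi>') (s + s') \<epsilon> x (g + g')"
        using g unfolding Q_def by (auto simp: blinfun.add_right intro!: le)
      then show "\<exists>g. Q (\<Psi> + \<Psi>') (s + s') \<epsilon> x g" ..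
    qed
    then show "v + w \<in> W" by (simp add: v_eq w_eq)
  qed
  moreover have "s \<le> M * norm \<Psi>" if "(\<Psi>, s) \<in> W" for \<Psi> s
  proof (rule field_le_epsilon)
    fix \<epsilon> :: real assume \<epsilon>: "0 < \<epsilon>"
    obtain x where x: "0 \<le> x" "\<And>\<epsilon>. 0 < \<epsilon> \<Longrightarrow> \<exists>g. Q \<Psi> s \<epsilon> x g"
      using W_E[OF \<open>(\<Psi>, s) \<in> W\<close>] by blast
    define \<eta> where "\<eta> = \<epsilon> / (M + 1)"
    have \<eta>: "0 < \<eta>" using \<epsilon> M(1) by (simp add: \<eta>_def)
    obtain g where g: "Q \<Psi> s \<eta> x g" using x(2)[OF \<eta>] by blast
    \<comment> \<open>\<open>\<bar>g\<bar> x\<close> is the supremum of \<open>g\<close> over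
      \<open>[- x, x]\<close>, in which the vectors \<open>m c x\<close> with
      \<open>norm c \<le> 1\<close> are dense by \<open>clamped_approx\<close>; on those
      \<open>g\<close> is within \<eta> of \<Psi>.\<close>
    have "dual_apply \<bar>g\<bar> x \<le> norm \<Psi> + \<eta>"
    proof (rule dual_abs_leI[OF x(1)], rule field_le_epsilon)
      fix y and r :: real assume y: "\<bar>y\<bar> \<le> x" and r: "0 < r"
      have gp: "0 < norm g + 1" by (simp add: add_nonneg_pos)
      obtain c where c: "norm c \<le> 1" "norm (m c x - y) < r / (norm g + 1)"
        by (rule clamped_approx[OF y, of "r / (norm g + 1)"]) (use r gp in auto)
      have "dual_apply g y - dual_apply g (m c x) \<le> norm g * norm (m c x - y)"
        using norm_dual_apply[of g "m c x - y"] by (simp add: dual_apply_diff)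
      also have "\<dots> \<le> (norm g + 1) * (r / (norm g + 1))" using c by (intro mult_mono) auto
      also have "\<dots> = r" using gp by simp
      finally have "dual_apply g y \<le> dual_apply g (m c x) + r" by simp
      also have "dual_apply g (m c x) \<le> dual_apply \<Psi> c + \<eta>"
        using g c(1) unfolding Q_def by (auto simp: abs_le_iff dest!: spec[of _ c])
      also have "dual_apply \<Psi> c \<le> norm \<Psi> * norm c" using norm_dual_apply[of \<Psi> c] by simp
      also have "\<dots> \<le> norm \<Psi> * 1" by (intro mult_left_mono c) simp
      finally show "dual_apply g y \<le> norm \<Psi> + \<eta> + r" by simp
    qed
    then have "M * dual_apply \<bar>g\<bar> x \<le> M * (norm \<Psi> + \<eta>)" using M(1) by (intro mult_left_mono) auto
    moreover have "s \<le> dual_apply (T g) x + \<eta>" using g unfolding Q_def by linarith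
    moreover have "dual_apply (T g) x \<le> dual_apply \<bar>T g\<bar> x" by (intro dual_leD abs_ge_self x(1))
    moreover have "\<dots> \<le> dual_apply (M *\<^sub>R \<bar>g\<bar>) x" by (intro dual_leD M x(1))
    ultimately have "s \<le> M * norm \<Psi> + (M + 1) * \<eta>" by (simp add: algebra_simps)
    then show "s \<le> M * norm \<Psi> + \<epsilon>" using M(1) by (simp add: \<eta>_def)
  qed
  ultimately obtain \<Phi> where \<Phi>: "\<And>\<Psi> s. (\<Psi>, s) \<in> W \<Longrightarrow> dual_apply \<Phi> \<Psi> = s"
    by (rule Hahn_Banach_relation) (use M(1) in auto)
  have "(arens_mu m z f, dual_apply (T f) z) \<in> W" for z f
  proof (rule W_I[of "\<bar>z\<bar>"])
    fix x :: 'e and \<epsilon> :: real assume x: "\<bar>z\<bar> \<le> x" and \<epsilon>: "0 < \<epsilon>"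
    define K where "K = norm f + norm (T f) + 1"
    have K: "0 < K" by (simp add: K_def add_nonneg_pos)
    obtain b where "norm (m b x - z) < \<epsilon> / K" by (rule clamped_approx[OF x, of "\<epsilon> / K"]) (use K \<epsilon> in auto)
    then have b: "K * norm (z - m b x) \<le> \<epsilon>" using K by (simp add: field_simps norm_minus_commute)
    \<comment> \<open>With \<open>z\<close> close to \<open>m b x\<close>, the factor
      \<open>b\<close> is moved from the vector to the functional; \<open>center_commute\<close>
      says that \<open>T\<close> respects this move.\<close>
    have "Q (arens_mu m z f) (dual_apply (T f) z) \<epsilon> x (dual_adjoint (m b) f)"
      unfolding Q_def
    proof (intro conjI allI impI)
      fix c :: "'k \<Rightarrow>\<^sub>C real" assume c: "norm c \<le> 1"
      have "dual_apply (arens_mu m z f) c - dual_apply (dual_adjoint (m b) f) (m c x) = dual_apply f (m c (z - m b x))"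
        by (simp add: arens_mu_apply dual_apply_diff A_diff_right A_commute[of b c])
      also have "\<bar>\<dots>\<bar> \<le> norm f * norm (m c (z - m b x))" by (rule norm_dual_apply)
      also have "\<dots> \<le> norm f * (1 * norm (z - m b x))"
        by (intro mult_left_mono order_trans[OF contractive_norm] mult_right_mono c) auto
      also have "\<dots> \<le> K * norm (z - m b x)" by (simp add: K_def mult_right_mono)
      finally show "\<bar>dual_apply (arens_mu m z f) c - dual_apply (dual_adjoint (m b) f) (m c x)\<bar> \<le> \<epsilon>" using b by simp
    next
      have "dual_apply (T f) z - dual_apply (T (dual_adjoint (m b) f)) x = dual_apply (T f) (z - m b x)"
        by (simp add: center_commute[OF T] dual_apply_diff)
      also have "\<bar>\<dots>\<bar> \<le> norm (T f) * norm (z - m b x)" by (rule norm_dual_apply)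
      also have "\<dots> \<le> K * norm (z - m b x)" by (simp add: K_def mult_right_mono)
      finally show "\<bar>dual_apply (T f) z - dual_apply (T (dual_adjoint (m b) f)) x\<bar> \<le> \<epsilon>" using b by simp
    qed
    then show "\<exists>g. Q (arens_mu m z f) (dual_apply (T f) z) \<epsilon> x g" ..
  qed simp
  then have "arens_ext m \<Phi> = T"
    by (intro blinfun_eqI dual_eqI) (simp add: arens_ext_apply \<Phi>)
  then show ?thesis by blast
qed

lemma center_eq_range_arens_ext: "ideal_center = range (arens_ext m)"
  using arens_ext_in_center center_in_range_arens_ext by blast

end


section \<open>From (2) to (1) for real scalars\<close>

lemma ideals_if_center_in_range_arens_ext:
  fixes m :: "('k::t2_space \<Rightarrow>\<^sub>C real) \<Rightarrow>\<^sub>L ('e::banach_lattice \<Rightarrow>\<^sub>L 'e)"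
  assumes center: "ideal_center \<subseteq> range (arens_ext m)"
  shows "closed_invariant_are_ideals m"
  unfolding closed_invariant_are_ideals_def order_ideal_def
proof (intro allI impI conjI ballI)
  fix F :: "'e set" assume "subspace F \<and> closed F \<and> (\<forall>a. m a ` F \<subseteq> F)"
  then have F: "subspace F" "closed F" "\<And>a x. x \<in> F \<Longrightarrow> m a x \<in> F" by auto
  show "subspace F" by (rule F(1))
  fix x y assume x: "x \<in> F" and yx: "\<bar>y\<bar> \<le> \<bar>x\<bar>"
  show "y \<in> F"
  proof (rule ccontr)
    assume "y \<notin> F"
    then obtain f where f: "\<And>z. z \<in> F \<Longrightarrow> dual_apply f z = 0" "dual_apply f y = 1"
      using Hahn_Banach_separation[OF F(1,2)] by blast
    have "dual_apply (T f) x = 0" if T: "T \<in> unit_center" for T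
    proof -
      obtain \<Phi> where "T = arens_ext m \<Phi>" using T center unit_center_subset by blast
      moreover have "arens_mu m x f = 0" by (rule dual_eqI) (simp add: arens_mu_apply f(1) F(3) x)
      ultimately show ?thesis by (simp add: arens_ext_apply)
    qed
    \<comment> \<open>The coupled system with vanishing imaginary parts.\<close>
    then have "dual_apply \<bar>f\<bar> \<bar>x\<bar> = 0"
      by (intro unit_center_annihilator[of f x 0 0]) (simp add: blinfun.zero_right)
    moreover have "dual_apply \<bar>f\<bar> \<bar>y\<bar> \<le> dual_apply \<bar>f\<bar> \<bar>x\<bar>" by (rule dual_mono[OF _ yx]) simp
    ultimately show False using dual_abs_bound[of f y] f(2) by simp
  qed
qed


section \<open>The weak operator closure\<close>

text \<open>One description for both weak operator topologies, with \<open>i\<close> a pair of a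
  functional and a vector. Induction over \<open>generate_topology_on\<close> shows that every open
  set around \<open>S\<close> contains a finite intersection of preimages of balls.\<close>

lemma closure_of_generated:
  fixes G :: "'i \<Rightarrow> 'x \<Rightarrow> 'b::metric_space"
  shows "S \<in> topology_generated_by {{T. G i T \<in> U} |i U. open U} closure_of A \<longleftrightarrow>
    (\<forall>J e. finite J \<longrightarrow> 0 < e \<longrightarrow> (\<exists>T\<in>A. \<forall>i\<in>J. dist (G i T) (G i S) < e))"
    (is "S \<in> ?X closure_of A \<longleftrightarrow> ?R")
proof
  assume S: "S \<in> ?X closure_of A"
  show ?R
  proof (intro allI impI)
    fix J :: "'i set" and e :: real assume J: "finite J" and e: "0 < e"
    define V where "V i = {T. G i T \<in> ball (G i S) e}" for i
    have "openin ?X (V i)" for i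
      unfolding V_def by (rule topology_generated_by_Basis) (use open_ball in blast)
    then have "openin ?X (\<Inter> (V ` J) \<inter> topspace ?X)" using J by (intro openin_INT)
    moreover have "S \<in> \<Inter> (V ` J) \<inter> topspace ?X"
      using S e by (auto simp: in_closure_of V_def simp del: topology_generated_by_topspace)
    ultimately obtain T where "T \<in> A" "T \<in> \<Inter> (V ` J)" using S unfolding in_closure_of by blast
    then show "\<exists>T\<in>A. \<forall>i\<in>J. dist (G i T) (G i S) < e"
      by (intro bexI[of _ T]) (auto simp: V_def dist_commute)
  qed
next
  assume R: ?R
  have nbhd: "\<exists>J e. finite J \<and> 0 < e \<and> {T. \<forall>i\<in>J. dist (G i T) (G i S) < e} \<subseteq> V"
    if "generate_topology_on {{T. G i T \<in> U} |i U. open U} V" "S \<in> V" for V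
    using that
  proof (induction rule: generate_topology_on.induct)
    case (Int a b)
    then obtain J e J' e' where "finite J" "0 < e" "{T. \<forall>i\<in>J. dist (G i T) (G i S) < e} \<subseteq> a"
      "finite J'" "0 < e'" "{T. \<forall>i\<in>J'. dist (G i T) (G i S) < e'} \<subseteq> b" by blast
    then show ?case by (intro exI[of _ "J \<union> J'"] exI[of _ "min e e'"]) auto
  next
    case (Basis s)
    then obtain i U where s: "s = {T. G i T \<in> U}" "open U" by blast
    then obtain e where "0 < e" "ball (G i S) e \<subseteq> U" using Basis(2) open_contains_ball by blast
    then show ?case
      by (intro exI[of _ "{i}"] exI[of _ e]) (auto simp: s dist_commute subset_iff)
  next
    case (UN K)
    then obtain k where k: "k \<in> K" "S \<in> k" by blast
    then obtain J e where "finite J" "0 < e" "{T. \<forall>i\<in>J. dist (G i T) (G i S) < e} \<subseteq> k"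
      using UN.IH by blast
    then show ?case using k(1) by blast
  qed simp
  have "\<exists>T. T \<in> A \<and> T \<in> V" if V: "S \<in> V" "openin ?X V" for V
  proof -
    obtain J e where "finite J" "0 < e" "{T. \<forall>i\<in>J. dist (G i T) (G i S) < e} \<subseteq> V"
      using nbhd[OF openin_topology_generated_by[OF V(2)] V(1)] by blast
    then show ?thesis using R by blast
  qed
  moreover have "S \<in> topspace ?X" unfolding topology_generated_by_topspace by blast
  ultimately show "S \<in> ?X closure_of A" by (simp only: in_closure_of) blast
qed

lemma wot_closure_iff:
  "S \<in> wot closure_of A \<longleftrightarrow> (\<forall>J e. finite J \<longrightarrow> 0 < e \<longrightarrow>
    (\<exists>T\<in>A. \<forall>(f, x)\<in>J. \<bar>dual_apply f (blinfun_apply T x) - dual_apply f (blinfun_apply S x)\<bar> < e))"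
proof -
  have eq: "{{T. dual_apply f (blinfun_apply T x) \<in> U} |f x U. open U} =
      {{T. (\<lambda>(f, x) T. dual_apply f (blinfun_apply T x)) i T \<in> U} |i U. open U}"
    by auto
  show ?thesis
    unfolding wot_def eq closure_of_generated by (simp add: dist_real_def case_prod_unfold)
qed

lemma dual_span_if_common_kernel:
  fixes S :: "'v::real_normed_vector dual set"
  assumes "finite S" "\<And>v. (\<And>\<phi>. \<phi> \<in> S \<Longrightarrow> dual_apply \<phi> v = 0) \<Longrightarrow> dual_apply \<psi> v = 0"
  shows "\<psi> \<in> span S"
  using assms
proof (induction S arbitrary: \<psi> rule: finite_induct)
  case empty
  then have "\<psi> = 0" by (intro dual_eqI) simp
  then show ?case by simp
next
  case (insert \<phi>0 S)
  show ?case
  proof (cases "\<forall>v. (\<forall>\<phi>\<in>S. dual_apply \<phi> v = 0) \<longrightarrow> dual_apply \<phi>0 v = 0")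
    case True
    then have "\<psi> \<in> span S" by (intro insert.IH insert.prems) auto
    then show ?thesis using span_mono[of S "insert \<phi>0 S"] by blast
  next
    case False
    then obtain b where b: "\<And>\<phi>. \<phi> \<in> S \<Longrightarrow> dual_apply \<phi> b = 0" "dual_apply \<phi>0 b \<noteq> 0" by blast
    define r where "r = dual_apply \<psi> b / dual_apply \<phi>0 b"
    have "\<psi> - r *\<^sub>R \<phi>0 \<in> span S"
    proof (rule insert.IH)
      fix v assume v: "\<And>\<phi>. \<phi> \<in> S \<Longrightarrow> dual_apply \<phi> v = 0"
      define w where "w = v - (dual_apply \<phi>0 v / dual_apply \<phi>0 b) *\<^sub>R b"
      have "dual_apply \<psi> w = 0"
        by (rule insert.prems) (use v b in \<open>auto simp: w_def dual_apply_diff dual_apply_scaleR\<close>)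
      then show "dual_apply (\<psi> - r *\<^sub>R \<phi>0) v = 0"
        by (simp add: w_def r_def dual_apply_diff dual_apply_scaleR)
    qed
    then have "\<psi> - r *\<^sub>R \<phi>0 \<in> span (insert \<phi>0 S)" "r *\<^sub>R \<phi>0 \<in> span (insert \<phi>0 S)"
      using span_mono[of S "insert \<phi>0 S"] by (auto intro: span_scale span_base)
    from span_add[OF this] show ?thesis by simp
  qed
qed

text \<open>Helly's theorem without control of the norm, hence with equality in place of
  approximation. A new functional that depends linearly on the old ones is matched automatically; an
  independent one is corrected along a vector \<open>b\<close> that the old ones kill.\<close>

lemma finite_weak_star_density:
  fixes S :: "'v::real_normed_vector dual set" and \<Phi> :: "'v dual dual"
  assumes "finite S"
  shows "\<exists>a. \<forall>\<psi>\<in>S. dual_apply \<psi> a = dual_apply \<Phi> \<psi>"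
  using assms
proof (induction S rule: finite_induct)
  case (insert \<phi>0 S)
  then obtain a where a: "\<And>\<psi>. \<psi> \<in> S \<Longrightarrow> dual_apply \<psi> a = dual_apply \<Phi> \<psi>" by blast
  show ?case
  proof (cases "\<forall>v. (\<forall>\<phi>\<in>S. dual_apply \<phi> v = 0) \<longrightarrow> dual_apply \<phi>0 v = 0")
    case True
    then have "\<phi>0 \<in> span S" by (intro dual_span_if_common_kernel[OF insert(1)]) auto
    then have "dual_apply \<phi>0 a = dual_apply \<Phi> \<phi>0"
      by (induction rule: span_induct_alt) (auto simp: dual_apply_add dual_apply_scaleR a)
    then show ?thesis using a by auto
  next
    case False
    then obtain b where b: "\<And>\<phi>. \<phi> \<in> S \<Longrightarrow> dual_apply \<phi> b = 0" "dual_apply \<phi>0 b \<noteq> 0" by blast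
    define c where "c = a + ((dual_apply \<Phi> \<phi>0 - dual_apply \<phi>0 a) / dual_apply \<phi>0 b) *\<^sub>R b"
    have "\<forall>\<psi>\<in>insert \<phi>0 S. dual_apply \<psi> c = dual_apply \<Phi> \<psi>"
      using a b by (auto simp: c_def dual_apply_add dual_apply_scaleR)
    then show ?thesis ..
  qed
qed simp

lemma bounded_linear_dual_adjoint: "bounded_linear (dual_adjoint S)"
proof (rule bounded_linear_intro)
  fix f g r
  show "dual_adjoint S (f + g) = dual_adjoint S f + dual_adjoint S g"
    "dual_adjoint S (r *\<^sub>R f) = r *\<^sub>R dual_adjoint S f" by (rule dual_eqI; simp)+
  show "norm (dual_adjoint S f) \<le> norm f * norm S"
  proof (rule norm_dual_bound)
    fix x
    show "\<bar>dual_apply (dual_adjoint S f) x\<bar> \<le> norm f * norm S * norm x"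
      using order_trans[OF norm_dual_apply[of f "S x"] mult_left_mono[OF norm_blinfun]] by (simp add: mult.assoc)
  qed simp
qed

lemma dual_adjoint_in_center:
  assumes "T \<in> ideal_center"
  shows "Blinfun (dual_adjoint T) \<in> ideal_center"
proof -
  obtain M where M: "0 < M" "\<And>x. \<bar>blinfun_apply T x\<bar> \<le> M *\<^sub>R \<bar>x\<bar>" by (rule ideal_centerE[OF assms]) blast
  have "\<bar>dual_adjoint T f\<bar> \<le> M *\<^sub>R f" if f: "0 \<le> f" for f
  proof (rule dual_leI, rule dual_abs_leI)
    fix x y :: 'a assume "\<bar>y\<bar> \<le> x"
    have "dual_apply f (T y) \<le> dual_apply f \<bar>T y\<bar>" by (intro dual_mono f abs_ge_self)
    also have "\<dots> \<le> dual_apply f (M *\<^sub>R \<bar>y\<bar>)" by (intro dual_mono f M)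
    also have "\<dots> \<le> dual_apply f (M *\<^sub>R x)"
      using M(1) \<open>\<bar>y\<bar> \<le> x\<close> by (intro dual_mono f scaleR_left_mono) auto
    finally show "dual_apply (dual_adjoint T f) y \<le> dual_apply (M *\<^sub>R f) x"
      by (simp add: dual_apply_scaleR)
  qed
  then show ?thesis
    using M(1) by (auto simp: ideal_center_def bounded_linear_Blinfun_apply bounded_linear_dual_adjoint)
qed

lemma dual_separates:
  fixes x :: "'v::real_normed_vector"
  assumes "\<And>f. dual_apply f x = 0"
  shows "x = 0"
proof (rule ccontr)
  assume "x \<noteq> 0"
  then obtain f where "dual_apply f x = 1"
    using Hahn_Banach_separation[of "{0}" x] by (auto simp: subspace_def)
  then show False using assms by simp
qed

context ideal_hom
begin

text \<open>The adjoint of \<open>T\<close> is central in the dual, hence equal to some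
  \<open>arens_ext m \<Phi>\<close>, and on finitely many functionals \<open>arens_mu m x f\<close>
  the element \<Phi> agrees with a function \<open>a\<close>.\<close>

lemma center_subset_wot_closure: "ideal_center \<subseteq> wot closure_of range m"
proof
  fix T :: "'e \<Rightarrow>\<^sub>L 'e" assume T: "T \<in> ideal_center"
  obtain \<Phi> where \<Phi>: "Blinfun (dual_adjoint T) = arens_ext m \<Phi>"
    using center_in_range_arens_ext[OF dual_adjoint_in_center[OF T]] by blast
  have T_eq: "dual_apply \<Phi> (arens_mu m x f) = dual_apply f (T x)" for f x
    using arens_ext_apply[of m \<Phi> f x]
    by (simp flip: \<Phi> add: bounded_linear_Blinfun_apply bounded_linear_dual_adjoint)
  show "T \<in> wot closure_of range m"
    unfolding wot_closure_iff
  proof (intro allI impI)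
    fix J :: "('e dual \<times> 'e) set" and e :: real assume J: "finite J" and e: "0 < e"
    obtain a where "\<forall>\<psi>\<in>(\<lambda>(f, x). arens_mu m x f) ` J. dual_apply \<psi> a = dual_apply \<Phi> \<psi>"
      using finite_weak_star_density[of "(\<lambda>(f, x). arens_mu m x f) ` J" \<Phi>] J by blast
    then have a: "dual_apply (arens_mu m x f) a = dual_apply \<Phi> (arens_mu m x f)"
      if "(f, x) \<in> J" for f x
      using that by force
    show "\<exists>S\<in>range m. \<forall>(f, x)\<in>J. \<bar>dual_apply f (S x) - dual_apply f (T x)\<bar> < e"
      using a e by (intro bexI[of _ "m a"]) (auto simp: arens_mu_apply T_eq)
  qed
qed

lemma wot_closure_subset_center: "wot closure_of range m \<subseteq> ideal_center"
proof
  fix S :: "'e \<Rightarrow>\<^sub>L 'e" assume "S \<in> wot closure_of range m"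
  then have S: "\<exists>c. \<forall>(f, x)\<in>J. \<bar>dual_apply f (m c x) - dual_apply f (S x)\<bar> < e"
    if "finite J" "0 < e" for J e
    using that unfolding wot_closure_iff by blast
  have commute: "S (m a x) = m a (S x)" for a x
  proof -
    have "dual_apply f (S (m a x) - m a (S x)) = 0" for f
    proof -
      have "\<bar>dual_apply f (S (m a x) - m a (S x))\<bar> \<le> 0 + e" if e: "0 < e" for e
      proof -
        obtain c where "\<bar>dual_apply f (m c (m a x)) - dual_apply f (S (m a x))\<bar> < e / 2"
          "\<bar>dual_apply (dual_adjoint (m a) f) (m c x) - dual_apply (dual_adjoint (m a) f) (S x)\<bar> < e / 2"
          using S[of "{(f, m a x), (dual_adjoint (m a) f, x)}" "e / 2"] e by auto
        then show ?thesis unfolding dual_adjoint_apply dual_apply_diff A_commute[of a c] by linarith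
      qed
      then have "\<bar>dual_apply f (S (m a x) - m a (S x))\<bar> \<le> 0" by (rule field_le_epsilon)
      then show ?thesis by simp
    qed
    then show ?thesis using dual_separates[of "S (m a x) - m a (S x)"] by simp
  qed
  \<comment> \<open>A closed subspace is weakly closed, by separation.\<close>
  have in_orbit: "S x \<in> orbit x" for x
  proof (rule ccontr)
    assume "S x \<notin> orbit x"
    moreover have "subspace (orbit x)" using order_ideal_orbit by (simp add: order_ideal_def)
    ultimately obtain f where f: "\<And>z. z \<in> orbit x \<Longrightarrow> dual_apply f z = 0" "dual_apply f (S x) = 1"
      using Hahn_Banach_separation[OF _ closed_orbit] by blast
    obtain c where "\<bar>dual_apply f (m c x) - dual_apply f (S x)\<bar> < 1"
      using S[of "{(f, x)}" 1] by auto
    then show False using f A_in_orbit by simp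
  qed
  \<comment> \<open>The excess 1 over \<open>norm S\<close> makes \<open>l * norm (m d x) \<le> norm
    S * norm (m d x) + norm (m b x - y)\<close> an estimate of \<open>norm (m d x)\<close>
    itself.\<close>
  define l where "l = norm S + 1"
  have l: "0 < l" by (simp add: l_def add_nonneg_pos)
  have "\<bar>S x\<bar> \<le> l *\<^sub>R x" if x: "0 \<le> x" for x
  proof -
    define y where "y = S x"
    \<comment> \<open>The excess of \<open>\<bar>S x\<bar>\<close> over
      \<open>l *\<^sub>R x\<close>. It turns out to be disjoint from \<open>x\<close>, yet it lies
      in the orbit of \<open>x\<close>, so it vanishes.\<close>
    define w where "w = sup (\<bar>y\<bar> - l *\<^sub>R x) 0"
    have w: "0 \<le> w" "w \<le> \<bar>y\<bar>" using l x by (auto simp: w_def scaleR_nonneg_nonneg)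
    have small: "norm (inf x w) \<le> e" if e: "0 < e" for e
    proof -
      obtain b where b: "norm (m b x - y) < e / 2"
        by (rule orbit_approx[OF in_orbit[of x], where e = "e / 2"]) (use e in \<open>auto simp: y_def\<close>)
      txt \<open>\<open>d\<close> lives where \<open>\<bar>b\<bar> > l\<close>; there \<open>S\<close> acts almost like \<open>b\<close>, although \<open>\<parallel>S\<parallel> < l\<close>.\<close>
      define c where "c = bcomp (\<lambda>s. max s 0) (bcomp abs b - l *\<^sub>R 1)"
      \<comment> \<open>This is \<open>min 1 c\<close>, written with a positive part so that
        \<open>pos_part\<close> yields \<open>m d x = inf x (m c x)\<close>.\<close>
      define d where "d = 1 - bcomp (\<lambda>s. max s 0) (1 - c)"
      have ab: "bcomp abs b t = \<bar>b t\<bar>" for t by (intro apply_bcomp continuous_intros)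
      have c: "c t = max (\<bar>b t\<bar> - l) 0" for t
        unfolding c_def by (subst apply_bcomp) (auto simp: ab intro!: continuous_intros)
      have d: "d t = min 1 (c t)" for t
        unfolding d_def by (simp add: apply_bcomp continuous_intros)
      have cx: "m c x = sup (\<bar>m b x\<bar> - l *\<^sub>R x) 0"
        using pos_part[OF x, of "bcomp abs b - l *\<^sub>R 1"]
        by (simp add: c_def modulus[OF x] A_diff_left A_one blinfun.scaleR_right blinfun.scaleR_left)
      have dx: "m d x = inf x (m c x)"
      proof -
        have "m d x = x - sup (x - m c x) 0"
          using pos_part[OF x, of "1 - c"] by (simp add: d_def A_diff_left A_one)
        also have "\<dots> = inf x (m c x)"
        proof -
          have "sup (x - m c x) 0 + m c x = sup x (m c x)" by (simp add: add_sup_distrib_right)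
          then have "sup (x - m c x) 0 = sup x (m c x) - m c x" by (simp only: eq_diff_eq)
          moreover have "x + m c x = sup x (m c x) + inf x (m c x)" by (rule add_eq_inf_sup)
          ultimately show ?thesis by (simp only: diff_diff_eq2) (simp only: add_diff_cancel_left')
        qed
        finally show ?thesis .
      qed
      have d0: "0 \<le> d t" "d t \<le> 1" for t by (auto simp: d c)
      have dx0: "0 \<le> m d x" using d0(1) x by (rule nonneg)
      have "l * norm (m d x) \<le> norm (m (d * b) x)"
      proof -
        have ad: "bcomp abs (d * b) t = \<bar>d t * b t\<bar>" for t by (simp add: apply_bcomp continuous_intros)
        have "m (l *\<^sub>R d) x \<le> m (bcomp abs (d * b)) x"
        proof (rule mono[OF _ x])
          fix t
          show "apply_bcontfun (l *\<^sub>R d) t \<le> bcomp abs (d * b) t"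
          proof (cases "d t = 0")
            case False
            then have "l \<le> \<bar>b t\<bar>" using d0(1)[of t] by (auto simp: d c max_def split: if_splits)
            then have "l * d t \<le> \<bar>b t\<bar> * d t" using d0(1)[of t] by (intro mult_right_mono)
            then show ?thesis using d0(1)[of t] by (simp add: ad abs_mult mult.commute)
          qed (simp add: ad)
        qed
        then have "l *\<^sub>R m d x \<le> \<bar>m (d * b) x\<bar>"
          by (simp add: modulus[OF x] blinfun.scaleR_right blinfun.scaleR_left)
        then have "norm (l *\<^sub>R m d x) \<le> norm \<bar>m (d * b) x\<bar>"
          using l dx0 by (intro norm_mono_nonneg scaleR_nonneg_nonneg) auto
        then show ?thesis using l by simp
      qed
      also have "m (d * b) x = S (m d x) + m d (m b x - y)"
        by (simp add: A_mult A_diff_right commute y_def)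
      also have "norm \<dots> \<le> norm S * norm (m d x) + norm (m b x - y)"
      proof (rule norm_triangle_mono[OF norm_blinfun])
        have "norm d \<le> 1" using d0 by (intro norm_bcontfun_le) auto
        then have "norm d * norm (m b x - y) \<le> 1 * norm (m b x - y)" by (intro mult_right_mono) auto
        then show "norm (m d (m b x - y)) \<le> norm (m b x - y)"
          using contractive_norm[of d "m b x - y"] by simp
      qed
      finally have "norm (m d x) \<le> norm (m b x - y)" by (simp add: l_def algebra_simps)
      moreover have "inf x w \<le> m d x + \<bar>m b x - y\<bar>"
      proof -
        have "\<bar>y\<bar> - l *\<^sub>R x \<le> (\<bar>m b x\<bar> - l *\<^sub>R x) + \<bar>m b x - y\<bar>"
          using abs_triangle_ineq2[of y "m b x"] by (simp add: algebra_simps abs_minus_commute)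
        also have "\<dots> \<le> m c x + \<bar>m b x - y\<bar>" unfolding cx by (intro add_right_mono sup_ge1)
        finally have "w \<le> m c x + \<bar>m b x - y\<bar>"
          unfolding w_def by (intro le_supI add_nonneg_nonneg) (auto simp: cx)
        then have "inf x w \<le> inf x (m c x + \<bar>m b x - y\<bar>)" by (rule inf_mono[OF order_refl])
        also have "\<dots> \<le> inf x (m c x) + inf x \<bar>m b x - y\<bar>"
          using x by (intro inf_add_le) (auto simp: cx)
        also have "\<dots> \<le> m d x + \<bar>m b x - y\<bar>" by (intro add_mono inf_le2) (simp add: dx)
        finally show ?thesis .
      qed
      then have "norm (inf x w) \<le> norm (m d x + \<bar>m b x - y\<bar>)"
        using x w by (intro norm_mono_nonneg) auto
      then have "norm (inf x w) \<le> norm (m d x) + norm (m b x - y)"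
        using norm_triangle_ineq[of "m d x" "\<bar>m b x - y\<bar>"] by simp
      ultimately show ?thesis using b by simp
    qed
    then have "norm (inf x w) \<le> 0" using field_le_epsilon[of "norm (inf x w)" 0] by simp
    then have xw: "inf w x = 0" by (simp add: inf.commute)
    have "w \<in> orbit x"
      by (rule order_idealD[OF order_ideal_orbit in_orbit[of x, folded y_def]]) (use w in \<open>simp add: abs_of_nonneg\<close>)
    \<comment> \<open>Up to \<open>e\<close>, the vector \<open>w\<close> is dominated by a multiple
      of \<open>x\<close>, from which it is disjoint.\<close>
    have "norm w \<le> 0 + e" if e: "0 < e" for e
    proof -
      obtain b where b: "norm (m b x - w) < e" by (rule orbit_approx[OF \<open>w \<in> orbit x\<close> e])
      have "w \<le> (norm b + 1) *\<^sub>R x + \<bar>m b x - w\<bar>"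
      proof -
        have "w \<le> \<bar>m b x\<bar> + \<bar>m b x - w\<bar>"
          using abs_triangle_ineq2[of w "m b x"] w(1) by (simp add: abs_of_nonneg abs_minus_commute algebra_simps)
        moreover have "\<bar>m b x\<bar> \<le> (norm b + 1) *\<^sub>R x"
          using contractive[of b x] x scaleR_right_mono[of "norm b" "norm b + 1" x]
          by (simp add: abs_of_nonneg)
        ultimately show ?thesis by (meson add_right_mono order_trans)
      qed
      then have "w \<le> inf w ((norm b + 1) *\<^sub>R x + \<bar>m b x - w\<bar>)" by simp
      also have "\<dots> \<le> inf w ((norm b + 1) *\<^sub>R x) + inf w \<bar>m b x - w\<bar>"
        using w x by (intro inf_add_le scaleR_nonneg_nonneg) auto
      also have "\<dots> \<le> 0 + \<bar>m b x - w\<bar>"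
        using w by (intro add_mono inf_scaleR_disjoint inf_le2 xw) auto
      finally have "norm w \<le> norm (m b x - w)"
        using norm_mono_nonneg[OF w(1), of "\<bar>m b x - w\<bar>"] by simp
      then show ?thesis using b by simp
    qed
    then have "norm w \<le> 0" by (rule field_le_epsilon)
    then have "w = 0" by simp
    then have "\<bar>y\<bar> - l *\<^sub>R x \<le> 0" unfolding w_def by (metis sup_ge1)
    then show ?thesis by (simp add: y_def)
  qed
  then show "S \<in> ideal_center" using l unfolding ideal_center_def by blast
qed

lemma center_eq_wot_closure: "ideal_center = wot closure_of range m"
  using center_subset_wot_closure wot_closure_subset_center by blast

end


section \<open>Complexifications\<close>

lemma cabs_real: "cabs (Cx x 0) = \<bar>x\<bar>"
  using cabs_le_parts[of "Cx x 0"] abs_parts_le_cabs(1)[of "Cx x 0"] by (auto intro: order.antisym)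

lemma norm_Cx_real: "norm (Cx x 0) = norm x"
  by (simp add: norm_complexified_def cabs_real)

lemma cabs_minus: "cabs (- z) = cabs z"
proof -
  have "- z = (- 1) *\<^sub>C z" by (rule complexified.expand) simp
  then show ?thesis by (simp add: cabs_scaleC del: scaleC_parts)
qed

lemma Cx_decompose: "z = Cx (rpart z) 0 + \<i> *\<^sub>C Cx (ipart z) 0"
  by (rule complexified.expand) simp

lemma Cx_real_simps: "Cx (x + y) 0 = Cx x 0 + Cx y 0" "Cx (r *\<^sub>R x) 0 = r *\<^sub>R Cx x 0"
  "Cx (x - y) 0 = Cx x 0 - Cx y 0" "Cx 0 0 = 0"
  by (rule complexified.expand; simp)+

lemma bounded_linear_rpart: "bounded_linear (rpart :: 'a::banach_lattice complexified \<Rightarrow> 'a)"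
  and bounded_linear_ipart: "bounded_linear (ipart :: 'a::banach_lattice complexified \<Rightarrow> 'a)"
  by (rule bounded_linear_intro[where K = 1]; simp add: norm_parts_le)+

lemma cblinfun_apply_zero_right [simp]: "cblinfun_apply f 0 = 0"
  using cblinfun_apply_right(2)[of f 0 0] by simp

lemma cblinfun_compose_apply: "cblinfun_apply (f o\<^sub>C\<^sub>L g) x = f (g x)"
  by transfer simp

lemma id_cblinfun_apply: "cblinfun_apply id_cblinfun x = x"
  by transfer simp

lemma cblinfun_apply_decompose:
  "cblinfun_apply f z = f (Cx (rpart z) 0) + \<i> *\<^sub>C f (Cx (ipart z) 0)"
  by (subst Cx_decompose[of z]) (simp only: cblinfun_apply_right)

lemma cblinfun_eqI_real:
  assumes "\<And>x. cblinfun_apply f (Cx x 0) = cblinfun_apply g (Cx x 0)"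
  shows "f = g"
  using assms by (intro cblinfun_eqI) (metis cblinfun_apply_decompose)

definition re_op :: "('e::banach_lattice complexified \<Rightarrow>\<^sub>C\<^sub>L 'e complexified) \<Rightarrow> 'e \<Rightarrow>\<^sub>L 'e"
  where "re_op T = Blinfun (\<lambda>x. rpart (T (Cx x 0)))"

definition im_op :: "('e::banach_lattice complexified \<Rightarrow>\<^sub>C\<^sub>L 'e complexified) \<Rightarrow> 'e \<Rightarrow>\<^sub>L 'e"
  where "im_op T = Blinfun (\<lambda>x. ipart (T (Cx x 0)))"

lemma re_op_apply: "blinfun_apply (re_op T) x = rpart (T (Cx x 0))"
  and im_op_apply: "blinfun_apply (im_op T) x = ipart (T (Cx x 0))"
proof -
  have "bounded_linear (\<lambda>x. cblinfun_apply T (Cx x 0))"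
    by (rule bounded_linear_compose[OF bounded_linear_cblinfun_apply bounded_linear_Cx])
  from bounded_linear_compose[OF bounded_linear_rpart this] bounded_linear_compose[OF bounded_linear_ipart this]
  show "blinfun_apply (re_op T) x = rpart (T (Cx x 0))" "blinfun_apply (im_op T) x = ipart (T (Cx x 0))"
    by (simp_all add: re_op_def im_op_def bounded_linear_Blinfun_apply)
qed

lemma norm_re_op: "norm (re_op T) \<le> norm T"
proof (rule norm_blinfun_bound)
  fix x
  show "norm (re_op T x) \<le> norm T * norm x"
    using order_trans[OF norm_parts_le(1) norm_cblinfun_apply[of T "Cx x 0"]]
    by (simp add: re_op_apply norm_Cx_real)
qed simp

lemma center_parts:
  assumes "T \<in> cideal_center"
  shows "re_op T \<in> ideal_center" "im_op T \<in> ideal_center"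
proof -
  obtain M where M: "0 < M" "\<And>x. 0 \<le> x \<Longrightarrow> cabs (cblinfun_apply T (Cx x 0)) \<le> M *\<^sub>R x"
    using assms unfolding cideal_center_def by blast
  have "\<bar>re_op T x\<bar> \<le> M *\<^sub>R x" "\<bar>im_op T x\<bar> \<le> M *\<^sub>R x" if "0 \<le> x" for x
    unfolding re_op_apply im_op_apply using abs_parts_le_cabs M(2)[OF that] order_trans by blast+
  then show "re_op T \<in> ideal_center" "im_op T \<in> ideal_center"
    using M(1) unfolding ideal_center_def by blast+
qed

lemma center_of_parts:
  assumes "re_op T \<in> ideal_center" "im_op T \<in> ideal_center"
  shows "T \<in> cideal_center"
proof -
  obtain M1 where M1: "0 < M1" "\<And>x. \<bar>blinfun_apply (re_op T) x\<bar> \<le> M1 *\<^sub>R \<bar>x\<bar>"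
    by (rule ideal_centerE[OF assms(1)]) blast
  obtain M2 where M2: "0 < M2" "\<And>x. \<bar>blinfun_apply (im_op T) x\<bar> \<le> M2 *\<^sub>R \<bar>x\<bar>"
    by (rule ideal_centerE[OF assms(2)]) blast
  have "cabs (T (Cx x 0)) \<le> (M1 + M2) *\<^sub>R x" if "0 \<le> x" for x
    using order_trans[OF cabs_le_parts add_mono[OF M1(2)[of x, unfolded re_op_apply] M2(2)[of x, unfolded im_op_apply]]] that
    by (simp add: scaleR_add_left abs_of_nonneg)
  moreover have "0 < M1 + M2" using M1(1) M2(1) by simp
  ultimately show ?thesis unfolding cideal_center_def by blast
qed

definition dual_complexify :: "'e::banach_lattice dual \<Rightarrow> ('e complexified \<Rightarrow>\<^sub>C\<^sub>L complex)"
  where "dual_complexify u =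
    CBlinfun (\<lambda>z. of_real (dual_apply u (rpart z)) + \<i> * of_real (dual_apply u (ipart z)))"

lemma dual_complexify_apply:
  "cblinfun_apply (dual_complexify u) z = of_real (dual_apply u (rpart z)) + \<i> * of_real (dual_apply u (ipart z))"
proof -
  have "bounded_linear (\<lambda>z. of_real (dual_apply u (rpart z)) + \<i> * of_real (dual_apply u (ipart z)))"
    by (intro bounded_linear_add bounded_linear_const_mult
      bounded_linear_compose[OF bounded_linear_of_real]
      bounded_linear_compose[OF bounded_linear_dual_apply] bounded_linear_rpart bounded_linear_ipart)
  then show ?thesis
    unfolding dual_complexify_def
    by (subst cblinfun_apply_CBlinfun)
       (auto simp: complex_eq_iff dual_apply_diff dual_apply_add dual_apply_scaleR scaleC_complex_def)
qed

lemma norm_dual_complexify: "norm (dual_complexify u) \<le> norm u * 2"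
proof (rule norm_cblinfun_bound)
  fix z :: "'a complexified"
  have "norm (dual_complexify u z) \<le> \<bar>dual_apply u (rpart z)\<bar> + \<bar>dual_apply u (ipart z)\<bar>"
    using cmod_le[of "dual_complexify u z"] by (simp add: dual_complexify_apply)
  also have "\<dots> \<le> norm u * norm z + norm u * norm z"
    by (intro add_mono order_trans[OF norm_dual_apply] mult_left_mono norm_parts_le norm_ge_zero)
  finally show "norm (dual_complexify u z) \<le> norm u * 2 * norm z" by simp
qed simp

lemma bounded_linear_dual_complexify: "bounded_linear dual_complexify"
proof (rule bounded_linear_intro)
  show "dual_complexify (u + v) = dual_complexify u + dual_complexify v"
    "dual_complexify (r *\<^sub>R u) = r *\<^sub>R dual_complexify u" for u v :: "'a dual" and r
    by (rule cblinfun_eqI; simp add: dual_complexify_apply algebra_simps scaleR_conv_of_real)+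
qed (rule norm_dual_complexify)

lemma dual_parts_dual_complexify: "dual_parts (dual_complexify u) = Cx u 0"
  by (rule complexified.expand, intro conjI; rule dual_eqI)
     (simp_all add: dual_parts_apply dual_complexify_apply)

lemma dual_parts_simps:
  "dual_parts (f + g) = dual_parts f + dual_parts g"
  "dual_parts (r *\<^sub>R f) = r *\<^sub>R dual_parts f"
  "dual_parts (c *\<^sub>C f) = c *\<^sub>C dual_parts f"
  by (rule complexified.expand, intro conjI; rule dual_eqI;
    simp add: dual_parts_apply scaleC_complex_def)+

lemma dual_apply_dual_parts:
  "cblinfun_apply f (Cx x 0) =
    of_real (dual_apply (rpart (dual_parts f)) x) + \<i> * of_real (dual_apply (ipart (dual_parts f)) x)"
  by (simp add: dual_parts_apply complex_eq_iff)

lemma dual_parts_apply_complex: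
  "cblinfun_apply f z =
    of_real (dual_apply (rpart (dual_parts f)) (rpart z) - dual_apply (ipart (dual_parts f)) (ipart z)) +
    \<i> * of_real (dual_apply (rpart (dual_parts f)) (ipart z) + dual_apply (ipart (dual_parts f)) (rpart z))"
  by (subst cblinfun_apply_decompose) (simp add: dual_apply_dual_parts scaleC_complex_def complex_eq_iff)

lemma dual_decompose:
  "f = dual_complexify (rpart (dual_parts f)) + \<i> *\<^sub>C dual_complexify (ipart (dual_parts f))"
  by (rule cblinfun_eqI_real)
     (simp add: dual_apply_dual_parts[of f] dual_complexify_apply scaleC_complex_def)

lemma norm_dual_parts_le: "norm (rpart (dual_parts f)) \<le> norm f" "norm (ipart (dual_parts f)) \<le> norm f"
proof -
  have "cmod (f (Cx x 0)) \<le> norm f * norm x" for x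
    using norm_cblinfun_apply[of f "Cx x 0"] by (simp add: norm_Cx_real)
  from order_trans[OF abs_Re_le_cmod this] order_trans[OF abs_Im_le_cmod this]
  show "norm (rpart (dual_parts f)) \<le> norm f" "norm (ipart (dual_parts f)) \<le> norm f"
    by (auto intro!: norm_dual_bound simp: dual_parts_apply)
qed

lemma bounded_linear_dual_parts:
  "bounded_linear (\<lambda>f. rpart (dual_parts f))" "bounded_linear (\<lambda>f. ipart (dual_parts f))"
  by (rule bounded_linear_intro[where K = 1]; simp add: dual_parts_simps norm_dual_parts_le)+

text \<open>Rotating \<open>z\<close> by a scalar of modulus one makes the value real and
  nonnegative, so that it is \<open>g\<close> at the real part of a rotate, which
  \<open>cabs z\<close> dominates.\<close>

lemma cmod_dual_complexify_le:
  assumes g: "0 \<le> g"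
  shows "cmod (cblinfun_apply (dual_complexify g) z) \<le> dual_apply g (cabs z)"
proof (cases "dual_complexify g z = 0")
  case True
  then show ?thesis using dual_nonneg[OF g cabs_nonneg] by simp
next
  case False
  define w where "w = dual_complexify g z"
  define c where "c = cnj w / cmod w"
  have w: "w \<noteq> 0" using False by (simp add: w_def)
  then have c: "cmod c = 1" by (simp add: c_def norm_divide)
  have "c * w = cmod w"
    using w complex_norm_square[of w] by (simp add: c_def field_simps power2_eq_square)
  then have "cmod w = Re (c * w)" by simp
  also have "\<dots> = dual_apply g (rpart (c *\<^sub>C z))"
    by (simp add: w_def dual_complexify_apply dual_apply_diff dual_apply_scaleR)
  also have "\<dots> \<le> dual_apply g (cabs z)" by (intro dual_mono g cabs_upper c)
  finally show ?thesis by (simp add: w_def)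
qed

lemma cwot_closure_iff:
  fixes S :: "'v::complex_normed_vector \<Rightarrow>\<^sub>C\<^sub>L 'v"
  shows "S \<in> cwot closure_of A \<longleftrightarrow> (\<forall>J e. finite J \<longrightarrow> 0 < e \<longrightarrow>
    (\<exists>T\<in>A. \<forall>(f, x)\<in>J. cmod (cblinfun_apply f (cblinfun_apply T x) - cblinfun_apply f (cblinfun_apply S x)) < e))"
proof -
  have eq: "{{T :: 'v \<Rightarrow>\<^sub>C\<^sub>L 'v. cblinfun_apply f (cblinfun_apply T x) \<in> U} |(f :: 'v \<Rightarrow>\<^sub>C\<^sub>L complex) x U. open U} =
      {{T. (\<lambda>(f, x) T. cblinfun_apply f (cblinfun_apply T x)) i T \<in> U} |(i :: ('v \<Rightarrow>\<^sub>C\<^sub>L complex) \<times> 'v) U. open U}"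
    by auto
  show ?thesis
    unfolding cwot_def eq closure_of_generated by (simp add: dist_norm case_prod_unfold)
qed


section \<open>Complex scalars: reduction to the real case\<close>

lemma cunital_hom_action:
  assumes "cunital_hom m"
  shows "bcontfun_action (\<lambda>a. cblinfun_apply (cblinfun_apply m a)) (norm m)"
proof
  fix a b u v
  show "norm (m a v) \<le> norm m * norm a * norm v"
    by (intro order_trans[OF norm_cblinfun_apply] mult_right_mono norm_cblinfun_apply norm_ge_zero)
qed (use assms in \<open>simp_all add: cunital_hom_def cblinfun_apply_right cblinfun_compose_apply id_cblinfun_apply\<close>)

lemma bcontfun_complex_decompose:
  "a = bembed (bcomp Re a) + \<i> *\<^sub>C bembed (bcomp Im a)"
  by (rule bcontfun_eqI) (simp add: apply_bcomp continuous_intros scaleC_complex_def complex_eq_iff)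

locale cideal_hom =
  fixes m :: "('k::t2_space \<Rightarrow>\<^sub>C complex) \<Rightarrow>\<^sub>C\<^sub>L ('e::banach_lattice complexified \<Rightarrow>\<^sub>C\<^sub>L 'e complexified)"
  assumes hom: "cunital_hom m" and ideals: "cclosed_invariant_are_ideals m"
begin

sublocale bcontfun_action "\<lambda>a. cblinfun_apply (cblinfun_apply m a)" "norm m"
  by (rule cunital_hom_action[OF hom])

lemma m_const: "m (const_bcontfun c) z = c *\<^sub>C z"
proof -
  have "const_bcontfun c = c *\<^sub>C (1 :: 'k \<Rightarrow>\<^sub>C complex)" by (rule bcontfun_eqI) (simp add: scaleC_complex_def)
  then show ?thesis using A_one[of z] by (simp add: cblinfun_apply_right del: scaleC_parts)
qed

lemma corder_ideal_orbit: "corder_ideal (orbit z)"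
proof -
  have "c *\<^sub>C u \<in> orbit z" if "u \<in> orbit z" for c u
    using orbit_invariant[OF that, of "const_bcontfun c"] by (simp only: m_const)
  moreover have "0 \<in> orbit z" using A_in_orbit[of 0 z] by simp
  ultimately have "csubspace (orbit z)" by (simp add: csubspace_def orbit_add)
  then show ?thesis
    using ideals closed_orbit orbit_invariant unfolding cclosed_invariant_are_ideals_def by blast
qed

sublocale modulus_action "\<lambda>a. cblinfun_apply (cblinfun_apply m a)" "norm m" cabs
proof
  fix a b :: "'k \<Rightarrow>\<^sub>C complex" and u :: "'e complexified" and c :: complex
  show "cabs (u + v) \<le> cabs u + cabs v" for u v :: "'e complexified" by (rule cabs_triangle)
  show "norm (cabs u) = norm u" "0 \<le> cabs u" for u :: "'e complexified"
    by (simp_all add: norm_complexified_def)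
  show "cabs (m (const_bcontfun c) u) = norm c *\<^sub>R cabs u" by (simp only: m_const cabs_scaleC)
  assume ab: "a * b = 0"
  \<comment> \<open>The infimum of the two moduli enters as the real element \<open>Cx w 0\<close>;
    being ideals, both orbits contain it, so it is zero.\<close>
  define w where "w = inf (cabs (m a u)) (cabs (m b u))"
  have w: "cabs (Cx w 0) = w" by (simp add: cabs_real w_def abs_of_nonneg)
  have "Cx w 0 \<in> orbit (m a u)" "Cx w 0 \<in> orbit (m b u)"
    using corder_ideal_orbit orbit_self w unfolding corder_ideal_def by (metis inf_le1 inf_le2 w_def)+
  then have "Cx w 0 = 0" by (rule orbit_disjoint[OF ab])
  then have "w = 0" by (metis complexified.sel(1) complexified_parts(1))
  then show "cabs (m a u) + cabs (m b u) \<le> cabs (m a u + m b u)"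
    using cabs_triangle[of "m a u + m b u" "- m b u"] cabs_triangle[of "m a u + m b u" "- m a u"]
    by (intro disjoint_add_le) (auto simp: w_def cabs_minus)
qed

lemma contractive: "cabs (m a z) \<le> norm a *\<^sub>R cabs z"
proof (rule N_contractive[where ?h1.0 = "bcomp Re a" and ?h2.0 = "bcomp Im a"])
  fix s t
  show "norm (a s - a t) \<le> \<bar>bcomp Re a s - bcomp Re a t\<bar> + \<bar>bcomp Im a s - bcomp Im a t\<bar>"
    using cmod_le[of "a s - a t"] by (simp add: apply_bcomp continuous_intros)
qed

lemma norm_contractive: "norm (m a) \<le> norm a"
proof (rule norm_cblinfun_bound)
  fix z
  show "norm (m a z) \<le> norm a * norm z"
    using norm_mono_nonneg[OF cabs_nonneg contractive[of a z]] by (simp add: norm_complexified_def)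
qed simp

text \<open>Applied to \<open>a - i \<tau>\<close>, contractivity bounds \<open>\<tau> x - Im (a x)\<close> by \<open>\<surd>(\<parallel>a\<parallel>\<^sup>2 + \<tau>\<^sup>2) x\<close>; let
  \<open>\<tau>\<close> tend to infinity.\<close>

lemma ipart_nonneg:
  fixes a :: "'k \<Rightarrow>\<^sub>C real"
  assumes x: "0 \<le> x"
  shows "0 \<le> ipart (m (bembed a) (Cx x 0))"
proof -
  define q where "q = ipart (m (bembed a) (Cx x 0))"
  define \<alpha> where "\<alpha> = norm a"
  have le: "- q \<le> (\<alpha>\<^sup>2 / (2 * \<tau>)) *\<^sub>R x" if \<tau>: "0 < \<tau>" for \<tau> :: real
  proof -
    define c where "c = bembed a - const_bcontfun (\<i> * of_real \<tau>)"
    \<comment> \<open>The tangent bound for the square root; its excess over \<tau> vanishes as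
      \<tau> grows.\<close>
    have "norm c \<le> \<tau> + \<alpha>\<^sup>2 / (2 * \<tau>)"
    proof (rule norm_bcontfun_le)
      fix t
      have "(cmod (c t))\<^sup>2 = (a t)\<^sup>2 + \<tau>\<^sup>2" by (simp add: c_def cmod_power2)
      also have "\<dots> \<le> \<alpha>\<^sup>2 + \<tau>\<^sup>2"
        using norm_bounded[of a t] by (simp add: \<alpha>_def abs_le_square_iff[symmetric])
      also have "\<dots> \<le> (\<tau> + \<alpha>\<^sup>2 / (2 * \<tau>))\<^sup>2"
      proof -
        define \<beta> where "\<beta> = \<alpha>\<^sup>2 / (2 * \<tau>)"
        have "\<alpha>\<^sup>2 = 2 * \<tau> * \<beta>" using \<tau> by (simp add: \<beta>_def)
        then show ?thesis by (simp add: power2_sum flip: \<beta>_def)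
      qed
      finally show "cmod (c t) \<le> \<tau> + \<alpha>\<^sup>2 / (2 * \<tau>)"
        by (rule power2_le_imp_le) (use \<tau> in simp)
    qed
    have "m c (Cx x 0) = m (bembed a) (Cx x 0) - (\<i> * of_real \<tau>) *\<^sub>C Cx x 0"
      by (simp only: c_def A_diff_left m_const)
    then have "\<tau> *\<^sub>R x - q = - ipart (m c (Cx x 0))" by (simp add: q_def)
    also have "\<dots> \<le> cabs (m c (Cx x 0))"
      using abs_parts_le_cabs(2) abs_ge_minus_self order_trans by blast
    also have "\<dots> \<le> norm c *\<^sub>R x" using contractive[of c "Cx x 0"] x by (simp add: cabs_real abs_of_nonneg)
    also have "\<dots> \<le> (\<tau> + \<alpha>\<^sup>2 / (2 * \<tau>)) *\<^sub>R x" using x \<open>norm c \<le> _\<close> by (intro scaleR_right_mono)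
    finally show ?thesis by (simp add: scaleR_add_left)
  qed
  have "(\<lambda>n. (\<alpha>\<^sup>2 / 2 * inverse (real (Suc n))) *\<^sub>R x) \<longlonglongrightarrow> (\<alpha>\<^sup>2 / 2 * 0) *\<^sub>R x"
    by (intro tendsto_intros LIMSEQ_inverse_real_of_nat)
  then have "- q \<le> (\<alpha>\<^sup>2 / 2 * 0) *\<^sub>R x"
  proof (rule lattice_LIMSEQ_le[OF tendsto_const])
    fix n
    show "- q \<le> (\<alpha>\<^sup>2 / 2 * inverse (real (Suc n))) *\<^sub>R x"
      using le[of "real (Suc n)"] by (simp add: field_simps)
  qed
  then show ?thesis by (simp add: q_def)
qed

lemma ipart_zero: "ipart (m (bembed a) (Cx x 0)) = 0"
proof -
  have pos: "ipart (m (bembed a) (Cx x 0)) = 0" if "0 \<le> x" for x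
  proof (rule order.antisym)
    have "bembed (- a) = (- bembed a :: 'k \<Rightarrow>\<^sub>C complex)" by (rule bcontfun_eqI) simp
    then show "ipart (m (bembed a) (Cx x 0)) \<le> 0" using ipart_nonneg[OF that, of "- a"] by (simp add: A_minus_left)
  qed (rule ipart_nonneg[OF that])
  have "Cx x 0 = Cx (sup x 0) 0 - Cx (sup (- x) 0) 0"
    using pos_neg_parts(1)[of x] by (metis Cx_real_simps(3))
  then show ?thesis using pos[of "sup x 0"] pos[of "sup (- x) 0"] by (simp add: A_diff_right)
qed

text \<open>The restriction of \<open>m\<close> to real functions and real vectors; by
  \<open>ipart_zero\<close>, taking the real part loses nothing.\<close>

definition real_hom :: "('k \<Rightarrow>\<^sub>C real) \<Rightarrow>\<^sub>L ('e \<Rightarrow>\<^sub>L 'e)"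
  where "real_hom = Blinfun (\<lambda>a. re_op (m (bembed a)))"

lemma real_hom_apply: "real_hom a x = rpart (m (bembed a) (Cx x 0))"
proof -
  have "bounded_linear (\<lambda>a. re_op (m (bembed a)))"
  proof (rule bounded_linear_intro)
    fix a b r
    show "re_op (m (bembed (a + b))) = re_op (m (bembed a)) + re_op (m (bembed b))"
      by (rule blinfun_eqI) (simp add: re_op_apply bembed_simps A_add_left blinfun.add_left)
    show "re_op (m (bembed (r *\<^sub>R a))) = r *\<^sub>R re_op (m (bembed a))"
      by (rule blinfun_eqI) (simp add: re_op_apply bembed_scaleR cblinfun_apply_right blinfun.scaleR_left)
    show "norm (re_op (m (bembed a))) \<le> norm a * 1"
      using order_trans[OF norm_re_op norm_contractive[of "bembed a"]] by (simp add: norm_bembed)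
  qed
  then show ?thesis by (simp add: real_hom_def bounded_linear_Blinfun_apply re_op_apply)
qed

lemma m_bembed: "m (bembed a) (Cx x 0) = Cx (real_hom a x) 0"
  by (rule complexified.expand) (simp add: real_hom_apply ipart_zero)

lemma m_real: "m a (Cx x 0) = Cx (real_hom (bcomp Re a) x) (real_hom (bcomp Im a) x)"
proof -
  have "m a (Cx x 0) = m (bembed (bcomp Re a)) (Cx x 0) + \<i> *\<^sub>C m (bembed (bcomp Im a)) (Cx x 0)"
    by (subst bcontfun_complex_decompose[of a]) (simp only: cblinfun_apply_simps cblinfun_apply_right scaleC_cblinfun_apply)
  then show ?thesis unfolding m_bembed by (intro complexified.expand) simp
qed

text \<open>If \<open>F\<close> is closed and invariant under real functions, then so is
  \<open>F + i F\<close> under complex ones, because \<open>m\<close> acts through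
  \<open>real_hom\<close>. The latter is an ideal by hypothesis, and its real elements are those of
  \<open>F\<close>.\<close>

lemma ideal_hom_real_hom: "ideal_hom real_hom"
proof
  show "unital_hom real_hom"
    unfolding unital_hom_def
  proof (intro conjI allI; rule blinfun_eqI)
    show "real_hom 1 x = id_blinfun x" for x by (simp add: real_hom_apply bembed_simps A_one)
    show "real_hom (a * b) x = (real_hom a o\<^sub>L real_hom b) x" for a b x
      by (simp add: real_hom_apply[of "a * b"] bembed_simps A_mult m_bembed)
  qed
  show "closed_invariant_are_ideals real_hom"
    unfolding closed_invariant_are_ideals_def order_ideal_def
  proof (intro allI impI conjI ballI)
    fix F :: "'e set" assume "subspace F \<and> closed F \<and> (\<forall>a. real_hom a ` F \<subseteq> F)"
    then have F: "subspace F" "closed F" "\<And>a x. x \<in> F \<Longrightarrow> real_hom a x \<in> F" by auto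
    show "subspace F" by (rule F(1))
    define FC where "FC = {z. rpart z \<in> F \<and> ipart z \<in> F}"
    have "csubspace FC"
      using F(1) by (auto simp: csubspace_def FC_def subspace_0 subspace_add subspace_diff subspace_scale)
    moreover have "FC = rpart -` F \<inter> ipart -` F" by (auto simp: FC_def)
    then have "closed FC"
      using F(2) by (auto intro!: closed_Int continuous_closed_vimage
        linear_continuous_at[OF bounded_linear_rpart] linear_continuous_at[OF bounded_linear_ipart])
    moreover have "m a z \<in> FC" if "z \<in> FC" for a z
      using that F
      by (subst Cx_decompose[of z])
         (auto simp: FC_def A_add_right cblinfun_apply_right m_real subspace_add subspace_diff)
    ultimately have "corder_ideal FC" using ideals unfolding cclosed_invariant_are_ideals_def by blast
    then have "Cx y 0 \<in> FC" if "Cx x 0 \<in> FC" "\<bar>y\<bar> \<le> \<bar>x\<bar>" for x y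
      using that unfolding corder_ideal_def by (metis cabs_real)
    then show "y \<in> F" if "x \<in> F" "\<bar>y\<bar> \<le> \<bar>x\<bar>" for x y
      using that subspace_0[OF F(1)] by (auto simp: FC_def)
  qed
qed

sublocale real: ideal_hom real_hom
  by (rule ideal_hom_real_hom)

lemma positive:
  assumes a: "\<And>t. apply_bcontfun a t \<in> \<real>\<^sub>\<ge>\<^sub>0" and x: "0 \<le> x"
  shows "\<exists>y\<ge>0. m a (Cx x 0) = Cx y 0"
proof -
  have "0 \<le> bcomp Re a t" "bcomp Im a t = 0" for t
    using a[of t] by (auto simp: apply_bcomp continuous_intros complex_nonneg_Reals_iff)
  moreover from this have "bcomp Im a = 0" by (intro bcontfun_eqI) simp
  ultimately show ?thesis
    using real.nonneg[of "bcomp Re a" x] x by (auto simp: m_real)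
qed

lemma carens_ext_in_center: "carens_ext m \<Phi> \<in> cideal_center_dual"
proof -
  have "cabs (dual_parts (carens_ext m \<Phi> f)) \<le> (norm \<Phi> + 1) *\<^sub>R g" if g: "0 \<le> g" "dual_parts f = Cx g 0" for f g
  proof (rule cabs_least, rule dual_leI)
    fix c and x :: 'e assume c: "cmod c = 1" and x: "0 \<le> x"
    have f: "f = dual_complexify g"
      using dual_decompose[of f]
      by (simp add: g linear_0[OF bounded_linear.linear[OF bounded_linear_dual_complexify]])
    have "norm (carens_mu m (Cx x 0) f) \<le> dual_apply g x"
    proof (rule norm_cblinfun_bound)
      fix a
      have "cmod (f (m a (Cx x 0))) \<le> dual_apply g (cabs (m a (Cx x 0)))"
        unfolding f by (rule cmod_dual_complexify_le[OF g(1)])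
      also have "\<dots> \<le> dual_apply g (norm a *\<^sub>R x)"
        using contractive[of a "Cx x 0"] x by (intro dual_mono g) (simp add: cabs_real abs_of_nonneg)
      finally show "norm (carens_mu m (Cx x 0) f a) \<le> dual_apply g x * norm a"
        by (simp add: carens_mu_apply dual_apply_scaleR mult.commute)
    qed (rule dual_nonneg[OF g(1) x])
    then have "norm \<Phi> * norm (carens_mu m (Cx x 0) f) \<le> (norm \<Phi> + 1) * dual_apply g x"
      using dual_nonneg[OF g(1) x] by (intro mult_mono) auto
    then have "cmod (carens_ext m \<Phi> f (Cx x 0)) \<le> (norm \<Phi> + 1) * dual_apply g x"
      using norm_cblinfun_apply[of \<Phi> "carens_mu m (Cx x 0) f"] by (simp add: carens_ext_apply)
    moreover have "dual_apply (rpart (c *\<^sub>C dual_parts (carens_ext m \<Phi> f))) x = Re (c * carens_ext m \<Phi> f (Cx x 0))"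
      by (simp add: dual_parts_apply)
    moreover have "Re (c * carens_ext m \<Phi> f (Cx x 0)) \<le> cmod (carens_ext m \<Phi> f (Cx x 0))"
      using complex_Re_le_cmod[of "c * carens_ext m \<Phi> f (Cx x 0)"] c by (simp add: norm_mult)
    ultimately show "dual_apply (rpart (c *\<^sub>C dual_parts (carens_ext m \<Phi> f))) x \<le> dual_apply ((norm \<Phi> + 1) *\<^sub>R g) x"
      by simp
  qed
  moreover have "0 < norm \<Phi> + 1" by (simp add: add_nonneg_pos)
  ultimately show ?thesis unfolding cideal_center_dual_def by blast
qed

text \<open>On real functionals \<open>T\<close> has a real and an imaginary part, both central, so
  the real case yields \<open>\<Phi>1\<close> and \<open>\<Phi>2\<close>. Here \<phi> is the value
  of \<open>\<Phi>1 + i \<Phi>2\<close> at \<open>\<psi>1 + i \<psi>2\<close>, the decomposition of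
  \<psi> over real functions.\<close>

lemma center_in_range_carens_ext:
  assumes T: "T \<in> cideal_center_dual"
  shows "T \<in> range (carens_ext m)"
proof -
  obtain M where M: "0 < M" "\<And>f g. 0 \<le> g \<Longrightarrow> dual_parts f = Cx g 0 \<Longrightarrow>
      cabs (dual_parts (cblinfun_apply T f)) \<le> M *\<^sub>R g"
    using T unfolding cideal_center_dual_def by blast
  have bl: "bounded_linear (\<lambda>u. T (dual_complexify u))"
    by (rule bounded_linear_compose[OF bounded_linear_cblinfun_apply bounded_linear_dual_complexify])
  define T1 where "T1 = Blinfun (\<lambda>u. rpart (dual_parts (T (dual_complexify u))))"
  define T2 where "T2 = Blinfun (\<lambda>u. ipart (dual_parts (T (dual_complexify u))))"
  have T12: "T1 u = rpart (dual_parts (T (dual_complexify u)))" "T2 u = ipart (dual_parts (T (dual_complexify u)))" for u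
    unfolding T1_def T2_def
    by (simp_all add: bounded_linear_Blinfun_apply bounded_linear_compose[OF bounded_linear_dual_parts(1) bl]
      bounded_linear_compose[OF bounded_linear_dual_parts(2) bl])
  have "\<bar>T1 u\<bar> \<le> M *\<^sub>R u" "\<bar>T2 u\<bar> \<le> M *\<^sub>R u" if "0 \<le> u" for u
    unfolding T12 using M(2)[OF that dual_parts_dual_complexify] abs_parts_le_cabs order_trans by blast+
  then have "T1 \<in> ideal_center" "T2 \<in> ideal_center" using M(1) unfolding ideal_center_def by blast+
  then obtain \<Phi>1 \<Phi>2 where \<Phi>12: "T1 = arens_ext real_hom \<Phi>1" "T2 = arens_ext real_hom \<Phi>2"
    using real.center_in_range_arens_ext by blast
  define \<psi>1 where "\<psi>1 \<psi> = Dual (Blinfun (\<lambda>a. Re (cblinfun_apply \<psi> (bembed a))))"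
    for \<psi> :: "('k \<Rightarrow>\<^sub>C complex) \<Rightarrow>\<^sub>C\<^sub>L complex"
  define \<psi>2 where "\<psi>2 \<psi> = Dual (Blinfun (\<lambda>a. Im (cblinfun_apply \<psi> (bembed a))))"
    for \<psi> :: "('k \<Rightarrow>\<^sub>C complex) \<Rightarrow>\<^sub>C\<^sub>L complex"
  have bl_embed: "bounded_linear (bembed :: ('k \<Rightarrow>\<^sub>C real) \<Rightarrow> ('k \<Rightarrow>\<^sub>C complex))"
    by (rule bounded_linear_intro[where K = 1]) (simp_all add: bembed_simps bembed_scaleR norm_bembed)
  have \<psi>12: "dual_apply (\<psi>1 \<psi>) a = Re (\<psi> (bembed a))" "dual_apply (\<psi>2 \<psi>) a = Im (\<psi> (bembed a))" for \<psi> a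
  proof -
    have bl: "bounded_linear (\<lambda>a. cblinfun_apply \<psi> (bembed a))"
      by (rule bounded_linear_compose[OF bounded_linear_cblinfun_apply bl_embed])
    show "dual_apply (\<psi>1 \<psi>) a = Re (\<psi> (bembed a))" "dual_apply (\<psi>2 \<psi>) a = Im (\<psi> (bembed a))"
      unfolding \<psi>1_def \<psi>2_def
      by (simp_all add: dual_apply_Dual bounded_linear_compose[OF bounded_linear_Re bl]
        bounded_linear_compose[OF bounded_linear_Im bl])
  qed
  have \<psi>_norm: "norm (\<psi>1 \<psi>) \<le> norm \<psi>" "norm (\<psi>2 \<psi>) \<le> norm \<psi>" for \<psi>
  proof -
    have "cmod (\<psi> (bembed a)) \<le> norm \<psi> * norm a" for a
      using norm_cblinfun_apply[of \<psi> "bembed a"] by (simp add: norm_bembed)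
    from order_trans[OF abs_Re_le_cmod this] order_trans[OF abs_Im_le_cmod this]
    show "norm (\<psi>1 \<psi>) \<le> norm \<psi>" "norm (\<psi>2 \<psi>) \<le> norm \<psi>"
      by (auto intro!: norm_dual_bound simp: \<psi>12)
  qed
  have \<psi>_add: "\<psi>1 (\<psi> + \<psi>') = \<psi>1 \<psi> + \<psi>1 \<psi>'" "\<psi>2 (\<psi> + \<psi>') = \<psi>2 \<psi> + \<psi>2 \<psi>'"
    and \<psi>_scaleR: "\<psi>1 (r *\<^sub>R \<psi>) = r *\<^sub>R \<psi>1 \<psi>" "\<psi>2 (r *\<^sub>R \<psi>) = r *\<^sub>R \<psi>2 \<psi>"
    and \<psi>_scaleC: "\<psi>1 (c *\<^sub>C \<psi>) = Re c *\<^sub>R \<psi>1 \<psi> - Im c *\<^sub>R \<psi>2 \<psi>" "\<psi>2 (c *\<^sub>C \<psi>) = Re c *\<^sub>R \<psi>2 \<psi> + Im c *\<^sub>R \<psi>1 \<psi>"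
    for \<psi> \<psi>' r c
    by (rule dual_eqI; simp add: \<psi>12 scaleC_complex_def)+
  have \<psi>_bl: "bounded_linear \<psi>1" "bounded_linear \<psi>2"
    by (rule bounded_linear_intro[where K = 1]; simp add: \<psi>_add \<psi>_scaleR \<psi>_norm)+
  define \<phi> where "\<phi> \<psi> = of_real (dual_apply \<Phi>1 (\<psi>1 \<psi>) - dual_apply \<Phi>2 (\<psi>2 \<psi>)) +
    \<i> * of_real (dual_apply \<Phi>1 (\<psi>2 \<psi>) + dual_apply \<Phi>2 (\<psi>1 \<psi>))" for \<psi>
  have "bounded_linear \<phi>"
    unfolding \<phi>_def
    by (intro bounded_linear_add bounded_linear_sub bounded_linear_const_mult
      bounded_linear_compose[OF bounded_linear_of_real]
      bounded_linear_compose[OF bounded_linear_dual_apply] \<psi>_bl)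
  moreover have "\<phi> (c *\<^sub>C \<psi>) = c *\<^sub>C \<phi> \<psi>" for c \<psi>
    unfolding \<phi>_def \<psi>_scaleC
    by (simp add: complex_eq_iff scaleC_complex_def dual_apply_add dual_apply_diff dual_apply_scaleR algebra_simps)
  ultimately have \<Phi>: "cblinfun_apply (CBlinfun \<phi>) = \<phi>" by (rule cblinfun_apply_CBlinfun)
  have "carens_ext m (CBlinfun \<phi>) f (Cx x 0) = T f (Cx x 0)" for f x
  proof -
    define u v where "u = rpart (dual_parts f)" and "v = ipart (dual_parts f)"
    have "\<psi>1 (carens_mu m (Cx x 0) f) = arens_mu real_hom x u" "\<psi>2 (carens_mu m (Cx x 0) f) = arens_mu real_hom x v"
      by (rule dual_eqI; simp add: \<psi>12 carens_mu_apply arens_mu_apply m_bembed u_def v_def dual_parts_apply)+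
    then have "carens_ext m (CBlinfun \<phi>) f (Cx x 0) =
        of_real (dual_apply (T1 u) x - dual_apply (T2 v) x) + \<i> * of_real (dual_apply (T1 v) x + dual_apply (T2 u) x)"
      by (simp add: carens_ext_apply \<Phi> \<phi>_def \<Phi>12 arens_ext_apply)
    also have "\<dots> = T (dual_complexify u) (Cx x 0) + \<i> *\<^sub>C T (dual_complexify v) (Cx x 0)"
      by (simp add: T12 dual_parts_apply scaleC_complex_def complex_eq_iff)
    moreover have "T f (Cx x 0) = T (dual_complexify u) (Cx x 0) + \<i> *\<^sub>C T (dual_complexify v) (Cx x 0)"
      by (subst dual_decompose[of f]) (simp add: cblinfun_apply_right u_def v_def)
    ultimately show ?thesis by simp
  qed
  then have "carens_ext m (CBlinfun \<phi>) = T" by (intro cblinfun_eqI[of _ T] cblinfun_eqI_real)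
  then show ?thesis by blast
qed

lemma center_eq_range_carens_ext: "cideal_center_dual = range (carens_ext m)"
  using carens_ext_in_center center_in_range_carens_ext by blast

lemma center_eq_cwot_closure: "cideal_center = cwot closure_of range m"
proof (intro equalityI subsetI)
  fix T :: "'e complexified \<Rightarrow>\<^sub>C\<^sub>L 'e complexified" assume "T \<in> cideal_center"
  from center_parts[OF this]
  have T: "re_op T \<in> wot closure_of range real_hom" "im_op T \<in> wot closure_of range real_hom"
    using real.center_eq_wot_closure by auto
  show "T \<in> cwot closure_of range m"
    unfolding cwot_closure_iff
  proof (intro allI impI)
    fix J :: "(('e complexified \<Rightarrow>\<^sub>C\<^sub>L complex) \<times> 'e complexified) set" and e :: real
    assume J: "finite J" and e: "0 < e"
    define P where "P f = {rpart (dual_parts f), ipart (dual_parts f)}" for f :: "'e complexified \<Rightarrow>\<^sub>C\<^sub>L complex"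
    define J' where "J' = (\<Union>(f, z)\<in>J. P f \<times> {rpart z, ipart z})"
    have J': "finite J'" using J by (auto simp: J'_def P_def)
    \<comment> \<open>Four real differences enter the real part of an entry and four the imaginary
      part.\<close>
    have e8: "0 < e / 8" using e by simp
    obtain a b where a: "\<forall>(f, x)\<in>J'. \<bar>dual_apply f (real_hom a x) - dual_apply f (re_op T x)\<bar> < e / 8"
      and b: "\<forall>(f, x)\<in>J'. \<bar>dual_apply f (real_hom b x) - dual_apply f (im_op T x)\<bar> < e / 8"
      using T J' e8 unfolding wot_closure_iff by blast
    define c :: "'k \<Rightarrow>\<^sub>C complex" where "c = bembed a + \<i> *\<^sub>C bembed b"
    have mc: "m c z = Cx (real_hom a (rpart z) - real_hom b (ipart z)) (real_hom a (ipart z) + real_hom b (rpart z))" for z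
      by (subst Cx_decompose[of z], rule complexified.expand)
         (simp add: c_def A_add_left A_add_right cblinfun_apply_right m_bembed)
    have Tz: "T z = Cx (re_op T (rpart z) - im_op T (ipart z)) (re_op T (ipart z) + im_op T (rpart z))" for z
      by (subst cblinfun_apply_decompose, rule complexified.expand) (simp add: re_op_apply im_op_apply)
    have "cmod (f (m c z) - f (T z)) < e" if "(f, z) \<in> J" for f z
    proof -
      have J'_I: "(u, x) \<in> J'" if "u \<in> P f" "x \<in> {rpart z, ipart z}" for u x
        using that \<open>(f, z) \<in> J\<close> by (auto simp: J'_def)
      have ab: "\<bar>dual_apply u (real_hom a x) - dual_apply u (re_op T x)\<bar> < e / 8"
        "\<bar>dual_apply u (real_hom b x) - dual_apply u (im_op T x)\<bar> < e / 8"
        if "u \<in> P f" "x \<in> {rpart z, ipart z}" for u x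
        using bspec[OF a J'_I[OF that]] bspec[OF b J'_I[OF that]] by simp_all
      define u v x y where "u = rpart (dual_parts f)" and "v = ipart (dual_parts f)"
        and "x = rpart z" and "y = ipart z"
      define \<alpha> \<beta> where "\<alpha> g p = dual_apply g (real_hom a p) - dual_apply g (re_op T p)"
        and "\<beta> g p = dual_apply g (real_hom b p) - dual_apply g (im_op T p)" for g p
      have parts: "Re (f (m c z) - f (T z)) = \<alpha> u x - \<beta> u y - \<alpha> v y - \<beta> v x"
        "Im (f (m c z) - f (T z)) = \<alpha> u y + \<beta> u x + \<alpha> v x - \<beta> v y"
        unfolding mc Tz dual_parts_apply_complex[of f] \<alpha>_def \<beta>_def u_def v_def x_def y_def
        by (simp_all add: dual_apply_add dual_apply_diff)
      have "\<bar>\<alpha> g p\<bar> < e / 8" "\<bar>\<beta> g p\<bar> < e / 8" if "g \<in> {u, v}" "p \<in> {x, y}" for g p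
        unfolding \<alpha>_def \<beta>_def
        by (rule ab; use that in \<open>simp add: u_def v_def x_def y_def P_def\<close>)+
      then have small: "\<bar>\<alpha> u x\<bar> < e / 8" "\<bar>\<alpha> u y\<bar> < e / 8" "\<bar>\<alpha> v x\<bar> < e / 8" "\<bar>\<alpha> v y\<bar> < e / 8"
        "\<bar>\<beta> u x\<bar> < e / 8" "\<bar>\<beta> u y\<bar> < e / 8" "\<bar>\<beta> v x\<bar> < e / 8" "\<bar>\<beta> v y\<bar> < e / 8"
        by blast+
      have "\<bar>Re (f (m c z) - f (T z))\<bar> < e / 2" "\<bar>Im (f (m c z) - f (T z))\<bar> < e / 2"
        unfolding parts using small unfolding abs_less_iff by linarith+
      then show ?thesis using cmod_le[of "f (m c z) - f (T z)"] by linarith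
    qed
    then show "\<exists>S\<in>range m. \<forall>(f, z)\<in>J. cmod (cblinfun_apply f (cblinfun_apply S z) - cblinfun_apply f (T z)) < e"
      by blast
  qed
next
  fix S :: "'e complexified \<Rightarrow>\<^sub>C\<^sub>L 'e complexified" assume "S \<in> cwot closure_of range m"
  then have S: "\<exists>c. \<forall>(f, z)\<in>J. cmod (cblinfun_apply f (m c z) - cblinfun_apply f (S z)) < e"
    if "finite J" "0 < e" for J e
    using that unfolding cwot_closure_iff by blast
  have "re_op S \<in> wot closure_of range real_hom \<and> im_op S \<in> wot closure_of range real_hom"
    unfolding wot_closure_iff
  proof (intro conjI allI impI)
    fix J :: "('e dual \<times> 'e) set" and e :: real assume J: "finite J" and e: "0 < e"
    obtain c where c: "\<forall>(f, z)\<in>(\<lambda>(g, x). (dual_complexify g, Cx x 0)) ` J.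
        cmod (cblinfun_apply f (m c z) - cblinfun_apply f (S z)) < e"
      using S[OF finite_imageI[OF J] e] by blast
    have *: "cmod (dual_complexify g (m c (Cx x 0)) - dual_complexify g (S (Cx x 0))) < e" if "(g, x) \<in> J" for g x
      using c that by force
    have "\<bar>dual_apply g (real_hom (bcomp Re c) x) - dual_apply g (re_op S x)\<bar> < e"
      "\<bar>dual_apply g (real_hom (bcomp Im c) x) - dual_apply g (im_op S x)\<bar> < e" if "(g, x) \<in> J" for g x
      using order_le_less_trans[OF abs_Re_le_cmod *[OF that]] order_le_less_trans[OF abs_Im_le_cmod *[OF that]]
      by (simp_all add: dual_complexify_apply m_real re_op_apply im_op_apply)
    then show "\<exists>T\<in>range real_hom. \<forall>(g, x)\<in>J. \<bar>dual_apply g (T x) - dual_apply g (re_op S x)\<bar> < e"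
      "\<exists>T\<in>range real_hom. \<forall>(g, x)\<in>J. \<bar>dual_apply g (T x) - dual_apply g (im_op S x)\<bar> < e"
      by blast+
  qed
  then show "S \<in> cideal_center"
    using real.center_eq_wot_closure by (intro center_of_parts) auto
qed

end

section \<open>From (2) to (1) for complex scalars\<close>

lemma complex_functional_of_real:
  fixes L :: "'v::complex_normed_vector dual"
  obtains h where "\<And>z. cblinfun_apply h z = of_real (dual_apply L z) - \<i> * of_real (dual_apply L (\<i> *\<^sub>C z))"
proof
  define h where "h z = of_real (dual_apply L z) - \<i> * of_real (dual_apply L (\<i> *\<^sub>C z))" for z
  have "bounded_linear h"
    unfolding h_def
    by (intro bounded_linear_sub bounded_linear_const_mult bounded_linear_compose[OF bounded_linear_of_real]
      bounded_linear_compose[OF bounded_linear_dual_apply] bounded_linear_scaleC bounded_linear_dual_apply)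
  moreover have "h (c *\<^sub>C z) = c *\<^sub>C h z" for c z
  proof -
    have c: "c *\<^sub>C z = Re c *\<^sub>R z + Im c *\<^sub>R (\<i> *\<^sub>C z)"
      by (subst complex_eq[of c]) (simp add: scaleC_add_left scaleC_scaleC[symmetric] scaleC_of_real
        mult.commute[of \<i>])
    have "\<i> *\<^sub>C (\<i> *\<^sub>C z) = - z"
      using scaleC_of_real[of "- 1" z] by (simp add: scaleC_scaleC)
    then have ic: "\<i> *\<^sub>C (c *\<^sub>C z) = Re c *\<^sub>R (\<i> *\<^sub>C z) - Im c *\<^sub>R z"
      unfolding c by (simp add: scaleC_add_right linear_scale[OF bounded_linear.linear[OF bounded_linear_scaleC]])
    show ?thesis
      unfolding h_def ic unfolding c
      by (simp add: complex_eq_iff scaleC_complex_def dual_apply_add dual_apply_diff dual_apply_scaleR)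
  qed
  ultimately show "cblinfun_apply (CBlinfun h) z = of_real (dual_apply L z) - \<i> * of_real (dual_apply L (\<i> *\<^sub>C z))" for z
    by (simp add: cblinfun_apply_CBlinfun) (simp add: h_def)
qed

text \<open>The complex linear extension of \<open>T\<close>; it turns the band projections of the
  real dual into tests for complex functionals.\<close>

lemma unit_center_complexify:
  fixes T :: "'e::banach_lattice dual \<Rightarrow>\<^sub>L 'e dual"
  assumes T: "T \<in> unit_center"
  obtains TC where "TC \<in> cideal_center_dual"
    "\<And>f. cblinfun_apply TC f = dual_complexify (T (rpart (dual_parts f))) + \<i> *\<^sub>C dual_complexify (T (ipart (dual_parts f)))"
proof -
  note lin = bounded_linear.linear[OF bounded_linear_dual_complexify]
  define t where "t f = dual_complexify (T (rpart (dual_parts f))) + \<i> *\<^sub>C dual_complexify (T (ipart (dual_parts f)))" for f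
  have "bounded_linear t"
    unfolding t_def
    by (intro bounded_linear_add bounded_linear_compose[OF bounded_linear_scaleC]
      bounded_linear_compose[OF bounded_linear_dual_complexify]
      bounded_linear_compose[OF blinfun.bounded_linear_right] bounded_linear_dual_parts)
  moreover have "t (c *\<^sub>C f) = c *\<^sub>C t f" for c f
    unfolding t_def
    by (rule cblinfun_eqI_real)
       (simp add: dual_parts_simps blinfun.bilinear_simps linear_add[OF lin] linear_diff[OF lin] linear_scale[OF lin]
         dual_complexify_apply scaleC_complex_def complex_eq_iff)
  ultimately have t: "cblinfun_apply (CBlinfun t) = t" by (rule cblinfun_apply_CBlinfun)
  show ?thesis
  proof
    have "cabs (dual_parts (t f)) \<le> 1 *\<^sub>R g" if "0 \<le> g" "dual_parts f = Cx g 0" for f g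
    proof -
      have "t f = dual_complexify (T g)" by (simp add: t_def that blinfun.zero_right linear_0[OF lin])
      then show ?thesis
        using unit_centerD[OF T that(1)] by (simp add: dual_parts_dual_complexify cabs_real abs_of_nonneg)
    qed
    then show "CBlinfun t \<in> cideal_center_dual"
      unfolding cideal_center_dual_def mem_Collect_eq t by (intro exI[of _ 1]) simp
    show "cblinfun_apply (CBlinfun t) f = dual_complexify (T (rpart (dual_parts f))) + \<i> *\<^sub>C dual_complexify (T (ipart (dual_parts f)))" for f
      by (simp add: t t_def)
  qed
qed

lemma ideals_if_center_in_range_carens_ext:
  fixes m :: "('k::t2_space \<Rightarrow>\<^sub>C complex) \<Rightarrow>\<^sub>C\<^sub>L ('e::banach_lattice complexified \<Rightarrow>\<^sub>C\<^sub>L 'e complexified)"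
  assumes center: "cideal_center_dual \<subseteq> range (carens_ext m)"
  shows "cclosed_invariant_are_ideals m"
  unfolding cclosed_invariant_are_ideals_def corder_ideal_def
proof (intro allI impI conjI ballI)
  fix F :: "'e complexified set" assume "csubspace F \<and> closed F \<and> (\<forall>a. m a ` F \<subseteq> F)"
  then have F: "csubspace F" "closed F" "\<And>a x. x \<in> F \<Longrightarrow> m a x \<in> F" by auto
  show "csubspace F" by (rule F(1))
  fix z w assume z: "z \<in> F" and wz: "cabs w \<le> cabs z"
  have "subspace F"
    using F(1) unfolding csubspace_def subspace_def by (metis scaleC_of_real)
  show "w \<in> F"
  proof (rule ccontr)
    assume "w \<notin> F"
    then obtain L where L: "\<And>v. v \<in> F \<Longrightarrow> dual_apply L v = 0" "dual_apply L w = 1"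
      using Hahn_Banach_separation[OF \<open>subspace F\<close> F(2)] by blast
    obtain h where h: "\<And>v. cblinfun_apply h v = of_real (dual_apply L v) - \<i> * of_real (dual_apply L (\<i> *\<^sub>C v))"
      by (rule complex_functional_of_real[of L]) blast
    have hF: "h v = 0" if "v \<in> F" for v
      using that F(1) L(1) unfolding h csubspace_def by simp
    define u v x y where "u = rpart (dual_parts h)" and "v = ipart (dual_parts h)"
      and "x = rpart z" and "y = ipart z"
    \<comment> \<open>The two conditions are the real and the imaginary part of
      \<open>TC h z = 0\<close>.\<close>
    have H: "dual_apply (T u) x = dual_apply (T v) y \<and> dual_apply (T u) y = - dual_apply (T v) x"
      if T: "T \<in> unit_center" for T
    proof -
      obtain TC where TC: "TC \<in> cideal_center_dual" "\<And>f. cblinfun_apply TC f =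
        dual_complexify (T (rpart (dual_parts f))) + \<i> *\<^sub>C dual_complexify (T (ipart (dual_parts f)))"
        by (rule unit_center_complexify[OF T]) blast
      obtain \<Phi> where "TC = carens_ext m \<Phi>" using TC(1) center by blast
      moreover have "carens_mu m z h = 0" by (rule cblinfun_eqI) (simp add: carens_mu_apply hF F(3) z)
      ultimately have "TC h z = 0" by (simp add: carens_ext_apply)
      then show ?thesis
        by (simp add: TC(2) dual_complexify_apply scaleC_complex_def complex_eq_iff u_def v_def x_def y_def)
    qed
    \<comment> \<open>Multiplying \<open>h\<close> or \<open>z\<close> by the imaginary unit
      preserves \<open>H\<close>; the four combinations cover all products of
      \<open>\<bar>u\<bar>\<close>, \<open>\<bar>v\<bar>\<close> with \<open>\<bar>x\<bar>\<close>,
      \<open>\<bar>y\<bar>\<close>.\<close>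
    have "dual_apply \<bar>u\<bar> \<bar>x\<bar> = 0" by (rule unit_center_annihilator[OF H])
    moreover have "dual_apply \<bar>- v\<bar> \<bar>x\<bar> = 0"
      by (rule unit_center_annihilator[of "- v" x u y]) (use H in \<open>simp add: blinfun.minus_right\<close>)
    moreover have "dual_apply \<bar>u\<bar> \<bar>- y\<bar> = 0"
      by (rule unit_center_annihilator[of u "- y" v x]) (use H in \<open>simp add: dual_apply_minus\<close>)
    moreover have "dual_apply \<bar>- v\<bar> \<bar>- y\<bar> = 0"
      by (rule unit_center_annihilator[of "- v" "- y" u x])
        (use H in \<open>simp add: blinfun.minus_right dual_apply_minus\<close>)
    ultimately have zero: "dual_apply \<bar>u\<bar> (\<bar>x\<bar> + \<bar>y\<bar>) = 0" "dual_apply \<bar>v\<bar> (\<bar>x\<bar> + \<bar>y\<bar>) = 0"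
      by (simp_all add: dual_apply_add)
    have "cabs w \<le> \<bar>x\<bar> + \<bar>y\<bar>" using wz cabs_le_parts[of z] unfolding x_def y_def by (rule order_trans)
    then have le: "\<bar>rpart w\<bar> \<le> \<bar>x\<bar> + \<bar>y\<bar>" "\<bar>ipart w\<bar> \<le> \<bar>x\<bar> + \<bar>y\<bar>"
      using abs_parts_le_cabs[of w] by (blast intro: order_trans)+
    have "dual_apply u (rpart w) = 0"
      using dual_abs_bound[of u "rpart w"] dual_mono[OF abs_ge_zero[of u] le(1)] zero(1) by simp
    moreover have "dual_apply v (ipart w) = 0"
      using dual_abs_bound[of v "ipart w"] dual_mono[OF abs_ge_zero[of v] le(2)] zero(2) by simp
    ultimately have "Re (h w) = 0" unfolding dual_parts_apply_complex[of h] by (simp add: u_def v_def)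
    then show False using L(2) by (simp add: h)
  qed
qed

theorem theorem1:
  fixes m :: "('k::t2_space \<Rightarrow>\<^sub>C real) \<Rightarrow>\<^sub>L
      ('e::banach_lattice \<Rightarrow>\<^sub>L 'e)"
    and mc :: "('k \<Rightarrow>\<^sub>C complex) \<Rightarrow>\<^sub>C\<^sub>L
      ('e complexified \<Rightarrow>\<^sub>C\<^sub>L 'e complexified)"
  assumes "compact (UNIV :: 'k set)"
  shows
    "(unital_hom m \<longrightarrow>
       (closed_invariant_are_ideals m \<longleftrightarrow> ideal_center = range (arens_ext m)) \<and>
       (ideal_center = range (arens_ext m) \<longrightarrow> ideal_center = wot closure_of range m) \<and>
       (closed_invariant_are_ideals m \<longrightarrow>
         (\<forall>a. (\<forall>t. 0 \<le> apply_bcontfun a t) \<longrightarrow> (\<forall>x\<ge>0. 0 \<le> m a x)) \<and>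
         (\<forall>a. norm (m a) \<le> norm a))) \<and>
     (cunital_hom mc \<longrightarrow>
       (cclosed_invariant_are_ideals mc \<longleftrightarrow> cideal_center_dual = range (carens_ext mc)) \<and>
       (cideal_center_dual = range (carens_ext mc) \<longrightarrow>
         cideal_center = cwot closure_of range mc) \<and>
       (cclosed_invariant_are_ideals mc \<longrightarrow>
         (\<forall>a. (\<forall>t. apply_bcontfun a t \<in> \<real>\<^sub>\<ge>\<^sub>0) \<longrightarrow> (\<forall>x\<ge>0. \<exists>y\<ge>0. mc a (Cx x 0) = Cx y 0)) \<and>
         (\<forall>a. norm (mc a) \<le> norm a)))"
proof (intro conjI impI)
  assume m: "unital_hom m"
  show "closed_invariant_are_ideals m \<longleftrightarrow> ideal_center = range (arens_ext m)"
    using ideal_hom.center_eq_range_arens_ext[OF ideal_hom.intro[OF m]]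
      ideals_if_center_in_range_arens_ext[of m] by blast
  \<comment> \<open>Statement (3) is reached through (1), which makes the order calculus of the
    action available.\<close>
  show "ideal_center = wot closure_of range m" if "ideal_center = range (arens_ext m)"
    using ideal_hom.center_eq_wot_closure[OF ideal_hom.intro[OF m ideals_if_center_in_range_arens_ext]]
      that by blast
  assume "closed_invariant_are_ideals m"
  with m interpret ideal_hom m by (rule ideal_hom.intro)
  show "\<forall>a. (\<forall>t. 0 \<le> apply_bcontfun a t) \<longrightarrow> (\<forall>x\<ge>0. 0 \<le> m a x)" by (simp add: nonneg)
  show "\<forall>a. norm (m a) \<le> norm a" by (intro allI norm_blinfun_bound contractive_norm norm_ge_zero)
next
  assume mc: "cunital_hom mc"
  show "cclosed_invariant_are_ideals mc \<longleftrightarrow> cideal_center_dual = range (carens_ext mc)"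
    using cideal_hom.center_eq_range_carens_ext[OF cideal_hom.intro[OF mc]]
      ideals_if_center_in_range_carens_ext[of mc] by blast
  show "cideal_center = cwot closure_of range mc" if "cideal_center_dual = range (carens_ext mc)"
    using cideal_hom.center_eq_cwot_closure[OF cideal_hom.intro[OF mc ideals_if_center_in_range_carens_ext]]
      that by blast
  assume "cclosed_invariant_are_ideals mc"
  with mc interpret cideal_hom mc by (rule cideal_hom.intro)
  show "\<forall>a. (\<forall>t. apply_bcontfun a t \<in> \<real>\<^sub>\<ge>\<^sub>0) \<longrightarrow> (\<forall>x\<ge>0. \<exists>y\<ge>0. mc a (Cx x 0) = Cx y 0)"
    by (simp add: positive)
  show "\<forall>a. norm (mc a) \<le> norm a" by (simp add: norm_contractive)
qed

end
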